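(* Let $\mathfrak g=\mathfrak g_{-3}\oplus\cdots\oplus\mathfrak g_3$ be the $\mathbb Z$-grading of $\mathfrak g=G(3)$ associated with $\mathfrak p_2^{\rm IV}$ and $\mathfrak m=\mathfrak g_{-3}\oplus\mathfrak g_{-2}\oplus\mathfrak g_{-1}$. Then: $H^{d,1}(\mathfrak m,\mathfrak g)=0$ for all $d\ge0$; $H^{d,2}(\mathfrak m,\mathfrak g)_{\bar0}=0$ for all $d>0$, $d\ne2$, and $H^{2,2}(\mathfrak m,\mathfrak g)_{\bar0}\cong S^2\mathbb C^2\boxtimes\Lambda^2\mathbb C^2$; $H^{d,2}(\mathfrak m,\mathfrak g)_{\bar1}=0$ for all $d>0$. Moreover, any cohomology class in $H^{2,2}(\mathfrak m,\mathfrak g)_{\bar0}$ admits a canonical representative $\varphi$ whose only nonzero components are $\varphi(\mathbf e_a,\boldsymbol\epsilon_{b\beta})=\varphi_{ab\beta}{}^\gamma\boldsymbol\epsilon_\gamma\in(\mathfrak g_0)_{\bar1}$ (for $\mathbf e_a\in(\mathfrak g_{-1})_{\bar0}$), $\varphi(\boldsymbol\epsilon_{a\alpha},\boldsymbol\epsilon_{b\beta})=\varphi_{a\alpha b\beta}{}^{\mathfrak{sl}(2)}+\varphi_{a\alpha b\beta}{}^{\mathfrak{sp}(2)}\in\mathfrak{sl}(2)\oplus\mathfrak{sp}(2)\subset(\mathfrak g_0)_{\bar0}$, $\varphi(\boldsymbol\epsilon_\alpha,\mathbf e_a)=\varphi_{\alpha a}{}^{b\beta}\boldsymbol\epsilon_{b\beta}\in(\mathfrak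 g_{-1})_{\bar1}$ (for $\boldsymbol\epsilon_\alpha\in(\mathfrak g_{-2})_{\bar1}$, $\mathbf e_a\in(\mathfrak g_{-1})_{\bar0}$), $\varphi(\boldsymbol\epsilon_{a\alpha},\mathbf e_b)=\varphi_{a\alpha b}{}^\gamma\boldsymbol\epsilon_\gamma\in(\mathfrak g_{-2})_{\bar1}$ (for $\mathbf e_b\in\mathfrak g_{-3}$), which (after lowering all indices) are symmetric in the latin indices and skew-symmetric in the greek indices, and which are all determined by $\varphi_{ab\beta}{}^\gamma$ via $\varphi_{b\beta a}{}^\gamma=-2\varphi_{ab\beta}{}^\gamma$, $\ \varphi_{\alpha cb\beta}=\varphi_{cb\beta\alpha}$, $\varphi_{a\alpha b\beta}{}^{\mathfrak{sl}(2)}(\mathbf e_c)=-2\varphi_{cb\beta\alpha}\mathbf e_a-2\varphi_{ca\alpha\beta}\mathbf e_b$, $\varphi_{a\alpha b\beta}{}^{\mathfrak{sp}(2)}(\boldsymbol\epsilon_\gamma)=-2\omega_{\alpha\gamma}\varphi_{ab\beta}{}^\delta\boldsymbol\epsilon_\delta-2\omega_{\beta\gamma}\varphi_{ba\alpha}{}^\delta\boldsymbol\epsilon_\delta$, where $\mathbf e_c\in\mathbb C^2\boxtimes\mathbb C$ and $\boldsymbol\epsilon_\gamma\in\mathbb C\boxtimes\mathbb C^2$ (summation over repeated indices).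
   Context: $G(3)$: complex exceptional simple Lie superalgebra of dimension $(17|14)$, $\mathfrak g_{\bar0}=G(2)\oplus\mathfrak{sp}(2)$, $\mathfrak g_{\bar1}=\mathbb C^7\boxtimes\mathbb C^2$. With even roots $\pm2\delta,\pm\epsilon_i,\epsilon_i-\epsilon_j$ and odd roots $\pm\delta,\pm\delta\pm\epsilon_i$ ($\epsilon_1+\epsilon_2+\epsilon_3=0$), take simple roots $\alpha_1=\epsilon_2-\epsilon_1,\alpha_2=\epsilon_1-\delta,\alpha_3=\delta$ with dual basis $\mathsf Z_1,\mathsf Z_2,\mathsf Z_3$; the grading is the eigenspace decomposition of $\mathrm{ad}\,\mathsf Z_2$. Then $\mathfrak g_0=\mathbb C\mathsf Z_2\oplus\mathfrak{sl}(2)\oplus\mathfrak{osp}(1|2)$, $(\mathfrak g_0)_{\bar0}=\mathbb C\mathsf Z_2\oplus\mathfrak{sl}(2)\oplus\mathfrak{sp}(2)$, and as $\mathfrak{sl}(2)\oplus\mathfrak{sp}(2)$-modules: $(\mathfrak g_{-1})_{\bar0}\cong\mathbb C^2\boxtimes\mathbb C$, $(\mathfrak g_{-1})_{\bar1}\cong\mathbb C^2\boxtimes\mathbb C^2$, $(\mathfrak g_{-2})_{\bar0}\cong\mathbb C\boxtimes\mathbb C$, $(\mathfrak g_{-2})_{\bar1}\cong\mathbb C\boxtimes\mathbb C^2$, $\mathfrak g_{-3}=(\mathfrak g_{-3})_{\bar0}\cong\mathbb C^2\boxtimes\mathbb C$, $(\mathfrak g_0)_{\bar1}\cong\mathbb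 C\boxtimes\mathbb C^2$. Fix symplectic bases $(\mathbf e_1,\mathbf e_2)$ of $\mathbb C^2\boxtimes\mathbb C$ (used both for $(\mathfrak g_{-1})_{\bar0}$ and for $\mathfrak g_{-3}$) and $(\boldsymbol\epsilon_1,\boldsymbol\epsilon_2)$ of $\mathbb C\boxtimes\mathbb C^2$ (used for $(\mathfrak g_{-2})_{\bar1}$ and $(\mathfrak g_0)_{\bar1}$) with $\omega_{12}=\omega^{12}=1$, a basis $\mathbb 1$ of $(\mathfrak g_{-2})_{\bar0}$, and $\boldsymbol\epsilon_{a\alpha}=\mathbf e_a\boxtimes\boldsymbol\epsilon_\alpha$ of $(\mathfrak g_{-1})_{\bar1}$. Indices are raised/lowered by $X^a=X_b\omega^{ba}$, $X_a=\omega_{ab}X^b$ (same for greek). The nonzero brackets of $\mathfrak m$ are $[\mathbf e_a,\mathbf e_b]=\omega_{ab}\mathbb 1$, $[\mathbf e_a,\boldsymbol\epsilon_{b\beta}]=\omega_{ab}\boldsymbol\epsilon_\beta$, $[\boldsymbol\epsilon_{a\alpha},\boldsymbol\epsilon_{b\beta}]=\omega_{ab}\omega_{\alpha\beta}\mathbb 1$ (values in $\mathfrak g_{-2}$), $[\mathbf e_a,\mathbb 1]=\mathbf e_a$, $[\boldsymbol\epsilon_{a\alpha},\boldsymbol\epsilon_\beta]=\omega_{\alpha\beta}\mathbf e_a$ (values in $\mathfrak g_{-3}$); $\boldsymbol\epsilon_\gamma\in(\mathfrak g_0)_{\bar1}$ acts by $[\boldsymbol\epsilon_\gamma,\mathbf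 e_a]=\boldsymbol\epsilon_{a\gamma}$, $[\boldsymbol\epsilon_\gamma,\boldsymbol\epsilon_{a\alpha}]=-2\omega_{\gamma\alpha}\mathbf e_a$, $[\boldsymbol\epsilon_\gamma,\mathbb 1]=2\boldsymbol\epsilon_\gamma$, $[\boldsymbol\epsilon_\gamma,\boldsymbol\epsilon_\beta]=-\omega_{\gamma\beta}\mathbb 1$. Spencer cohomology $H^{d,n}(\mathfrak m,\mathfrak g)$: degree-$d$ part of the Chevalley–Eilenberg cohomology of $\mathfrak m$ with values in the adjoint module ($\mathfrak g_j^*$ of degree $-j$); isomorphisms are of $\mathfrak{sl}(2)\oplus\mathfrak{sp}(2)$-modules. *)

theory Defs
  imports Complex_Main
begin

text \<open>
  We work with a fixed homogeneous basis b_0, ..., b_30 of g = G(3) (complex, dimension (17|14)),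
  adapted to the Z-grading g = g_-3 + ... + g_3 given by ad Z_2 (parabolic p_2^IV).
  Index / degree / parity of the basis vectors:
   0  f1  (degree -3, parity 0)
   1  f2  (degree -3, parity 0)
   2  one  (degree -2, parity 0)
   3  eps1  (degree -2, parity 1)
   4  eps2  (degree -2, parity 1)
   5  e1  (degree -1, parity 0)
   6  e2  (degree -1, parity 0)
   7  eps11  (degree -1, parity 1)
   8  eps12  (degree -1, parity 1)
   9  eps21  (degree -1, parity 1)
  10  eps22  (degree -1, parity 1)
  11  Z  (degree 0, parity 0)
  12  slH  (degree 0, parity 0)
  13  slE  (degree 0, parity 0)
  14  slF  (degree 0, parity 0)
  15  spH  (degree 0, parity 0)
  16  spE  (degree 0, parity 0)
  17  spF  (degree 0, parity 0)
  18  epsg1  (degree 0, parity 1)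
  19  epsg2  (degree 0, parity 1)
  20  g1_0_0  (degree 1, parity 0)
  21  g1_0_1  (degree 1, parity 0)
  22  g1_1_0  (degree 1, parity 1)
  23  g1_1_1  (degree 1, parity 1)
  24  g1_1_2  (degree 1, parity 1)
  25  g1_1_3  (degree 1, parity 1)
  26  g2_0_0  (degree 2, parity 0)
  27  g2_1_0  (degree 2, parity 1)
  28  g2_1_1  (degree 2, parity 1)
  29  g3_0_0  (degree 3, parity 0)
  30  g3_0_1  (degree 3, parity 0)

  Meaning of the indices 0..19 (a, b, alpha, beta, gamma range over {1,2}):
    ix_f a        = e_a in g_-3                       (indices 0,1)
    ix_one        = the basis vector 1 of (g_-2)_even   (index 2)
    ix_eps2 alpha = eps_alpha in (g_-2)_odd             (indices 3,4)
    ix_e a        = e_a in (g_-1)_even                  (indices 5,6)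
    ix_eps1 a alpha = eps_{a alpha} in (g_-1)_odd       (indices 7..10)
    ix_Z          = grading element Z_2                 (index 11)
    12,13,14      = H,E,F of sl(2), acting on the latin index (standard matrices)
    15,16,17      = H,E,F of sp(2), acting on the greek index
    ix_eps0 gamma = eps_gamma in (g_0)_odd              (indices 18,19)
  The brackets of m = g_-3 + g_-2 + g_-1 and the action of the eps_gamma on m are exactly the
  ones fixed in the paper; g_0 is the algebra of degree-0 derivations of m (Z, sl(2), sp(2),
  eps_1, eps_2), and g_1, g_2, g_3 (dimensions (2|4), (1|2), (2|0)) were obtained as the
  (super) Tanaka prolongation; the super Jacobi identity holds for the table below.
  The structure constants: [b_i, b_j] = sum_k g3sc i j k b_k.
\<close>

definition g3_table :: "((nat \<times> nat \<times> nat) \<times> complex) list" where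
  "g3_table = [
    ((0,11,0), (3)),
    ((0,12,0), (-1)),
    ((0,14,1), (-1)),
    ((0,20,2), (3/2)),
    ((0,22,4), (-1)),
    ((0,23,3), (1)),
    ((0,26,5), (-1)),
    ((0,27,8), (-(3/2))),
    ((0,28,7), (3/2)),
    ((0,29,11), (3/4)),
    ((0,29,12), (-(3/4))),
    ((0,30,13), (-(3/2))),
    ((1,11,1), (3)),
    ((1,12,1), (1)),
    ((1,13,0), (-1)),
    ((1,21,2), (3/2)),
    ((1,24,3), (3/2)),
    ((1,25,4), (3/4)),
    ((1,26,6), (-1)),
    ((1,27,10), (-(3/2))),
    ((1,28,9), (3/2)),
    ((1,29,14), (-(3/2))),
    ((1,30,11), (3/4)),
    ((1,30,12), (3/4)),
    ((2,5,0), (-1)),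
    ((2,6,1), (-1)),
    ((2,11,2), (2)),
    ((2,18,3), (-2)),
    ((2,19,4), (-2)),
    ((2,20,6), (2)),
    ((2,21,5), (-2)),
    ((2,22,10), (-(1/3))),
    ((2,23,9), (1/3)),
    ((2,24,7), (-(1/2))),
    ((2,25,8), (-(1/4))),
    ((2,26,11), (1/3)),
    ((2,27,19), (1)),
    ((2,28,18), (-1)),
    ((2,29,20), (1)),
    ((2,30,21), (1)),
    ((3,8,0), (-1)),
    ((3,10,1), (-1)),
    ((3,11,3), (2)),
    ((3,15,3), (-1)),
    ((3,17,4), (-1)),
    ((3,19,2), (1)),
    ((3,20,9), (1/2)),
    ((3,21,7), (-(1/2))),
    ((3,22,6), (-(1/3))),
    ((3,25,5), (-(1/4))),
    ((3,26,18), (-(1/3))),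
    ((3,27,11), (1/2)),
    ((3,27,15), (1)),
    ((3,28,16), (2)),
    ((3,29,23), (3/2)),
    ((3,30,24), (1)),
    ((4,7,0), (1)),
    ((4,9,1), (1)),
    ((4,11,4), (2)),
    ((4,15,4), (1)),
    ((4,16,3), (-1)),
    ((4,18,2), (-1)),
    ((4,20,10), (1/2)),
    ((4,21,8), (-(1/2))),
    ((4,23,6), (-(1/3))),
    ((4,24,5), (1/2)),
    ((4,26,19), (-(1/3))),
    ((4,27,17), (2)),
    ((4,28,11), (1/2)),
    ((4,28,15), (-1)),
    ((4,29,22), (-(3/2))),
    ((4,30,25), (2)),
    ((5,2,0), (1)),
    ((5,6,2), (1)),
    ((5,9,3), (1)),
    ((5,10,4), (1)),
    ((5,11,5), (1)),
    ((5,12,5), (-1)),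
    ((5,14,6), (-1)),
    ((5,18,7), (-1)),
    ((5,19,8), (-1)),
    ((5,20,11), (1/4)),
    ((5,20,12), (-(3/4))),
    ((5,21,13), (-(3/2))),
    ((5,22,19), (-(1/3))),
    ((5,23,18), (1/3)),
    ((5,26,21), (-(2/3))),
    ((5,27,25), (-2)),
    ((5,28,24), (1)),
    ((5,29,26), (-(3/2))),
    ((6,2,1), (1)),
    ((6,5,2), (-1)),
    ((6,7,3), (-1)),
    ((6,8,4), (-1)),
    ((6,11,6), (1)),
    ((6,12,6), (1)),
    ((6,13,5), (-1)),
    ((6,18,9), (-1)),
    ((6,19,10), (-1)),
    ((6,20,14), (-(3/2))),
    ((6,21,11), (1/4)),
    ((6,21,12), (3/4)),
    ((6,24,18), (1/2)),
    ((6,25,19), (1/4)),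
    ((6,26,20), (2/3)),
    ((6,27,22), (-(3/2))),
    ((6,28,23), (-(3/2))),
    ((6,30,26), (-(3/2))),
    ((7,4,0), (1)),
    ((7,6,3), (1)),
    ((7,10,2), (1)),
    ((7,11,7), (1)),
    ((7,12,7), (-1)),
    ((7,14,9), (-1)),
    ((7,15,7), (-1)),
    ((7,17,8), (-1)),
    ((7,19,5), (2)),
    ((7,20,18), (-1)),
    ((7,22,11), (-(1/6))),
    ((7,22,12), (1/2)),
    ((7,22,15), (-(2/3))),
    ((7,23,16), (-(4/3))),
    ((7,25,13), (-(3/4))),
    ((7,26,24), (-(2/3))),
    ((7,27,21), (-1)),
    ((7,29,28), (1)),
    ((8,3,0), (-1)),
    ((8,6,4), (1)),
    ((8,9,2), (-1)),
    ((8,11,8), (1)),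
    ((8,12,8), (-1)),
    ((8,14,10), (-1)),
    ((8,15,8), (1)),
    ((8,16,7), (-1)),
    ((8,18,5), (-2)),
    ((8,20,19), (-1)),
    ((8,22,17), (-(4/3))),
    ((8,23,11), (-(1/6))),
    ((8,23,12), (1/2)),
    ((8,23,15), (2/3)),
    ((8,24,13), (3/2)),
    ((8,26,25), (-(4/3))),
    ((8,28,21), (-1)),
    ((8,29,27), (-1)),
    ((9,4,1), (1)),
    ((9,5,3), (-1)),
    ((9,8,2), (-1)),
    ((9,11,9), (1)),
    ((9,12,9), (1)),
    ((9,13,7), (-1)),
    ((9,15,9), (-1)),
    ((9,17,10), (-1)),
    ((9,19,6), (2)),
    ((9,21,18), (-1)),
    ((9,22,14), (1)),
    ((9,24,16), (-2)),
    ((9,25,11), (1/8)),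
    ((9,25,12), (3/8)),
    ((9,25,15), (1/2)),
    ((9,26,23), (1)),
    ((9,27,20), (1)),
    ((9,30,28), (1)),
    ((10,3,1), (-1)),
    ((10,5,4), (-1)),
    ((10,7,2), (1)),
    ((10,11,10), (1)),
    ((10,12,10), (1)),
    ((10,13,8), (-1)),
    ((10,15,10), (1)),
    ((10,16,9), (-1)),
    ((10,18,6), (-2)),
    ((10,21,19), (-1)),
    ((10,23,14), (1)),
    ((10,24,11), (-(1/4))),
    ((10,24,12), (-(3/4))),
    ((10,24,15), (1)),
    ((10,25,17), (1)),
    ((10,26,22), (-1)),
    ((10,28,20), (1)),
    ((10,30,27), (-1)),
    ((11,0,0), (-3)),
    ((11,1,1), (-3)),
    ((11,2,2), (-2)),
    ((11,3,3), (-2)),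
    ((11,4,4), (-2)),
    ((11,5,5), (-1)),
    ((11,6,6), (-1)),
    ((11,7,7), (-1)),
    ((11,8,8), (-1)),
    ((11,9,9), (-1)),
    ((11,10,10), (-1)),
    ((11,20,20), (1)),
    ((11,21,21), (1)),
    ((11,22,22), (1)),
    ((11,23,23), (1)),
    ((11,24,24), (1)),
    ((11,25,25), (1)),
    ((11,26,26), (2)),
    ((11,27,27), (2)),
    ((11,28,28), (2)),
    ((11,29,29), (3)),
    ((11,30,30), (3)),
    ((12,0,0), (1)),
    ((12,1,1), (-1)),
    ((12,5,5), (1)),
    ((12,6,6), (-1)),
    ((12,7,7), (1)),
    ((12,8,8), (1)),
    ((12,9,9), (-1)),
    ((12,10,10), (-1)),
    ((12,13,13), (2)),
    ((12,14,14), (-2)),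
    ((12,20,20), (-1)),
    ((12,21,21), (1)),
    ((12,22,22), (-1)),
    ((12,23,23), (-1)),
    ((12,24,24), (1)),
    ((12,25,25), (1)),
    ((12,29,29), (-1)),
    ((12,30,30), (1)),
    ((13,1,0), (1)),
    ((13,6,5), (1)),
    ((13,9,7), (1)),
    ((13,10,8), (1)),
    ((13,12,13), (-2)),
    ((13,14,12), (1)),
    ((13,20,21), (-1)),
    ((13,22,25), (4/3)),
    ((13,23,24), (-(2/3))),
    ((13,29,30), (-1)),
    ((14,0,1), (1)),
    ((14,5,6), (1)),
    ((14,7,9), (1)),
    ((14,8,10), (1)),
    ((14,12,14), (2)),
    ((14,13,12), (-1)),
    ((14,21,20), (-1)),
    ((14,24,23), (-(3/2))),
    ((14,25,22), (3/4)),
    ((14,30,29), (-1)),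
    ((15,3,3), (1)),
    ((15,4,4), (-1)),
    ((15,7,7), (1)),
    ((15,8,8), (-1)),
    ((15,9,9), (1)),
    ((15,10,10), (-1)),
    ((15,16,16), (2)),
    ((15,17,17), (-2)),
    ((15,18,18), (1)),
    ((15,19,19), (-1)),
    ((15,22,22), (-1)),
    ((15,23,23), (1)),
    ((15,24,24), (1)),
    ((15,25,25), (-1)),
    ((15,27,27), (-1)),
    ((15,28,28), (1)),
    ((16,4,3), (1)),
    ((16,8,7), (1)),
    ((16,10,9), (1)),
    ((16,15,16), (-2)),
    ((16,17,15), (1)),
    ((16,19,18), (1)),
    ((16,22,23), (-1)),
    ((16,25,24), (1/2)),
    ((16,27,28), (-1)),
    ((17,3,4), (1)),
    ((17,7,8), (1)),
    ((17,9,10), (1)),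
    ((17,15,17), (2)),
    ((17,16,15), (-1)),
    ((17,18,19), (1)),
    ((17,23,22), (-1)),
    ((17,24,25), (2)),
    ((17,28,27), (-1)),
    ((18,2,3), (2)),
    ((18,4,2), (-1)),
    ((18,5,7), (1)),
    ((18,6,9), (1)),
    ((18,8,5), (-2)),
    ((18,10,6), (-2)),
    ((18,15,18), (-1)),
    ((18,17,19), (-1)),
    ((18,18,16), (-4)),
    ((18,19,15), (2)),
    ((18,20,23), (3)),
    ((18,21,24), (2)),
    ((18,22,20), (2/3)),
    ((18,25,21), (-(1/2))),
    ((18,26,28), (-(2/3))),
    ((18,27,26), (-3)),
    ((19,2,4), (2)),
    ((19,3,2), (1)),
    ((19,5,8), (1)),
    ((19,6,10), (1)),
    ((19,7,5), (2)),
    ((19,9,6), (2)),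
    ((19,15,19), (1)),
    ((19,16,18), (-1)),
    ((19,18,15), (2)),
    ((19,19,17), (4)),
    ((19,20,22), (-3)),
    ((19,21,25), (4)),
    ((19,23,20), (2/3)),
    ((19,24,21), (1)),
    ((19,26,27), (2/3)),
    ((19,28,26), (-3)),
    ((20,0,2), (-(3/2))),
    ((20,2,6), (-2)),
    ((20,3,9), (-(1/2))),
    ((20,4,10), (-(1/2))),
    ((20,5,11), (-(1/4))),
    ((20,5,12), (3/4)),
    ((20,6,14), (3/2)),
    ((20,7,18), (1)),
    ((20,8,19), (1)),
    ((20,11,20), (-1)),
    ((20,12,20), (1)),
    ((20,13,21), (1)),
    ((20,18,23), (-3)),
    ((20,19,22), (3)),
    ((20,21,26), (3)),
    ((20,24,28), (-(1/2))),
    ((20,25,27), (1/4)),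
    ((20,26,29), (1)),
    ((21,1,2), (-(3/2))),
    ((21,2,5), (2)),
    ((21,3,7), (1/2)),
    ((21,4,8), (1/2)),
    ((21,5,13), (3/2)),
    ((21,6,11), (-(1/4))),
    ((21,6,12), (-(3/4))),
    ((21,9,18), (1)),
    ((21,10,19), (1)),
    ((21,11,21), (-1)),
    ((21,12,21), (-1)),
    ((21,14,20), (1)),
    ((21,18,24), (-2)),
    ((21,19,25), (-4)),
    ((21,20,26), (-3)),
    ((21,22,27), (1/3)),
    ((21,23,28), (1/3)),
    ((21,26,30), (1)),
    ((22,0,4), (1)),
    ((22,2,10), (1/3)),
    ((22,3,6), (-(1/3))),
    ((22,5,19), (1/3)),
    ((22,7,11), (-(1/6))),
    ((22,7,12), (1/2)),
    ((22,7,15), (-(2/3))),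
    ((22,8,17), (-(4/3))),
    ((22,9,14), (1)),
    ((22,11,22), (-1)),
    ((22,12,22), (1)),
    ((22,13,25), (-(4/3))),
    ((22,15,22), (1)),
    ((22,16,23), (1)),
    ((22,18,20), (2/3)),
    ((22,21,27), (-(1/3))),
    ((22,24,26), (1/2)),
    ((22,28,29), (-1)),
    ((23,0,3), (-1)),
    ((23,2,9), (-(1/3))),
    ((23,4,6), (-(1/3))),
    ((23,5,18), (-(1/3))),
    ((23,7,16), (-(4/3))),
    ((23,8,11), (-(1/6))),
    ((23,8,12), (1/2)),
    ((23,8,15), (2/3)),
    ((23,10,14), (1)),
    ((23,11,23), (-1)),
    ((23,12,23), (1)),
    ((23,13,24), (2/3)),
    ((23,15,23), (-1)),
    ((23,17,22), (1)),
    ((23,19,20), (2/3)),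
    ((23,21,28), (-(1/3))),
    ((23,25,26), (1/4)),
    ((23,27,29), (1)),
    ((24,1,3), (-(3/2))),
    ((24,2,7), (1/2)),
    ((24,4,5), (1/2)),
    ((24,6,18), (-(1/2))),
    ((24,8,13), (3/2)),
    ((24,9,16), (-2)),
    ((24,10,11), (-(1/4))),
    ((24,10,12), (-(3/4))),
    ((24,10,15), (1)),
    ((24,11,24), (-1)),
    ((24,12,24), (-1)),
    ((24,14,23), (3/2)),
    ((24,15,24), (-1)),
    ((24,17,25), (-2)),
    ((24,19,21), (1)),
    ((24,20,28), (1/2)),
    ((24,22,26), (1/2)),
    ((24,27,30), (3/2)),
    ((25,1,4), (-(3/4))),
    ((25,2,8), (1/4)),
    ((25,3,5), (-(1/4))),
    ((25,6,19), (-(1/4))),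
    ((25,7,13), (-(3/4))),
    ((25,9,11), (1/8)),
    ((25,9,12), (3/8)),
    ((25,9,15), (1/2)),
    ((25,10,17), (1)),
    ((25,11,25), (-1)),
    ((25,12,25), (-1)),
    ((25,14,22), (-(3/4))),
    ((25,15,25), (1)),
    ((25,16,24), (-(1/2))),
    ((25,18,21), (-(1/2))),
    ((25,20,27), (-(1/4))),
    ((25,23,26), (1/4)),
    ((25,28,30), (3/4)),
    ((26,0,5), (1)),
    ((26,1,6), (1)),
    ((26,2,11), (-(1/3))),
    ((26,3,18), (1/3)),
    ((26,4,19), (1/3)),
    ((26,5,21), (2/3)),
    ((26,6,20), (-(2/3))),
    ((26,7,24), (2/3)),
    ((26,8,25), (4/3)),
    ((26,9,23), (-1)),
    ((26,10,22), (1)),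
    ((26,11,26), (-2)),
    ((26,18,28), (2/3)),
    ((26,19,27), (-(2/3))),
    ((26,20,29), (-1)),
    ((26,21,30), (-1)),
    ((27,0,8), (3/2)),
    ((27,1,10), (3/2)),
    ((27,2,19), (-1)),
    ((27,3,11), (1/2)),
    ((27,3,15), (1)),
    ((27,4,17), (2)),
    ((27,5,25), (2)),
    ((27,6,22), (3/2)),
    ((27,7,21), (-1)),
    ((27,9,20), (1)),
    ((27,11,27), (-2)),
    ((27,15,27), (1)),
    ((27,16,28), (1)),
    ((27,18,26), (-3)),
    ((27,23,29), (1)),
    ((27,24,30), (3/2)),
    ((28,0,7), (-(3/2))),
    ((28,1,9), (-(3/2))),
    ((28,2,18), (1)),
    ((28,3,16), (2)),
    ((28,4,11), (1/2)),
    ((28,4,15), (-1)),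
    ((28,5,24), (-1)),
    ((28,6,23), (3/2)),
    ((28,8,21), (-1)),
    ((28,10,20), (1)),
    ((28,11,28), (-2)),
    ((28,15,28), (-1)),
    ((28,17,27), (1)),
    ((28,19,26), (-3)),
    ((28,22,29), (-1)),
    ((28,25,30), (3/4)),
    ((29,0,11), (-(3/4))),
    ((29,0,12), (3/4)),
    ((29,1,14), (3/2)),
    ((29,2,20), (-1)),
    ((29,3,23), (-(3/2))),
    ((29,4,22), (3/2)),
    ((29,5,26), (3/2)),
    ((29,7,28), (-1)),
    ((29,8,27), (1)),
    ((29,11,29), (-3)),
    ((29,12,29), (1)),
    ((29,13,30), (1)),
    ((30,0,13), (3/2)),
    ((30,1,11), (-(3/4))),
    ((30,1,12), (-(3/4))),
    ((30,2,21), (-1)),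
    ((30,3,24), (-1)),
    ((30,4,25), (-2)),
    ((30,6,26), (3/2)),
    ((30,9,28), (-1)),
    ((30,10,27), (1)),
    ((30,11,30), (-3)),
    ((30,12,30), (-1)),
    ((30,14,29), (1)) ]"

definition g3sc :: "nat \<Rightarrow> nat \<Rightarrow> nat \<Rightarrow> complex" where
  "g3sc i j k = (case map_of g3_table (i, j, k) of Some c \<Rightarrow> c | None \<Rightarrow> 0)"

definition gdeg :: "nat \<Rightarrow> int" where
  "gdeg i = [-3, -3, -2, -2, -2, -1, -1, -1, -1, -1, -1, 0, 0, 0, 0, 0, 0, 0, 0, 0, 1, 1, 1, 1, 1, 1, 2, 2, 2, 3, 3] ! i"

definition gpar :: "nat \<Rightarrow> nat" where
  "gpar i = [0, 0, 0, 1, 1, 0, 0, 1, 1, 1, 1, 0, 0, 0, 0, 0, 0, 0, 1, 1, 0, 0, 1, 1, 1, 1, 0, 1, 1, 0, 0] ! i"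

definition G3B :: "nat set" where "G3B = {..<31}"        \<comment> \<open>basis of g\<close>
definition G3M :: "nat set" where "G3M = {..<11}"        \<comment> \<open>basis of m = g_-3 + g_-2 + g_-1\<close>

definition idx2 :: "nat set" where "idx2 = {1, 2}"

definition ix_f :: "nat \<Rightarrow> nat" where "ix_f a = a - 1"
definition ix_one :: nat where "ix_one = 2"
definition ix_eps2 :: "nat \<Rightarrow> nat" where "ix_eps2 al = 2 + al"
definition ix_e :: "nat \<Rightarrow> nat" where "ix_e a = 4 + a"
definition ix_eps1 :: "nat \<Rightarrow> nat \<Rightarrow> nat" where "ix_eps1 a al = 4 + 2 * a + al"
definition ix_Z :: nat where "ix_Z = 11"
definition ix_eps0 :: "nat \<Rightarrow> nat" where "ix_eps0 ga = 17 + ga"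

definition sl2_idx :: "nat set" where "sl2_idx = {12, 13, 14}"
definition sp2_idx :: "nat set" where "sp2_idx = {15, 16, 17}"

definition omega :: "nat \<Rightarrow> nat \<Rightarrow> complex" where
  "omega a b = (if a = 1 \<and> b = 2 then 1 else if a = 2 \<and> b = 1 then -1 else 0)"

text \<open>Elements of g are coefficient vectors w.r.t. the basis (supported in G3B).\<close>
type_synonym g3vec = "nat \<Rightarrow> complex"

definition bv :: "nat \<Rightarrow> g3vec" where "bv i = (\<lambda>k. if k = i then 1 else 0)"

definition gbr :: "g3vec \<Rightarrow> g3vec \<Rightarrow> g3vec" where
  "gbr u v = (\<lambda>k. \<Sum>i\<in>G3B. \<Sum>j\<in>G3B. u i * v j * g3sc i j k)"

definition ssgn :: "nat \<Rightarrow> complex" where "ssgn n = (-1) ^ n"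

text \<open>
  Cochains are homogeneous w.r.t. degree d (g_j^* has degree -j) and parity p (0 = even, 1 = odd).
  A 1-cochain psi: m -> g is given by its values psi i on the basis vectors b_i of m;
  a 2-cochain phi is super-skew-symmetric, given by its values phi i j on pairs of basis vectors.
\<close>

definition is_gvec :: "int \<Rightarrow> nat \<Rightarrow> g3vec \<Rightarrow> bool" where
  "is_gvec d p v \<longleftrightarrow> (\<forall>k. v k \<noteq> 0 \<longrightarrow> k \<in> G3B \<and> gdeg k = d \<and> even (gpar k + p))"

definition is_cochain1 :: "int \<Rightarrow> nat \<Rightarrow> (nat \<Rightarrow> g3vec) \<Rightarrow> bool" where
  "is_cochain1 d p psi \<longleftrightarrow>
     (\<forall>i k. psi i k \<noteq> 0 \<longrightarrow> i \<in> G3M \<and> k \<in> G3B \<and> gdeg k = gdeg i + d \<and> even (gpar k + gpar i + p))"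

definition is_cochain2 :: "int \<Rightarrow> nat \<Rightarrow> (nat \<Rightarrow> nat \<Rightarrow> g3vec) \<Rightarrow> bool" where
  "is_cochain2 d p phi \<longleftrightarrow>
     (\<forall>i j k. phi i j k \<noteq> 0 \<longrightarrow> i \<in> G3M \<and> j \<in> G3M \<and> k \<in> G3B \<and>
        gdeg k = gdeg i + gdeg j + d \<and> even (gpar k + gpar i + gpar j + p)) \<and>
     (\<forall>i j k. phi j i k = - ssgn (gpar i * gpar j) * phi i j k)"

definition apply1 :: "(nat \<Rightarrow> g3vec) \<Rightarrow> g3vec \<Rightarrow> g3vec" where
  "apply1 psi v = (\<lambda>k. \<Sum>i\<in>G3M. v i * psi i k)"

definition apply2 :: "(nat \<Rightarrow> nat \<Rightarrow> g3vec) \<Rightarrow> g3vec \<Rightarrow> g3vec \<Rightarrow> g3vec" where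
  "apply2 phi u w = (\<lambda>k. \<Sum>i\<in>G3M. \<Sum>j\<in>G3M. u i * w j * phi i j k)"

definition ce_d0 :: "nat \<Rightarrow> g3vec \<Rightarrow> nat \<Rightarrow> g3vec" where
  "ce_d0 p v = (\<lambda>i. if i \<in> G3M then (\<lambda>k. ssgn (p * gpar i) * gbr (bv i) v k) else (\<lambda>k. 0))"

definition ce_d1 :: "nat \<Rightarrow> (nat \<Rightarrow> g3vec) \<Rightarrow> nat \<Rightarrow> nat \<Rightarrow> g3vec" where
  "ce_d1 p psi = (\<lambda>i j. if i \<in> G3M \<and> j \<in> G3M then
     (\<lambda>k. ssgn (p * gpar i) * gbr (bv i) (psi j) k
        - ssgn (gpar j * (gpar i + p)) * gbr (bv j) (psi i) k
        - apply1 psi (gbr (bv i) (bv j)) k) else (\<lambda>k. 0))"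

definition ce_d2 :: "nat \<Rightarrow> (nat \<Rightarrow> nat \<Rightarrow> g3vec) \<Rightarrow> nat \<Rightarrow> nat \<Rightarrow> nat \<Rightarrow> g3vec" where
  "ce_d2 p phi = (\<lambda>i j l. (\<lambda>k.
        ssgn (p * gpar i) * gbr (bv i) (phi j l) k
      - ssgn (gpar i * gpar j + p * gpar j) * gbr (bv j) (phi i l) k
      + ssgn ((gpar i + gpar j) * gpar l + p * gpar l) * gbr (bv l) (phi i j) k
      - apply2 phi (gbr (bv i) (bv j)) (bv l) k
      + ssgn (gpar j * gpar l) * apply2 phi (gbr (bv i) (bv l)) (bv j) k
      - ssgn (gpar i * (gpar j + gpar l)) * apply2 phi (gbr (bv j) (bv l)) (bv i) k))"

definition cocycle1 :: "int \<Rightarrow> nat \<Rightarrow> (nat \<Rightarrow> g3vec) \<Rightarrow> bool" where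
  "cocycle1 d p psi \<longleftrightarrow> is_cochain1 d p psi \<and> (\<forall>i\<in>G3M. \<forall>j\<in>G3M. ce_d1 p psi i j = (\<lambda>k. 0))"

definition coboundary1 :: "int \<Rightarrow> nat \<Rightarrow> (nat \<Rightarrow> g3vec) \<Rightarrow> bool" where
  "coboundary1 d p psi \<longleftrightarrow> (\<exists>v. is_gvec d p v \<and> (\<forall>i\<in>G3M. psi i = ce_d0 p v i))"

definition cocycle2 :: "int \<Rightarrow> nat \<Rightarrow> (nat \<Rightarrow> nat \<Rightarrow> g3vec) \<Rightarrow> bool" where
  "cocycle2 d p phi \<longleftrightarrow> is_cochain2 d p phi \<and>
     (\<forall>i\<in>G3M. \<forall>j\<in>G3M. \<forall>l\<in>G3M. ce_d2 p phi i j l = (\<lambda>k. 0))"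

definition coboundary2 :: "int \<Rightarrow> nat \<Rightarrow> (nat \<Rightarrow> nat \<Rightarrow> g3vec) \<Rightarrow> bool" where
  "coboundary2 d p phi \<longleftrightarrow>
     (\<exists>psi. is_cochain1 d p psi \<and> (\<forall>i\<in>G3M. \<forall>j\<in>G3M. phi i j = ce_d1 p psi i j))"

definition H1_zero :: "int \<Rightarrow> nat \<Rightarrow> bool" where
  "H1_zero d p \<longleftrightarrow> (\<forall>psi. cocycle1 d p psi \<longrightarrow> coboundary1 d p psi)"

definition H2_zero :: "int \<Rightarrow> nat \<Rightarrow> bool" where
  "H2_zero d p \<longleftrightarrow> (\<forall>phi. cocycle2 d p phi \<longrightarrow> coboundary2 d p phi)"

definition in_sl2sp2 :: "g3vec \<Rightarrow> bool" where
  "in_sl2sp2 X \<longleftrightarrow> (\<forall>k. X k \<noteq> 0 \<longrightarrow> k \<in> sl2_idx \<union> sp2_idx)"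

definition in_span :: "nat set \<Rightarrow> g3vec \<Rightarrow> bool" where
  "in_span S X \<longleftrightarrow> (\<forall>k. X k \<noteq> 0 \<longrightarrow> k \<in> S)"

text \<open>Matrices of ad X on C^2 (x) C = (g_-1)_even (basis e_a) and on C (x) C^2 = (g_-2)_odd
  (basis eps_alpha): X e_a = sum_c rho1 X c a e_c.\<close>
definition rho1 :: "g3vec \<Rightarrow> nat \<Rightarrow> nat \<Rightarrow> complex" where
  "rho1 X c a = gbr X (bv (ix_e a)) (ix_e c)"
definition rho2 :: "g3vec \<Rightarrow> nat \<Rightarrow> nat \<Rightarrow> complex" where
  "rho2 X ga al = gbr X (bv (ix_eps2 al)) (ix_eps2 ga)"

text \<open>S^2 C^2 (x) Lambda^2 C^2 realised as tensors t^{a b beta gamma} (in basis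
  e_a e_b eps_beta eps_gamma), symmetric in a,b and skew in beta,gamma.\<close>
definition S2L2 :: "(nat \<Rightarrow> nat \<Rightarrow> nat \<Rightarrow> nat \<Rightarrow> complex) set" where
  "S2L2 = {t. (\<forall>a b be ga. t a b be ga \<noteq> 0 \<longrightarrow> a \<in> idx2 \<and> b \<in> idx2 \<and> be \<in> idx2 \<and> ga \<in> idx2)
              \<and> (\<forall>a b be ga. t a b be ga = t b a be ga)
              \<and> (\<forall>a b be ga. t a b be ga = - t a b ga be)}"

definition act_T :: "g3vec \<Rightarrow> (nat \<Rightarrow> nat \<Rightarrow> nat \<Rightarrow> nat \<Rightarrow> complex) \<Rightarrow> (nat \<Rightarrow> nat \<Rightarrow> nat \<Rightarrow> nat \<Rightarrow> complex)" where
  "act_T X t = (\<lambda>a b be ga.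
       (\<Sum>c\<in>idx2. rho1 X a c * t c b be ga) + (\<Sum>c\<in>idx2. rho1 X b c * t a c be ga)
     + (\<Sum>de\<in>idx2. rho2 X be de * t a b de ga) + (\<Sum>de\<in>idx2. rho2 X ga de * t a b be de))"

definition act_C2 :: "g3vec \<Rightarrow> (nat \<Rightarrow> nat \<Rightarrow> g3vec) \<Rightarrow> (nat \<Rightarrow> nat \<Rightarrow> g3vec)" where
  "act_C2 X phi = (\<lambda>i j k. gbr X (phi i j) k - apply2 phi (gbr X (bv i)) (bv j) k
                              - apply2 phi (bv i) (gbr X (bv j)) k)"

text \<open>H^{2,2}(m,g)_even is isomorphic to S^2 C^2 (x) Lambda^2 C^2 as sl(2)+sp(2)-module:
  a linear map Phi from the module into the even degree-2 cocycles inducing a bijection onto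
  cohomology classes and equivariant modulo coboundaries.\<close>
definition H22_iso_S2L2 :: bool where
  "H22_iso_S2L2 \<longleftrightarrow> (\<exists>Phi :: (nat \<Rightarrow> nat \<Rightarrow> nat \<Rightarrow> nat \<Rightarrow> complex) \<Rightarrow> (nat \<Rightarrow> nat \<Rightarrow> g3vec).
      (\<forall>t\<in>S2L2. cocycle2 2 0 (Phi t))
    \<and> (\<forall>t\<in>S2L2. \<forall>u\<in>S2L2. \<forall>c e. Phi (\<lambda>a b be ga. c * t a b be ga + e * u a b be ga)
                                  = (\<lambda>i j k. c * Phi t i j k + e * Phi u i j k))
    \<and> (\<forall>phi. cocycle2 2 0 phi \<longrightarrow> (\<exists>!t. t \<in> S2L2 \<and> coboundary2 2 0 (\<lambda>i j k. phi i j k - Phi t i j k)))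
    \<and> (\<forall>X. \<forall>t\<in>S2L2. in_sl2sp2 X \<longrightarrow>
          coboundary2 2 0 (\<lambda>i j k. act_C2 X (Phi t) i j k - Phi (act_T X t) i j k)))"

text \<open>Component coefficients of a 2-cochain phi:
  phi(e_a, eps_{b beta}) = sum_gamma comp1 phi a b beta gamma eps_gamma        (eps_gamma in (g_0)_odd)
  phi(eps_alpha, e_a)    = sum_{b,beta} comp3 phi alpha a b beta eps_{b beta}  (eps_alpha in (g_-2)_odd)
  phi(eps_{a alpha}, e_b) = sum_gamma comp4 phi a alpha b gamma eps_gamma     (e_b in g_-3, eps_gamma in (g_-2)_odd)
  and their versions with all indices lowered (X_a = omega_ab X^b).\<close>
definition comp1 :: "(nat \<Rightarrow> nat \<Rightarrow> g3vec) \<Rightarrow> nat \<Rightarrow> nat \<Rightarrow> nat \<Rightarrow> nat \<Rightarrow> complex" where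
  "comp1 phi a b be ga = phi (ix_e a) (ix_eps1 b be) (ix_eps0 ga)"
definition comp3 :: "(nat \<Rightarrow> nat \<Rightarrow> g3vec) \<Rightarrow> nat \<Rightarrow> nat \<Rightarrow> nat \<Rightarrow> nat \<Rightarrow> complex" where
  "comp3 phi al a b be = phi (ix_eps2 al) (ix_e a) (ix_eps1 b be)"
definition comp4 :: "(nat \<Rightarrow> nat \<Rightarrow> g3vec) \<Rightarrow> nat \<Rightarrow> nat \<Rightarrow> nat \<Rightarrow> nat \<Rightarrow> complex" where
  "comp4 phi a al b ga = phi (ix_eps1 a al) (ix_f b) (ix_eps2 ga)"

definition low1 :: "(nat \<Rightarrow> nat \<Rightarrow> g3vec) \<Rightarrow> nat \<Rightarrow> nat \<Rightarrow> nat \<Rightarrow> nat \<Rightarrow> complex" where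
  "low1 phi a b be ga = (\<Sum>de\<in>idx2. omega ga de * comp1 phi a b be de)"
definition low3 :: "(nat \<Rightarrow> nat \<Rightarrow> g3vec) \<Rightarrow> nat \<Rightarrow> nat \<Rightarrow> nat \<Rightarrow> nat \<Rightarrow> complex" where
  "low3 phi al a b be = (\<Sum>c\<in>idx2. \<Sum>de\<in>idx2. omega b c * omega be de * comp3 phi al a c de)"
definition low4 :: "(nat \<Rightarrow> nat \<Rightarrow> g3vec) \<Rightarrow> nat \<Rightarrow> nat \<Rightarrow> nat \<Rightarrow> nat \<Rightarrow> complex" where
  "low4 phi a al b ga = (\<Sum>de\<in>idx2. omega ga de * comp4 phi a al b de)"

definition canon_slot :: "nat \<Rightarrow> nat \<Rightarrow> nat \<Rightarrow> bool" where
  "canon_slot i j k \<longleftrightarrow>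
       (\<exists>a\<in>idx2. \<exists>b\<in>idx2. \<exists>be\<in>idx2. \<exists>ga\<in>idx2. i = ix_e a \<and> j = ix_eps1 b be \<and> k = ix_eps0 ga)
     \<or> (\<exists>a\<in>idx2. \<exists>al\<in>idx2. \<exists>b\<in>idx2. \<exists>be\<in>idx2. i = ix_eps1 a al \<and> j = ix_eps1 b be \<and> k \<in> sl2_idx \<union> sp2_idx)
     \<or> (\<exists>al\<in>idx2. \<exists>a\<in>idx2. \<exists>b\<in>idx2. \<exists>be\<in>idx2. i = ix_eps2 al \<and> j = ix_e a \<and> k = ix_eps1 b be)
     \<or> (\<exists>a\<in>idx2. \<exists>al\<in>idx2. \<exists>b\<in>idx2. \<exists>ga\<in>idx2. i = ix_eps1 a al \<and> j = ix_f b \<and> k = ix_eps2 ga)"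

definition canonical_form :: "(nat \<Rightarrow> nat \<Rightarrow> g3vec) \<Rightarrow> bool" where
  "canonical_form phi \<longleftrightarrow>
     \<comment> \<open>only the four kinds of components are nonzero\<close>
     (\<forall>i j k. phi i j k \<noteq> 0 \<longrightarrow> canon_slot i j k \<or> canon_slot j i k)
     \<comment> \<open>symmetric in latin, skew in greek indices (after lowering)\<close>
   \<and> (\<forall>a\<in>idx2. \<forall>b\<in>idx2. \<forall>be\<in>idx2. \<forall>ga\<in>idx2.
        low1 phi a b be ga = low1 phi b a be ga \<and> low1 phi a b be ga = - low1 phi a b ga be)
   \<and> (\<forall>al\<in>idx2. \<forall>a\<in>idx2. \<forall>b\<in>idx2. \<forall>be\<in>idx2.
        low3 phi al a b be = low3 phi al b a be \<and> low3 phi al a b be = - low3 phi be a b al)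
   \<and> (\<forall>a\<in>idx2. \<forall>al\<in>idx2. \<forall>b\<in>idx2. \<forall>ga\<in>idx2.
        low4 phi a al b ga = low4 phi b al a ga \<and> low4 phi a al b ga = - low4 phi a ga b al)
     \<comment> \<open>phi_{b beta a}^gamma = -2 phi_{a b beta}^gamma\<close>
   \<and> (\<forall>a\<in>idx2. \<forall>b\<in>idx2. \<forall>be\<in>idx2. \<forall>ga\<in>idx2. comp4 phi b be a ga = -2 * comp1 phi a b be ga)
     \<comment> \<open>phi_{alpha c b beta} = phi_{c b beta alpha}\<close>
   \<and> (\<forall>al\<in>idx2. \<forall>c\<in>idx2. \<forall>b\<in>idx2. \<forall>be\<in>idx2. low3 phi al c b be = low1 phi c b be al)
     \<comment> \<open>phi(eps_{a alpha}, eps_{b beta}) = X + Y with X in sl(2), Y in sp(2) given by the formulas\<close>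
   \<and> (\<forall>a\<in>idx2. \<forall>al\<in>idx2. \<forall>b\<in>idx2. \<forall>be\<in>idx2. \<exists>X Y.
        in_span sl2_idx X \<and> in_span sp2_idx Y \<and>
        phi (ix_eps1 a al) (ix_eps1 b be) = (\<lambda>k. X k + Y k) \<and>
        (\<forall>c\<in>idx2. gbr X (bv (ix_e c)) =
            (\<lambda>k. -2 * low1 phi c b be al * bv (ix_e a) k - 2 * low1 phi c a al be * bv (ix_e b) k)) \<and>
        (\<forall>ga\<in>idx2. gbr Y (bv (ix_eps2 ga)) =
            (\<lambda>k. \<Sum>de\<in>idx2. (-2 * omega al ga * comp1 phi a b be de
                              - 2 * omega be ga * comp1 phi b a al de) * bv (ix_eps2 de) k)))"

end

theory Submission
  imports Defs "HOL-Library.Code_Binary_Nat"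
begin

text \<open>
  The differential preserves degree, parity and weight, so every assertion is about finite-dimensional
  spaces. A cocycle is normalised by subtracting a coboundary chosen so that the coordinates in a certain
  triangular set vanish; it stays a cocycle because the square of the differential is zero, a consequence
  of the super Jacobi identity for two elements of m and one of g. Then the cocycle equations are taken in
  an order in which each of them, or a short combination, involves a single coordinate that is not yet known
  to vanish, until all coordinates vanish. The coordinates and the order of the equations were found by a
  computer search; they are recorded as certificates, whose evaluation in integer arithmetic is a proof.
  For even cochains of degree 2 three coordinates survive; they are realised by the canonical cocycles, and
  three linear functionals that kill coboundaries show that these are independent in cohomology.
\<close>

section \<open>Sparse linear forms, unit propagation and gauge fixing\<close>

text \<open>Exact elimination inside the logic would mean carrying fractions and transformed rows. A
  certificate step asks less: once the coordinates known to vanish are removed, a single coordinate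
  with a nonzero integer coefficient must remain. Denominators are cleared once and for all by 24,
  the least common multiple of the denominators 2, 3, 4, 6, 8 in the structure constants. Finitely
  many degrees suffice because the degrees of g lie between -3 and 3: a nonzero 1-cochain has degree
  at most 3 + 3 = 6 and a nonzero 2-cochain degree at most 3 + 6 = 9. Three coordinates survive in
  degree 2 because Lambda^2 C^2 is the trivial sp(2)-module and S^2 C^2 is three-dimensional, with
  sl(2)-weights -2, 0, 2. Propagation bounds the cohomology only from above; the matching lower
  bound needs explicit cocycles, and functionals that separate them modulo coboundaries.\<close>

definition ev :: "('x \<Rightarrow> complex) \<Rightarrow> ('x \<times> int) list \<Rightarrow> complex" where
  "ev f r = (\<Sum>(x, c)\<leftarrow>r. of_int c * f x)"

lemma ev_simps [simp]:
  "ev f [] = 0"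
  "ev f ((x, c) # r) = of_int c * f x + ev f r"
  "ev f (r @ s) = ev f r + ev f s"
  by (simp_all add: ev_def)

lemma ev_map_scale: "ev f (map (\<lambda>(x, c). (x, a * c)) r) = of_int a * ev f r"
  by (induction r) (auto simp: algebra_simps)

lemma ev_lin: "ev (\<lambda>x. a * f x + b * g x) r = a * ev f r + b * ev g r"
  by (induction r) (auto simp: algebra_simps)

lemma ev_cong: "(\<And>x c. (x, c) \<in> set r \<Longrightarrow> f x = g x) \<Longrightarrow> ev f r = ev g r"
  unfolding ev_def by (intro arg_cong[of _ _ sum_list] map_cong) auto

text \<open>Linear forms are lists in which a coordinate may be repeated, so that equations add by
  concatenation; \<open>acc\<close> merges such repetitions. A sum that cancels is dropped, hence an
  empty result certifies an identity. A term that arrives with coefficient 0 is kept, which explains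
  the test for 0 in \<open>unit_step\<close>.\<close>

fun acc :: "'x \<times> int \<Rightarrow> ('x \<times> int) list \<Rightarrow> ('x \<times> int) list" where
  "acc (x, c) [] = [(x, c)]"
| "acc (x, c) ((y, e) # r) =
     (if x = y then (if c + e = 0 then r else (y, c + e) # r) else (y, e) # acc (x, c) r)"

lemma ev_acc [simp]: "ev f (acc (x, c) r) = of_int c * f x + ev f r"
proof (induction "(x, c)" r rule: acc.induct)
  case (2 y e r)
  have "of_int c * f y + (of_int e * f y + ev f r) = ev f r" if "c + e = 0"
  proof -
    have "(of_int c + of_int e :: complex) = 0" using that by (metis of_int_0 of_int_add)
    then show ?thesis by (metis add.assoc add_0 distrib_right mult_zero_left)
  qed
  then show ?case using 2 by (auto simp: algebra_simps)
qed simp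

definition collect :: "('x \<times> int) list \<Rightarrow> ('x \<times> int) list" where
  "collect r = foldr acc r []"

lemma ev_collect [simp]: "ev f (collect r) = ev f r"
  by (induction r) (auto simp: collect_def)

text \<open>Every outcome other than a single surviving term leaves the list unchanged. A faulty
  certificate can therefore fail to cover the coordinates, but it cannot prove anything
  false.\<close>

definition unit_step :: "('x \<times> int) list \<Rightarrow> 'x list \<Rightarrow> 'x list" where
  "unit_step r Z = (case collect (filter (\<lambda>(x, c). x \<notin> set Z) r) of
     [(x, c)] \<Rightarrow> if c = 0 then Z else x # Z | _ \<Rightarrow> Z)"

lemma unit_step_sound:
  assumes "\<forall>x\<in>set Z. f x = 0" "ev f r = 0"
  shows "\<forall>x\<in>set (unit_step r Z). f x = 0"
proof -
  have "ev f (filter (\<lambda>(x, c). x \<notin> set Z) r) = ev f r"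
    using assms(1) by (induction r) auto
  then have *: "ev f (collect (filter (\<lambda>(x, c). x \<notin> set Z) r)) = 0"
    using assms(2) by simp
  have "f x = 0" if "collect (filter (\<lambda>(x, c). x \<notin> set Z) r) = [(x, c)]" "c \<noteq> 0" for x c
    using *[unfolded that(1)] that(2) by simp
  then show ?thesis
    using assms(1) unfolding unit_step_def by (auto split: list.splits prod.splits)
qed

definition comb_row :: "('q \<Rightarrow> ('x \<times> int) list) \<Rightarrow> (int \<times> 'q) list \<Rightarrow> ('x \<times> int) list" where
  "comb_row row s = concat (map (\<lambda>(a, q). map (\<lambda>(x, c). (x, a * c)) (row q)) s)"

fun propagate :: "('q \<Rightarrow> ('x \<times> int) list) \<Rightarrow> (int \<times> 'q) list list \<Rightarrow> 'x list \<Rightarrow> 'x list" where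
  "propagate row [] Z = Z"
| "propagate row (s # ss) Z = propagate row ss (unit_step (comb_row row s) Z)"

lemma propagate_sound:
  assumes "\<And>q. ev f (row q) = 0" "\<forall>x\<in>set Z. f x = 0"
  shows "\<forall>x\<in>set (propagate row ss Z). f x = 0"
  using assms(2)
proof (induction ss arbitrary: Z)
  case (Cons s ss)
  have "ev f (comb_row row s) = 0"
    by (induction s) (auto simp: comb_row_def ev_map_scale assms(1))
  then show ?case using Cons unit_step_sound by (metis propagate.simps(2))
qed simp

section \<open>Sparse vectors and triangular gauge fixing\<close>

fun lookup :: "('y \<times> int) list \<Rightarrow> 'y \<Rightarrow> int" where
  "lookup [] y = 0"
| "lookup ((z, c) # l) y = (if z = y then c else lookup l y)"

definition vec :: "('y \<times> int) list \<Rightarrow> 'y \<Rightarrow> complex" where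
  "vec l y = of_int (lookup l y)"

lemma vec_support: "vec l y \<noteq> 0 \<Longrightarrow> y \<in> fst ` set l"
  unfolding vec_def by (induction l) (auto split: if_splits)

fun dot :: "('y \<times> int) list \<Rightarrow> ('y \<times> int) list \<Rightarrow> int" where
  "dot [] l = 0"
| "dot ((y, c) # r) l = c * lookup l y + dot r l"

lemma ev_vec: "ev (vec l) r = of_int (dot r l)"
  by (induction r) (auto simp: vec_def)

text \<open>The matrix of the values of the rows on the chosen vectors is triangular: the row of an
  entry vanishes on all later vectors and is nonzero on its own. Such a system is solvable for every
  right-hand side.\<close>

fun triangular :: "('x \<Rightarrow> ('y \<times> int) list) \<Rightarrow> ('x \<times> ('y \<times> int) list) list \<Rightarrow> bool" where
  "triangular row [] = True"
| "triangular row ((x, l) # G) = (let r = row x in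
     dot r l \<noteq> 0 \<and> list_all (\<lambda>(x', l'). dot r l' = 0) G \<and> triangular row G)"

text \<open>Substitution from the end of the list. The third conjunct strengthens the induction: the
  solution for the tail lies in the span of the tail vectors, so the row of the head, which kills
  them, is not affected by it.\<close>

lemma gauge_fix:
  assumes "triangular row G"
  shows "\<exists>v. (\<forall>y. v y \<noteq> 0 \<longrightarrow> (\<exists>(x, l)\<in>set G. y \<in> fst ` set l))
           \<and> (\<forall>(x, l)\<in>set G. ev v (row x) = f x)
           \<and> (\<forall>r. (\<forall>(x, l)\<in>set G. dot r l = 0) \<longrightarrow> ev v r = 0)"
  using assms
proof (induction G arbitrary: f)
  case Nil
  have "ev (\<lambda>_. 0) r = 0" for r :: "('b \<times> int) list" by (induction r) auto
  then show ?case by (intro exI[of _ "\<lambda>_. 0"]) simp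
next
  case (Cons g G)
  obtain x l where g: "g = (x, l)" by force
  define a where "a = f x / of_int (dot (row x) l)"
  have tri: "dot (row x) l \<noteq> 0" "\<forall>(x', l')\<in>set G. dot (row x) l' = 0" "triangular row G"
    using Cons.prems by (auto simp: g Let_def list_all_iff)
  \<comment> \<open>The tail is solved for the prescribed values minus what \<open>a\<close> times
    \<open>l\<close> will contribute to them; adding \<open>a\<close> times \<open>l\<close>
    afterwards restores these values and gives the head its own.\<close>
  obtain v where v: "\<forall>y. v y \<noteq> 0 \<longrightarrow> (\<exists>(x, l)\<in>set G. y \<in> fst ` set l)"
    "\<forall>(x', l')\<in>set G. ev v (row x') = f x' - a * of_int (dot (row x') l)"
    "\<forall>r. (\<forall>(x, l)\<in>set G. dot r l = 0) \<longrightarrow> ev v r = 0"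
    using Cons.IH[OF tri(3), of "\<lambda>x'. f x' - a * of_int (dot (row x') l)"] by blast
  define w where "w = (\<lambda>y. 1 * v y + a * vec l y)"
  have w: "ev w r = ev v r + a * of_int (dot r l)" for r
    unfolding w_def ev_lin by (simp add: ev_vec)
  have "\<exists>(x, l)\<in>set (g # G). y \<in> fst ` set l" if "w y \<noteq> 0" for y
  proof (cases "v y = 0")
    case True
    then have "vec l y \<noteq> 0" using that by (auto simp: w_def)
    then show ?thesis using vec_support by (force simp: g)
  next
    case False
    then show ?thesis using v(1) by fastforce
  qed
  moreover have "ev w (row x) = f x"
    using v(3) tri by (simp add: w a_def)
  moreover have "\<forall>(x', l')\<in>set G. ev w (row x') = f x'"
    using v(2) by (auto simp: w)
  moreover have "ev w r = 0" if "\<forall>(x, l)\<in>set (g # G). dot r l = 0" for r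
    using that v(3) by (simp add: w g)
  ultimately show ?case by (intro exI[of _ w]) (auto simp: g)
qed

section \<open>Structure constants\<close>

lemma g3_table_distinct: "distinct (map fst g3_table)"
proof -
  \<comment> \<open>The keys are read as numerals in base 31. The table is sorted by them, so that
    distinctness needs only comparisons of neighbours instead of all pairs.\<close>
  let ?e = "\<lambda>((i, j, k), c :: complex). 961 * i + 31 * j + k :: nat"
  have "sorted_wrt (<) (map ?e g3_table)"
    by (simp add: g3_table_def sorted_wrt1 sorted_wrt2 del: sorted_wrt.simps(2))
  then have "distinct (map ?e g3_table)"
    using strict_sorted_iff by blast
  moreover have "map ?e g3_table = map (\<lambda>(i, j, k). 961 * i + 31 * j + k) (map fst g3_table)"
    by (auto simp: case_prod_beta)
  ultimately show ?thesis by (metis distinct_map)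
qed

text \<open>Decision trees replace the list lookups of \<open>gdeg\<close> and \<open>gpar\<close>.
  They are cheap to evaluate and also take definite values beyond index 30, so that bounds on
  \<open>deg\<close> hold without a range condition.\<close>

definition deg :: "nat \<Rightarrow> int" where
  "deg i = (if i < 5 then (if i < 2 then -3 else -2) else if i < 11 then -1 else if i < 20 then 0
            else if i < 26 then 1 else if i < 29 then 2 else 3)"

definition par :: "nat \<Rightarrow> bool" where
  "par i = (if i < 11 then (if i < 5 then 3 \<le> i else 7 \<le> i)
            else i = 18 \<or> i = 19 \<or> 22 \<le> i \<and> i \<le> 25 \<or> i = 27 \<or> i = 28)"

lemma less_31: "k < 31 \<Longrightarrow> k \<in> {0, 1, 2, 3, 4, 5, 6, 7, 8, 9, 10, 11, 12, 13, 14, 15, 16, 17, 18, 19,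
    20, 21, 22, 23, 24, 25, 26, 27, 28, 29, 30::nat}"
  by (simp add: less_Suc_eq numeral_eq_Suc)

lemma gdeg_eq: "i < 31 \<Longrightarrow> gdeg i = deg i"
  by (drule less_31) (auto simp: gdeg_def deg_def)

lemma gpar_eq: "i < 31 \<Longrightarrow> gpar i = of_bool (par i)"
  by (drule less_31) (auto simp: gpar_def par_def)

lemma g3_table_graded:
  "list_all (\<lambda>((i, j, k), c). i < 31 \<and> j < 31 \<and> k < 31 \<and> deg k = deg i + deg j
     \<and> par k = (par i \<noteq> par j)) g3_table"
  by (simp add: g3_table_def deg_def par_def)

lemma g3sc_graded:
  assumes "g3sc i j k \<noteq> 0"
  shows "i < 31" "j < 31" "k < 31" "deg k = deg i + deg j" "par k = (par i \<noteq> par j)"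
proof -
  obtain c where "map_of g3_table (i, j, k) = Some c"
    using assms by (auto simp: g3sc_def split: option.splits)
  then have "((i, j, k), c) \<in> set g3_table" by (rule map_of_SomeD)
  then show "i < 31" "j < 31" "k < 31" "deg k = deg i + deg j" "par k = (par i \<noteq> par j)"
    using g3_table_graded by (auto simp: list_all_iff)
qed

text \<open>As the keys are distinct, a sum of lookups is a sum over the table entries. The latter
  can be filtered by the left factor and then replaced by an integer row.\<close>

lemma sum_g3sc:
  "(\<Sum>j\<in>G3B. v j * g3sc i j k) = (\<Sum>((i', j, k'), c)\<leftarrow>g3_table. if i' = i \<and> k' = k then c * v j else 0)"
proof -
  have "(\<Sum>j\<in>G3B. v j * (case map_of T (i, j, k) of Some c \<Rightarrow> c | None \<Rightarrow> 0))
      = (\<Sum>((i', j, k'), c)\<leftarrow>T. if i' = i \<and> k' = k then c * v j else 0)"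
    if "distinct (map fst T)" "\<forall>((i, j, k), c)\<in>set T. j < 31" for T :: "((nat \<times> nat \<times> nat) \<times> complex) list"
    using that
  proof (induction T)
    case (Cons e T)
    obtain i' j' k' c where e: "e = ((i', j', k'), c)" by (metis prod.collapse)
    have none: "map_of T (i', j', k') = None"
      using Cons.prems(1) by (force simp: e map_of_eq_None_iff)
    have "(\<Sum>j\<in>G3B. v j * (case map_of (e # T) (i, j, k) of Some c \<Rightarrow> c | None \<Rightarrow> 0))
        = (\<Sum>j\<in>G3B. (if j = j' then (if i' = i \<and> k' = k then c * v j' else 0) else 0)
              + v j * (case map_of T (i, j, k) of Some c \<Rightarrow> c | None \<Rightarrow> 0))"
      by (rule sum.cong) (auto simp: e none)
    also have "\<dots> = (if i' = i \<and> k' = k then c * v j' else 0)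
              + (\<Sum>j\<in>G3B. v j * (case map_of T (i, j, k) of Some c \<Rightarrow> c | None \<Rightarrow> 0))"
      using Cons.prems(2) by (simp add: sum.distrib G3B_def e)
    finally show ?case using Cons by (simp add: e)
  qed simp
  moreover have "\<forall>((i, j, k), c)\<in>set g3_table. j < 31"
    using g3_table_graded by (auto simp: list_all_iff)
  ultimately show ?thesis unfolding g3sc_def using g3_table_distinct by blast
qed

lemma gbr_bv_sum: "i < 31 \<Longrightarrow> gbr (bv i) v k = (\<Sum>j\<in>G3B. v j * g3sc i j k)"
proof -
  assume "i < 31"
  have "gbr (bv i) v k = (\<Sum>i'\<in>G3B. if i' = i then (\<Sum>j\<in>G3B. v j * g3sc i j k) else 0)"
    unfolding gbr_def by (rule sum.cong) (auto simp: bv_def)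
  with \<open>i < 31\<close> show ?thesis by (simp add: G3B_def)
qed

text \<open>The entries of \<open>row i\<close> are the triples \<open>(j, k, 24 c)\<close>, where \<open>c\<close> is the coefficient of \<open>b_k\<close> in
  \<open>[b_i, b_j]\<close>; the factor 24 clears all denominators.\<close>

definition row :: "nat \<Rightarrow> (nat \<times> nat \<times> int) list" where
  "row i =
   (if i = 0 then
     [(11,0,72), (12,0,-24), (14,1,-24), (20,2,36), (22,4,-24), (23,3,24), (26,5,-24),
     (27,8,-36), (28,7,36), (29,11,18), (29,12,-18), (30,13,-36)]
    else
   (if i = 1 then
     [(11,1,72), (12,1,24), (13,0,-24), (21,2,36), (24,3,36), (25,4,18), (26,6,-24), (27,10,-36),
     (28,9,36), (29,14,-36), (30,11,18), (30,12,18)]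
    else
   (if i = 2 then
     [(5,0,-24), (6,1,-24), (11,2,48), (18,3,-48), (19,4,-48), (20,6,48), (21,5,-48), (22,10,-8),
     (23,9,8), (24,7,-12), (25,8,-6), (26,11,8), (27,19,24), (28,18,-24), (29,20,24), (30,21,24)]
    else
   (if i = 3 then
     [(8,0,-24), (10,1,-24), (11,3,48), (15,3,-24), (17,4,-24), (19,2,24), (20,9,12), (21,7,-12),
     (22,6,-8), (25,5,-6), (26,18,-8), (27,11,12), (27,15,24), (28,16,48), (29,23,36),
     (30,24,24)]
    else
   (if i = 4 then
     [(7,0,24), (9,1,24), (11,4,48), (15,4,24), (16,3,-24), (18,2,-24), (20,10,12), (21,8,-12),
     (23,6,-8), (24,5,12), (26,19,-8), (27,17,48), (28,11,12), (28,15,-24), (29,22,-36),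
     (30,25,48)]
    else
   (if i = 5 then
     [(2,0,24), (6,2,24), (9,3,24), (10,4,24), (11,5,24), (12,5,-24), (14,6,-24), (18,7,-24),
     (19,8,-24), (20,11,6), (20,12,-18), (21,13,-36), (22,19,-8), (23,18,8), (26,21,-16),
     (27,25,-48), (28,24,24), (29,26,-36)]
    else
   (if i = 6 then
     [(2,1,24), (5,2,-24), (7,3,-24), (8,4,-24), (11,6,24), (12,6,24), (13,5,-24), (18,9,-24),
     (19,10,-24), (20,14,-36), (21,11,6), (21,12,18), (24,18,12), (25,19,6), (26,20,16),
     (27,22,-36), (28,23,-36), (30,26,-36)]
    else
   (if i = 7 then
     [(4,0,24), (6,3,24), (10,2,24), (11,7,24), (12,7,-24), (14,9,-24), (15,7,-24), (17,8,-24),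
     (19,5,48), (20,18,-24), (22,11,-4), (22,12,12), (22,15,-16), (23,16,-32), (25,13,-18),
     (26,24,-16), (27,21,-24), (29,28,24)]
    else
   (if i = 8 then
     [(3,0,-24), (6,4,24), (9,2,-24), (11,8,24), (12,8,-24), (14,10,-24), (15,8,24), (16,7,-24),
     (18,5,-48), (20,19,-24), (22,17,-32), (23,11,-4), (23,12,12), (23,15,16), (24,13,36),
     (26,25,-32), (28,21,-24), (29,27,-24)]
    else
   (if i = 9 then
     [(4,1,24), (5,3,-24), (8,2,-24), (11,9,24), (12,9,24), (13,7,-24), (15,9,-24), (17,10,-24),
     (19,6,48), (21,18,-24), (22,14,24), (24,16,-48), (25,11,3), (25,12,9), (25,15,12),
     (26,23,24), (27,20,24), (30,28,24)]
    else
   (if i = 10 then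
     [(3,1,-24), (5,4,-24), (7,2,24), (11,10,24), (12,10,24), (13,8,-24), (15,10,24), (16,9,-24),
     (18,6,-48), (21,19,-24), (23,14,24), (24,11,-6), (24,12,-18), (24,15,24), (25,17,24),
     (26,22,-24), (28,20,24), (30,27,-24)]
    else
   (if i = 12 then
     [(0,0,24), (1,1,-24), (5,5,24), (6,6,-24), (7,7,24), (8,8,24), (9,9,-24), (10,10,-24),
     (13,13,48), (14,14,-48), (20,20,-24), (21,21,24), (22,22,-24), (23,23,-24), (24,24,24),
     (25,25,24), (29,29,-24), (30,30,24)]
    else
   (if i = 13 then
     [(1,0,24), (6,5,24), (9,7,24), (10,8,24), (12,13,-48), (14,12,24), (20,21,-24), (22,25,32),
     (23,24,-16), (29,30,-24)]
    else
   (if i = 14 then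
     [(0,1,24), (5,6,24), (7,9,24), (8,10,24), (12,14,48), (13,12,-24), (21,20,-24), (24,23,-36),
     (25,22,18), (30,29,-24)]
    else
   (if i = 15 then
     [(3,3,24), (4,4,-24), (7,7,24), (8,8,-24), (9,9,24), (10,10,-24), (16,16,48), (17,17,-48),
     (18,18,24), (19,19,-24), (22,22,-24), (23,23,24), (24,24,24), (25,25,-24), (27,27,-24),
     (28,28,24)]
    else
   (if i = 16 then
     [(4,3,24), (8,7,24), (10,9,24), (15,16,-48), (17,15,24), (19,18,24), (22,23,-24),
     (25,24,12), (27,28,-24)]
    else
   (if i = 17 then
     [(3,4,24), (7,8,24), (9,10,24), (15,17,48), (16,15,-24), (18,19,24), (23,22,-24),
     (24,25,48), (28,27,-24)]
    else
   [])))))))))))))))))"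

text \<open>The left factors whose brackets are tabulated: m, which enters the differential, and
  sl(2) + sp(2), which acts on the cohomology.\<close>

definition acting :: "nat set" where "acting = {..<11} \<union> {12..<18}"

text \<open>As conditional rewrite rules these evaluate \<open>filter\<close> on a long list in linear time, whereas the
  \<open>if\<close> in the defining equation makes the simplifier traverse the remaining list at every step.\<close>

lemma filter_yes: "P x \<Longrightarrow> filter P (x # xs) = x # filter P xs"
  and filter_no: "\<not> P x \<Longrightarrow> filter P (x # xs) = filter P xs"
  by simp_all

text \<open>The link between the complex structure constants and the integer data; all later
  evaluations use \<open>row\<close>.\<close>

lemma row_table:
  assumes "i \<in> acting"
  shows "filter (\<lambda>e. fst (fst e) = i) g3_table = map (\<lambda>(j, k, c). ((i, j, k), of_int c / 24)) (row i)"
proof -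
  have "i \<in> {0, 1, 2, 3, 4, 5, 6, 7, 8, 9, 10, 12, 13, 14, 15, 16, 17}"
    using assms(1) by (auto simp: acting_def less_Suc_eq numeral_eq_Suc)
  then show ?thesis
    unfolding insert_iff empty_iff
    by (elim disjE; simp only: g3_table_def filter_yes filter_no filter.simps(1) fst_conv rel_simps
          eq_numeral_simps numeral_eq_iff zero_neq_numeral simp_thms; simp add: row_def)
qed

fun sel_row :: "nat \<Rightarrow> (nat \<times> nat \<times> int) list \<Rightarrow> (nat \<times> int) list" where
  "sel_row k [] = []"
| "sel_row k ((j, k', c) # r) = (if k' = k then (j, c) # sel_row k r else sel_row k r)"

fun sel_col :: "nat \<Rightarrow> (nat \<times> nat \<times> int) list \<Rightarrow> (nat \<times> int) list" where
  "sel_col j [] = []"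
| "sel_col j ((j', k, c) # r) = (if j' = j then (k, c) # sel_col j r else sel_col j r)"

text \<open>The list \<open>ad i k\<close> holds the coefficients of the linear form that sends \<open>v\<close> to 24 times the
  \<open>k\<close>-th coordinate of \<open>[b_i, v]\<close>; \<open>brm i j\<close> holds the coordinates of \<open>24 [b_i, b_j]\<close>.\<close>

definition ad :: "nat \<Rightarrow> nat \<Rightarrow> (nat \<times> int) list" where "ad i k = sel_row k (row i)"

definition brm :: "nat \<Rightarrow> nat \<Rightarrow> (nat \<times> int) list" where "brm i j = sel_col j (row i)"

lemma gbr_bv:
  assumes "i \<in> acting"
  shows "gbr (bv i) v k = ev v (ad i k) / 24"
proof -
  have *: "(\<Sum>((i', j, k'), c)\<leftarrow>map (\<lambda>(j, k, c). ((i, j, k), of_int c / 24)) r.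
      if k' = k then c * v j else 0) = ev v (sel_row k r) / 24" for r
    by (induction r) (auto simp: add_divide_distrib)
  have "gbr (bv i) v k = (\<Sum>((i', j, k'), c)\<leftarrow>g3_table. if i' = i \<and> k' = k then c * v j else 0)"
    using assms by (subst gbr_bv_sum) (auto simp: sum_g3sc acting_def)
  also have "\<dots> = (\<Sum>((i', j, k'), c)\<leftarrow>filter (\<lambda>e. fst (fst e) = i) g3_table. if k' = k then c * v j else 0)"
    unfolding sum_list_map_filter' by (intro arg_cong[of _ _ sum_list] map_cong) auto
  also have "\<dots> = ev v (ad i k) / 24"
    unfolding row_table[OF assms] * ad_def ..
  finally show ?thesis .
qed

text \<open>Parities are booleans: a product of parities is a conjunction and a sum is
  \<open>\<noteq>\<close>, which binds tighter than the conjunction. Every Koszul sign thus becomes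
  \<open>sg\<close> of a boolean term.\<close>

definition sg :: "bool \<Rightarrow> int \<Rightarrow> int" where "sg b c = (if b then - c else c)"

text \<open>The coordinates of the differentials, as linear forms in the coordinates of the cochain and scaled
  by 24. Two-cochains are written in the coordinates \<open>(i, j, k)\<close> with \<open>i \<le> j\<close>, the diagonal
  \<open>i = j\<close> occurring for odd \<open>b_i\<close> only.\<close>

definition row0 :: "bool \<Rightarrow> nat \<times> nat \<Rightarrow> (nat \<times> int) list" where
  "row0 p = (\<lambda>(i, k). if i < 11 then map (\<lambda>(t, c). (t, sg (p \<and> par i) c)) (ad i k) else [])"

definition row1 :: "bool \<Rightarrow> nat \<times> nat \<times> nat \<Rightarrow> ((nat \<times> nat) \<times> int) list" where
  "row1 p = (\<lambda>(i, j, k). if i < 11 \<and> j < 11 then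
       map (\<lambda>(t, c). ((j, t), sg (p \<and> par i) c)) (ad i k)
     @ map (\<lambda>(t, c). ((i, t), sg (\<not> (par j \<and> par i \<noteq> p)) c)) (ad j k)
     @ map (\<lambda>(t, c). ((t, k), - c)) (brm i j)
   else [])"

definition skew_term :: "nat \<Rightarrow> nat \<Rightarrow> nat \<Rightarrow> int \<Rightarrow> ((nat \<times> nat \<times> nat) \<times> int) list" where
  "skew_term i j k c =
     (if i < j then [((i, j, k), c)]
      else if j < i then [((j, i, k), sg (\<not> (par i \<and> par j)) c)]
      else if par i then [((i, j, k), c)] else [])"

definition row2 :: "bool \<Rightarrow> nat \<times> nat \<times> nat \<times> nat \<Rightarrow> ((nat \<times> nat \<times> nat) \<times> int) list" where
  "row2 p = (\<lambda>(i, j, l, k). if i < 11 \<and> j < 11 \<and> l < 11 then let pi = par i; pj = par j; pl = par l in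
       concat (map (\<lambda>(t, c). skew_term j l t (sg (p \<and> pi) c)) (ad i k))
     @ concat (map (\<lambda>(t, c). skew_term i l t (sg (\<not> (pj \<and> pi \<noteq> p)) c)) (ad j k))
     @ concat (map (\<lambda>(t, c). skew_term i j t (sg (pl \<and> (pi \<noteq> pj) \<noteq> p) c)) (ad l k))
     @ concat (map (\<lambda>(t, c). skew_term t l k (- c)) (brm i j))
     @ concat (map (\<lambda>(t, c). skew_term t j k (sg (pj \<and> pl) c)) (brm i l))
     @ concat (map (\<lambda>(t, c). skew_term t i k (sg (\<not> (pi \<and> pj \<noteq> pl)) c)) (brm j l))
   else [])"

definition basis :: "int \<Rightarrow> bool \<Rightarrow> nat list" where
  "basis d p =
     (if p then
       (if d = -2 then [3, 4] else if d = -1 then [7, 8, 9, 10] else if d = 0 then [18, 19]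
        else if d = 1 then [22, 23, 24, 25] else if d = 2 then [27, 28] else [])
      else
       (if d = -3 then [0, 1] else if d = -2 then [2] else if d = -1 then [5, 6]
        else if d = 0 then [11, 12, 13, 14, 15, 16, 17] else if d = 1 then [20, 21]
        else if d = 2 then [26] else if d = 3 then [29, 30] else []))"

definition coords1 :: "int \<Rightarrow> bool \<Rightarrow> (nat \<times> nat) list" where
  "coords1 d p = concat (map (\<lambda>i. map (Pair i) (basis (deg i + d) (par i \<noteq> p))) [0..<11])"

definition coords2 :: "int \<Rightarrow> bool \<Rightarrow> (nat \<times> nat \<times> nat) list" where
  "coords2 d p = concat (map (\<lambda>i. concat (map (\<lambda>j.
     map (\<lambda>k. (i, j, k)) (basis (deg i + deg j + d) ((par i \<noteq> par j) \<noteq> p))) [if par i then i else Suc i..<11])) [0..<11])"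

text \<open>A certificate has one block per weight of the Cartan subalgebra of sl(2) + sp(2). A block consists of
  gauge pairs (a coordinate, and a sparse cochain whose coboundary makes that coordinate vanish) and of a
  sequence of integer combinations of cocycle equations for unit propagation.\<close>

type_synonym ('x, 'y, 'q) certificate =
  "(('x \<times> ('y \<times> int) list) list \<times> (int \<times> 'q) list list) list"

definition gauge :: "('x, 'y, 'q) certificate \<Rightarrow> ('x \<times> ('y \<times> int) list) list" where
  "gauge C = concat (map fst C)"

text \<open>The list \<open>T\<close> holds coordinates assumed to vanish besides the gauged ones.
  Each block is propagated separately, because the equations of one weight involve only coordinates
  of that weight, and short lists keep the membership tests cheap.\<close>

definition covered :: "('q \<Rightarrow> ('x \<times> int) list) \<Rightarrow> 'x list \<Rightarrow> ('x, 'y, 'q) certificate \<Rightarrow> 'x list" where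
  "covered rw T C = concat (map (\<lambda>(G, ss). propagate rw ss (map fst G @ T)) C)"

definition gauge_ok :: "('x \<Rightarrow> ('y \<times> int) list) \<Rightarrow> 'y list \<Rightarrow> ('x, 'y, 'q) certificate \<Rightarrow> bool" where
  "gauge_ok rw Y C \<longleftrightarrow> triangular rw (gauge C)
     \<and> list_all (\<lambda>(x, l). list_all (\<lambda>(y, c). y \<in> set Y) l) (gauge C)"

definition cover_ok :: "('q \<Rightarrow> ('x \<times> int) list) \<Rightarrow> 'x list \<Rightarrow> 'x list \<Rightarrow> ('x, 'y, 'q) certificate \<Rightarrow> bool" where
  "cover_ok rw X T C \<longleftrightarrow> (let Z = covered rw T C in list_all (\<lambda>x. x \<in> set Z) X)"

definition eqn :: "nat \<Rightarrow> nat \<Rightarrow> nat \<Rightarrow> nat \<Rightarrow> (int \<times> nat \<times> nat \<times> nat \<times> nat) list" where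
  "eqn i j l k = [(1, i, j, l, k)]"

definition eqn1 :: "nat \<Rightarrow> nat \<Rightarrow> nat \<Rightarrow> (int \<times> nat \<times> nat \<times> nat) list" where
  "eqn1 i j k = [(1, i, j, k)]"

definition unit_gauge :: "nat \<Rightarrow> nat \<Rightarrow> nat \<Rightarrow> nat \<Rightarrow> nat \<Rightarrow> (nat \<times> nat \<times> nat) \<times> ((nat \<times> nat) \<times> int) list" where
  "unit_gauge i j k s t = ((i, j, k), [((s, t), 1)])"

text \<open>The linear form that sends v to 576 = 24^2 times the k-th coordinate of [b_i, [b_j, v]]
  - (-1)^{|i||j|} [b_j, [b_i, v]] - [[b_i, b_j], v], the defect of the super Jacobi
  identity.\<close>

definition jacobi_form :: "nat \<Rightarrow> nat \<Rightarrow> nat \<Rightarrow> (nat \<times> int) list" where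
  "jacobi_form i j k =
     concat (map (\<lambda>(s, c). map (\<lambda>(t, e). (t, c * e)) (ad j s)) (ad i k))
   @ concat (map (\<lambda>(s, c). map (\<lambda>(t, e). (t, sg (\<not> (par i \<and> par j)) c * e)) (ad i s)) (ad j k))
   @ concat (map (\<lambda>(s, c). map (\<lambda>(t, e). (t, - c * e)) (ad s k)) (brm i j))"

text \<open>Emptiness means that the coefficient of every coordinate of v cancels. One evaluation
  thus settles the identity for all third arguments in g, of either parity.\<close>

lemma jacobi_forms: "list_all (\<lambda>i. list_all (\<lambda>j. list_all (\<lambda>k. collect (jacobi_form i j k) = [])
    [0..<31]) [0..<11]) [0..<11]"
  by code_simp

lemma brm_skew_forms: "list_all (\<lambda>i. list_all (\<lambda>j.
    collect (brm i j @ map (\<lambda>(t, c). (t, sg (par i \<and> par j) c)) (brm j i)) = []) [0..<11]) [0..<11]"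
  by code_simp

section \<open>The complex in degrees 0 to 3\<close>

lemma G3M_acting: "i \<in> G3M \<Longrightarrow> i \<in> acting" "i \<in> G3M \<Longrightarrow> i < 31" "i \<in> G3M \<Longrightarrow> i \<in> G3B"
  by (auto simp: G3M_def G3B_def acting_def)

lemma gbr_expand: "gbr u v k = (\<Sum>i\<in>G3B. u i * gbr (bv i) v k)"
  unfolding gbr_def[of u] by (rule sum.cong) (auto simp: gbr_bv_sum G3B_def sum_distrib_left mult.assoc)

lemma gbr_bv_bv: "i < 31 \<Longrightarrow> j < 31 \<Longrightarrow> gbr (bv i) (bv j) k = g3sc i j k"
  unfolding gbr_bv_sum unfolding bv_def by (subst sum.mono_neutral_right[of G3B "{j}"]) (auto simp: G3B_def)

lemma gbr_bv_nonzero: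
  assumes "i < 31" "gbr (bv i) v k \<noteq> 0"
  obtains t where "v t \<noteq> 0" "t < 31" "k < 31" "deg k = deg i + deg t" "par k = (par i \<noteq> par t)"
proof -
  obtain t where "v t * g3sc i t k \<noteq> 0"
    using assms by (force simp: gbr_bv_sum dest: sum.not_neutral_contains_not_neutral)
  then show ?thesis using that g3sc_graded[of i t k] by auto
qed

lemma gbr_lin3: "gbr u (\<lambda>k. a * v k - b * w k - x k) k = a * gbr u v k - b * gbr u w k - gbr u x k"
  unfolding gbr_def by (simp add: sum_distrib_left sum.distrib sum_subtractf algebra_simps)

lemma deg_neg: "k < 31 \<Longrightarrow> deg k < 0 \<longleftrightarrow> k \<in> G3M"
  by (auto simp: deg_def G3M_def)

lemma deg_acting: "i \<in> acting \<Longrightarrow> deg i \<le> 0"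
  by (auto simp: deg_def acting_def)

lemma row_bounds:
  assumes "i \<in> acting" "(j, k, c) \<in> set (row i)"
  shows "j < 31" "k < 31"
proof -
  have "((i, j, k), of_int c / 24) \<in> set (filter (\<lambda>e. fst (fst e) = i) g3_table)"
    unfolding row_table[OF assms(1)] using assms(2) by force
  then have "((i, j, k), of_int c / 24) \<in> set g3_table" by simp
  then show "j < 31" "k < 31" using g3_table_graded by (auto simp: list_all_iff)
qed

text \<open>Indices in \<open>acting\<close> have degree at most 0, and m is the part of negative
  degree, so these brackets stay in m.\<close>

lemma bracket_outside:
  assumes "i \<in> acting" "j \<in> G3M" "t \<notin> G3M"
  shows "gbr (bv i) (bv j) t = 0"
proof (rule ccontr)
  have ij: "i < 31" "j < 31" using assms by (auto simp: acting_def G3M_def)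
  assume "gbr (bv i) (bv j) t \<noteq> 0"
  then have "t < 31" "deg t = deg i + deg j" using g3sc_graded by (metis gbr_bv_bv[OF ij])+
  then show False
    using deg_acting[OF assms(1)] assms(2,3) deg_neg[OF ij(2)] deg_neg[of t] by auto
qed

text \<open>Sums weighted by the coordinates of a bracket occur in \<open>apply1\<close>,
  \<open>apply2\<close> and in iterated brackets; here they become integer forms.\<close>

lemma brm_sum:
  assumes "i \<in> acting" "j \<in> G3M"
  shows "(\<Sum>t\<in>G3M. gbr (bv i) (bv j) t * f t) = ev f (brm i j) / 24"
proof -
  have *: "(\<Sum>t\<in>G3B. ev (bv j) (sel_row t r) * f t) = ev f (sel_col j r)"
    if "\<forall>(j, k, c)\<in>set r. k < 31" for r
    using that
  proof (induction r)
    case (Cons e r)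
    obtain j' k c where e: "e = (j', k, c)" by (metis prod.collapse)
    have "(\<Sum>t\<in>G3B. ev (bv j) (sel_row t (e # r)) * f t)
        = (\<Sum>t\<in>G3B. (if t = k then of_int c * bv j j' * f k else 0) + ev (bv j) (sel_row t r) * f t)"
      by (rule sum.cong) (auto simp: e algebra_simps)
    also have "\<dots> = of_int c * bv j j' * f k + ev f (sel_col j r)"
      using Cons by (simp add: sum.distrib G3B_def e)
    finally show ?case by (simp add: e bv_def)
  qed simp
  have "(\<Sum>t\<in>G3M. gbr (bv i) (bv j) t * f t) = (\<Sum>t\<in>G3B. gbr (bv i) (bv j) t * f t)"
    using bracket_outside[OF assms] by (intro sum.mono_neutral_left) (auto simp: G3M_def G3B_def)
  also have "\<dots> = (\<Sum>t\<in>G3B. ev (bv j) (sel_row t (row i)) * f t) / 24"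
    using assms(1) by (simp add: gbr_bv ad_def sum_divide_distrib)
  also have "\<dots> = ev f (brm i j) / 24"
    using * row_bounds[OF assms(1)] by (force simp: brm_def)
  finally show ?thesis .
qed

lemma gbr_bracket:
  assumes "i \<in> acting" "j \<in> G3M"
  shows "gbr (gbr (bv i) (bv j)) v k = (\<Sum>t\<in>G3M. gbr (bv i) (bv j) t * gbr (bv t) v k)"
  unfolding gbr_expand[of "gbr (bv i) (bv j)"]
  using bracket_outside[OF assms] by (intro sum.mono_neutral_right) (auto simp: G3M_def G3B_def)

lemma ev_collect_Nil: "collect r = [] \<Longrightarrow> ev f r = 0"
  by (metis ev_collect ev_simps(1))

lemma ev_nested:
  "ev f (concat (map (\<lambda>(s, c). map (\<lambda>(t, e). (t, h c * e)) (g s)) r))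
     = ev (\<lambda>s. ev f (g s)) (map (\<lambda>(s, c). (s, h c)) r)"
  by (induction r) (auto simp: ev_map_scale)

lemma of_int_sg: "of_int (sg b c) = (if b then -1 else 1) * (of_int c :: complex)"
  by (simp add: sg_def)

lemma ev_sg: "ev f (map (\<lambda>(t, c). (t, sg b c)) r) = (if b then -1 else 1) * ev f r"
  by (induction r) (auto simp: of_int_sg algebra_simps)

lemma ev_sg_map: "ev f (map (\<lambda>(t, c). (g t, sg b c)) r) = (if b then -1 else 1) * ev (\<lambda>t. f (g t)) r"
  by (induction r) (auto simp: of_int_sg algebra_simps)

lemma ev_minus_map: "ev f (map (\<lambda>(t, c). (g t, - c)) r) = - ev (\<lambda>t. f (g t)) r"
  by (induction r) (auto simp: algebra_simps)

lemma brm_skew: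
  assumes "i \<in> G3M" "j \<in> G3M"
  shows "gbr (bv j) (bv i) = (\<lambda>k. (if par i \<and> par j then 1 else -1) * gbr (bv i) (bv j) k)"
proof
  fix k
  show "gbr (bv j) (bv i) k = (if par i \<and> par j then 1 else -1) * gbr (bv i) (bv j) k"
  proof (cases "k \<in> G3M")
    case False
    then show ?thesis using bracket_outside assms G3M_acting(1) by simp
  next
    case True
    have br: "gbr (bv a) (bv b) k = ev (bv k) (brm a b) / 24" if "a \<in> G3M" "b \<in> G3M" for a b
    proof -
      have "ev (bv k) (brm a b) / 24 = (\<Sum>t\<in>G3M. gbr (bv a) (bv b) t * bv k t)"
        using brm_sum that G3M_acting by metis
      also have "\<dots> = (\<Sum>t\<in>G3M. if t = k then gbr (bv a) (bv b) k else 0)"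
        by (rule sum.cong) (auto simp: bv_def)
      finally show ?thesis using True by (simp add: G3M_def)
    qed
    have "collect (brm i j @ map (\<lambda>(t, c). (t, sg (par i \<and> par j) c)) (brm j i)) = []"
      using brm_skew_forms assms by (auto simp: list_all_iff G3M_def)
    from ev_collect_Nil[OF this, of "bv k"] show ?thesis
      by (cases "par i \<and> par j") (auto simp: br assms ev_sg add_eq_0_iff)
  qed
qed

lemma jacobi:
  assumes "i \<in> G3M" "j \<in> G3M"
  shows "gbr (gbr (bv i) (bv j)) v = (\<lambda>k. 1 * gbr (bv i) (gbr (bv j) v) k
           + (if par i \<and> par j then 1 else -1) * gbr (bv j) (gbr (bv i) v) k)"
proof
  fix k
  show "gbr (gbr (bv i) (bv j)) v k = 1 * gbr (bv i) (gbr (bv j) v) k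
           + (if par i \<and> par j then 1 else -1) * gbr (bv j) (gbr (bv i) v) k"
  proof (cases "k < 31")
    case False
    have "gbr u w k = 0" for u w
      using False g3sc_graded(3) by (force simp: gbr_def intro!: sum.neutral)
    then show ?thesis by simp
  next
    case True
    note ij = assms[THEN G3M_acting(1)]
    have d: "ev (\<lambda>t. f t / 24) r = ev f r / 24" for f :: "nat \<Rightarrow> complex" and r
      by (induction r) (auto simp: add_divide_distrib)
    have gb: "gbr (bv a) w = (\<lambda>s. ev w (ad a s) / 24)" if "a \<in> acting" for a w
      using that gbr_bv by blast
    have "collect (jacobi_form i j k) = []"
      using jacobi_forms assms True by (auto simp: list_all_iff G3M_def)
    from ev_collect_Nil[OF this, of v]
    have h: "ev (\<lambda>s. ev v (ad j s)) (ad i k) + (if \<not> (par i \<and> par j) then - 1 else 1) * ev (\<lambda>s. ev v (ad i s)) (ad j k)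
        - ev (\<lambda>s. ev v (ad s k)) (brm i j) = 0"
      unfolding jacobi_form_def ev_simps
        ev_nested[where h = "\<lambda>c. c" and g = "ad j" and r = "ad i k", simplified]
        ev_nested[where h = "sg (\<not> (par i \<and> par j))" and g = "ad i" and r = "ad j k"]
        ev_nested[where h = uminus and g = "\<lambda>s. ad s k" and r = "brm i j"] ev_sg
        ev_minus_map[where g = "\<lambda>t. t"]
      by (simp only: add.assoc diff_conv_add_uminus)
    moreover have "gbr (bv i) (gbr (bv j) v) k = ev (\<lambda>s. ev v (ad j s)) (ad i k) / 576"
      by (simp add: gb[OF ij(1)] gb[OF ij(2)] d)
    moreover have "gbr (bv j) (gbr (bv i) v) k = ev (\<lambda>s. ev v (ad i s)) (ad j k) / 576"
      by (simp add: gb[OF ij(1)] gb[OF ij(2)] d)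
    moreover have "gbr (gbr (bv i) (bv j)) v k = ev (\<lambda>s. ev v (ad s k)) (brm i j) / 576"
    proof -
      have "gbr (gbr (bv i) (bv j)) v k = (\<Sum>t\<in>G3M. gbr (bv i) (bv j) t * (ev v (ad t k) / 24))"
        unfolding gbr_bracket[OF ij(1) assms(2)]
        by (rule sum.cong) (auto simp: gbr_bv G3M_acting)
      also have "\<dots> = ev (\<lambda>t. ev v (ad t k) / 24) (brm i j) / 24"
        by (rule brm_sum[OF ij(1) assms(2)])
      finally show ?thesis by (simp add: d)
    qed
    moreover have "ev (\<lambda>s. ev v (ad s k)) (brm i j) = ev (\<lambda>s. ev v (ad j s)) (ad i k)
        + (if par i \<and> par j then 1 else -1) * ev (\<lambda>s. ev v (ad i s)) (ad j k)"
      using h by (cases "par i \<and> par j") (auto simp: algebra_simps)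
    ultimately show ?thesis
      by (simp only: add_divide_distrib times_divide_eq_right mult_1)
  qed
qed

section \<open>The differentials as integer linear forms\<close>

lemma ssgn_simps [simp]: "ssgn 0 = 1" "ssgn (Suc n) = - ssgn n" "ssgn (m + n) = ssgn m * ssgn n"
  by (simp_all add: ssgn_def power_add)

lemma apply1_bracket:
  assumes "i \<in> acting" "j \<in> G3M"
  shows "apply1 psi (gbr (bv i) (bv j)) k = ev (\<lambda>t. psi t k) (brm i j) / 24"
  unfolding apply1_def by (rule brm_sum[OF assms])

lemma apply2_bv_right: "l \<in> G3M \<Longrightarrow> apply2 phi u (bv l) k = (\<Sum>t\<in>G3M. u t * phi t l k)"
proof -
  assume l: "l \<in> G3M"
  have "(\<Sum>j\<in>G3M. u t * bv l j * phi t j k) = u t * phi t l k" for t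
    using l unfolding bv_def by (subst sum.mono_neutral_right[of G3M "{l}"]) (auto simp: G3M_def)
  then show ?thesis by (simp add: apply2_def)
qed

lemma apply2_bracket:
  assumes "i \<in> acting" "j \<in> G3M" "l \<in> G3M"
  shows "apply2 phi (gbr (bv i) (bv j)) (bv l) k = ev (\<lambda>t. phi t l k) (brm i j) / 24"
  unfolding apply2_bv_right[OF assms(3)] by (rule brm_sum[OF assms(1,2)])

lemma ce_d0_row: "ce_d0 (of_bool p) v i k = ev v (row0 p (i, k)) / 24"
proof (cases "i \<in> G3M")
  case True
  then show ?thesis
    using G3M_acting[OF True] True[unfolded G3M_def]
    by (cases p; cases "par i"; simp add: ce_d0_def row0_def ev_sg gbr_bv gpar_eq)
qed (simp add: ce_d0_def row0_def G3M_def)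

text \<open>Holds for all indices: outside m the differential is zero by definition and the row is
  empty.\<close>

lemma ce_d1_row: "ce_d1 (of_bool p) psi i j k = ev (\<lambda>(i, k). psi i k) (row1 p (i, j, k)) / 24"
proof (cases "i \<in> G3M \<and> j \<in> G3M")
  case True
  then have ij: "i \<in> acting" "j \<in> acting" "i < 31" "j < 31" by (auto simp: G3M_acting)
  show ?thesis
    using True conjunct1[OF True, unfolded G3M_def] conjunct2[OF True, unfolded G3M_def]
    unfolding ce_d1_def row1_def
    by (cases p; cases "par i"; cases "par j";
        simp add: ev_sg_map ev_minus_map gbr_bv apply1_bracket ij gpar_eq diff_divide_distrib add_divide_distrib)
qed (auto simp: ce_d1_def row1_def G3M_def)

definition skew2 :: "(nat \<Rightarrow> nat \<Rightarrow> g3vec) \<Rightarrow> bool" where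
  "skew2 phi \<longleftrightarrow> (\<forall>i\<in>G3M. \<forall>j\<in>G3M. \<forall>k. phi j i k = (if par i \<and> par j then 1 else -1) * phi i j k)"

lemma skew2_diag:
  assumes "skew2 phi" "i \<in> G3M" "\<not> par i"
  shows "phi i i k = 0"
proof -
  have "phi i i k = - phi i i k" using assms unfolding skew2_def by fastforce
  then have "2 * phi i i k = 0" by (metis add.right_inverse mult_2)
  then show ?thesis by simp
qed

lemma ev_skew_term:
  assumes "skew2 phi" "i \<in> G3M" "j \<in> G3M"
  shows "ev (\<lambda>(i, j, k). phi i j k) (skew_term i j k c) = of_int c * phi i j k"
proof (cases "i = j \<and> \<not> par i")
  case True
  then have "phi i j k = 0" using skew2_diag assms by metis
  then show ?thesis using True by (simp add: skew_term_def)
next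
  case False
  have sw: "phi j i k = (if par i \<and> par j then 1 else -1) * phi i j k"
    using assms unfolding skew2_def by blast
  show ?thesis
  proof (cases "j < i")
    case True
    then show ?thesis by (simp add: skew_term_def of_int_sg sw)
  next
    case False
    then show ?thesis using \<open>\<not> (i = j \<and> \<not> par i)\<close> by (auto simp: skew_term_def)
  qed
qed

lemma ev_skew_terms:
  assumes "skew2 phi" "\<And>t c. (t, c) \<in> set r \<Longrightarrow> a t \<in> G3M \<and> b t \<in> G3M"
  shows "ev (\<lambda>(i, j, k). phi i j k) (concat (map (\<lambda>(t, c). skew_term (a t) (b t) (g t) (sg s c)) r))
     = (if s then -1 else 1) * ev (\<lambda>t. phi (a t) (b t) (g t)) r"
  using assms(2)
proof (induction r)
  case (Cons e r)
  obtain t c where e: "e = (t, c)" by force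
  have ab: "a t \<in> G3M" "b t \<in> G3M" using Cons.prems e by auto
  have IH: "ev (\<lambda>(i, j, k). phi i j k) (concat (map (\<lambda>(t, c). skew_term (a t) (b t) (g t) (sg s c)) r))
     = (if s then -1 else 1) * ev (\<lambda>t. phi (a t) (b t) (g t)) r"
    by (rule Cons.IH) (use Cons.prems in auto)
  show ?case
    unfolding e list.map concat.simps prod.case ev_simps IH ev_skew_term[OF assms(1) ab] of_int_sg
    by (simp add: algebra_simps)
qed simp

lemma bracket_in:
  assumes "i \<in> acting" "j \<in> G3M" "(t, c) \<in> set (brm i j)"
  shows "t \<in> G3M"
proof -
  have *: "(t, c) \<in> set (sel_col j r) \<Longrightarrow> (j, t, c) \<in> set r" for r
    by (induction r) (auto split: if_splits)
  have "(j, t, c) \<in> set (row i)" using assms(3) * by (simp add: brm_def)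
  then have "((i, j, t), of_int c / 24) \<in> set (filter (\<lambda>e. fst (fst e) = i) g3_table)"
    unfolding row_table[OF assms(1)] by force
  then have "((i, j, t), of_int c / 24) \<in> set g3_table" by simp
  then have "t < 31" "deg t = deg i + deg j" using g3_table_graded by (auto simp: list_all_iff)
  then show ?thesis
    using assms deg_neg deg_acting[OF assms(1)] G3M_acting(2)[OF assms(2)]
    by (smt (verit))
qed

text \<open>Skew-symmetry is what allows the differential to be written in the coordinates with
  ordered arguments that \<open>skew_term\<close> produces.\<close>

lemma ce_d2_row:
  assumes "skew2 phi" "i \<in> G3M" "j \<in> G3M" "l \<in> G3M"
  shows "ce_d2 (of_bool p) phi i j l k = ev (\<lambda>(i, j, k). phi i j k) (row2 p (i, j, l, k)) / 24"
proof -
  note ijl = assms(2-4)[THEN G3M_acting(1)] assms(2-4)[THEN G3M_acting(2)]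
  have m: "concat (map (\<lambda>(t, c). skew_term (a t) (b t) (g t) (- c)) r)
         = concat (map (\<lambda>(t, c). skew_term (a t) (b t) (g t) (sg True c)) r)" for a b g r
    by (simp add: sg_def)
  have ad: "ev (\<lambda>(i, j, k). phi i j k) (concat (map (\<lambda>(t, c). skew_term a b t (sg s c)) r))
     = (if s then -1 else 1) * ev (phi a b) r" if "a \<in> G3M" "b \<in> G3M" for a b s r
    using ev_skew_terms[OF assms(1), of r "\<lambda>_. a" "\<lambda>_. b" "\<lambda>t. t" s] that by simp
  have br: "ev (\<lambda>(i, j, k). phi i j k) (concat (map (\<lambda>(t, c). skew_term t b k (sg s c)) (brm x y)))
     = (if s then -1 else 1) * ev (\<lambda>t. phi t b k) (brm x y)" if "b \<in> G3M" "x \<in> G3M" "y \<in> G3M" for b s x y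
    by (rule ev_skew_terms[OF assms(1), of "brm x y" "\<lambda>t. t" "\<lambda>_. b" "\<lambda>_. k" s])
      (use that bracket_in G3M_acting(1) in blast)
  show ?thesis
    using assms(2-4) unfolding ce_d2_def row2_def Let_def m
    by (cases p; cases "par i"; cases "par j"; cases "par l";
        simp add: ad br gbr_bv apply2_bracket ijl gpar_eq G3M_def diff_divide_distrib add_divide_distrib)
qed

section \<open>The square of the differential vanishes\<close>

abbreviation sgn_if :: "bool \<Rightarrow> complex" where "sgn_if b \<equiv> (if b then -1 else 1)"

text \<open>The bracket is homogeneous, so every basis vector that occurs in it has the same parity
  and a sign depending on that parity can be pulled out of the sum.\<close>

lemma bracket_parity:
  assumes "i \<in> G3M" "j \<in> G3M"
  shows "(\<Sum>t\<in>G3M. gbr (bv i) (bv j) t * (h (par t) * f t))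
       = h (par i \<noteq> par j) * (\<Sum>t\<in>G3M. gbr (bv i) (bv j) t * f t)"
proof -
  have "par t = (par i \<noteq> par j)" if "gbr (bv i) (bv j) t \<noteq> 0" for t
    using that g3sc_graded(5) assms by (simp add: gbr_bv_bv G3M_acting)
  then have "gbr (bv i) (bv j) t * (h (par t) * f t) = h (par i \<noteq> par j) * (gbr (bv i) (bv j) t * f t)" for t
    by (cases "gbr (bv i) (bv j) t = 0") auto
  then show ?thesis unfolding sum_distrib_left by (intro sum.cong refl)
qed

lemma gbr_sum: "gbr w (\<lambda>k. \<Sum>t\<in>T. u t * f t k) k = (\<Sum>t\<in>T. u t * gbr w (f t) k)"
proof -
  have "gbr w (\<lambda>k. \<Sum>t\<in>T. u t * f t k) k
      = (\<Sum>i\<in>G3B. \<Sum>t\<in>T. \<Sum>j\<in>G3B. u t * (w i * f t j * g3sc i j k))"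
    unfolding gbr_def sum_distrib_left sum_distrib_right
    by (subst sum.swap[of _ T]) (simp add: mult_ac)
  also have "\<dots> = (\<Sum>t\<in>T. \<Sum>i\<in>G3B. \<Sum>j\<in>G3B. u t * (w i * f t j * g3sc i j k))"
    by (rule sum.swap)
  finally show ?thesis by (simp add: gbr_def sum_distrib_left)
qed

lemma apply1_lin: "apply1 psi (\<lambda>k. a * v k + b * w k) k = a * apply1 psi v k + b * apply1 psi w k"
  by (simp add: apply1_def sum_distrib_left sum.distrib algebra_simps)

lemma apply1_scale: "apply1 psi (\<lambda>k. a * v k) k = a * apply1 psi v k"
  by (simp add: apply1_def sum_distrib_left algebra_simps)

lemma gbr_scale: "gbr u (\<lambda>k. a * v k) = (\<lambda>k. a * gbr u v k)"
  by (simp add: gbr_def sum_distrib_left algebra_simps)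

lemma apply1_sum: "apply1 psi (\<lambda>s. \<Sum>t\<in>T. u t * f t s) k = (\<Sum>t\<in>T. u t * apply1 psi (f t) k)"
  unfolding apply1_def sum_distrib_left sum_distrib_right
  by (subst sum.swap) (simp add: mult_ac)

lemma ce_d1_eq:
  assumes "i \<in> G3M" "j \<in> G3M"
  shows "ce_d1 (of_bool p) psi i j = (\<lambda>k. sgn_if (p \<and> par i) * gbr (bv i) (psi j) k
      - sgn_if (par j \<and> par i \<noteq> p) * gbr (bv j) (psi i) k - apply1 psi (gbr (bv i) (bv j)) k)"
  using assms assms[THEN G3M_acting(2)]
  by (cases p; cases "par i"; cases "par j"; simp add: ce_d1_def gpar_eq)

lemma ce_d2_eq:
  assumes "i \<in> G3M" "j \<in> G3M" "l \<in> G3M"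
  shows "ce_d2 (of_bool p) phi i j l k =
        sgn_if (p \<and> par i) * gbr (bv i) (phi j l) k
      - sgn_if (par j \<and> par i \<noteq> p) * gbr (bv j) (phi i l) k
      + sgn_if (par l \<and> (par i \<noteq> par j) \<noteq> p) * gbr (bv l) (phi i j) k
      - apply2 phi (gbr (bv i) (bv j)) (bv l) k
      + sgn_if (par j \<and> par l) * apply2 phi (gbr (bv i) (bv l)) (bv j) k
      - sgn_if (par i \<and> par j \<noteq> par l) * apply2 phi (gbr (bv j) (bv l)) (bv i) k"
  using assms[THEN G3M_acting(2)]
  by (cases p; cases "par i"; cases "par j"; cases "par l"; simp add: ce_d2_def gpar_eq)

text \<open>By linearity the defining formula of \<open>ce_d1\<close> carries over from a basis
  vector to the element [b_i, b_j], whose parity is the sum of the parities of b_i and b_j.\<close>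

lemma apply2_ce_d1:
  assumes "i \<in> G3M" "j \<in> G3M" "l \<in> G3M"
  shows "apply2 (ce_d1 (of_bool p) psi) (gbr (bv i) (bv j)) (bv l) k
       = sgn_if (p \<and> par i \<noteq> par j) * gbr (gbr (bv i) (bv j)) (psi l) k
       - sgn_if (par l \<and> (par i \<noteq> par j) \<noteq> p) * gbr (bv l) (apply1 psi (gbr (bv i) (bv j))) k
       - apply1 psi (gbr (gbr (bv i) (bv j)) (bv l)) k"
proof -
  let ?u = "gbr (bv i) (bv j)"
  have "apply2 (ce_d1 (of_bool p) psi) ?u (bv l) k
      = (\<Sum>t\<in>G3M. ?u t * (sgn_if (p \<and> par t) * gbr (bv t) (psi l) k))
      - (\<Sum>t\<in>G3M. ?u t * (sgn_if (par l \<and> par t \<noteq> p) * gbr (bv l) (psi t) k))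
      - (\<Sum>t\<in>G3M. ?u t * apply1 psi (gbr (bv t) (bv l)) k)"
    unfolding apply2_bv_right[OF assms(3)] sum_subtractf[symmetric]
    by (rule sum.cong) (auto simp: ce_d1_eq assms(3) algebra_simps)
  moreover have "(\<Sum>t\<in>G3M. ?u t * apply1 psi (gbr (bv t) (bv l)) k) = apply1 psi (gbr ?u (bv l)) k"
    unfolding gbr_bracket[OF G3M_acting(1)[OF assms(1)] assms(2)] apply1_sum ..
  moreover have "(\<Sum>t\<in>G3M. ?u t * gbr (bv l) (psi t) k) = gbr (bv l) (apply1 psi ?u) k"
    unfolding apply1_def gbr_sum ..
  moreover have "(\<Sum>t\<in>G3M. ?u t * gbr (bv t) (psi l) k) = gbr ?u (psi l) k"
    unfolding gbr_bracket[OF G3M_acting(1)[OF assms(1)] assms(2)] ..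
  ultimately show ?thesis
    using bracket_parity[OF assms(1,2), of "\<lambda>b. sgn_if (p \<and> b)" "\<lambda>t. gbr (bv t) (psi l) k"]
      bracket_parity[OF assms(1,2), of "\<lambda>b. sgn_if (par l \<and> b \<noteq> p)" "\<lambda>t. gbr (bv l) (psi t) k"]
    by simp
qed

lemma bracket_skew:
  assumes "i \<in> G3M" "j \<in> G3M" "l \<in> G3M"
  shows "gbr (gbr (bv i) (bv j)) (bv l)
       = (\<lambda>k. - sgn_if (par l \<and> par i \<noteq> par j) * gbr (bv l) (gbr (bv i) (bv j)) k)"
proof
  fix k
  let ?u = "gbr (bv i) (bv j)"
  note a = G3M_acting(1)[OF assms(1)]
  have "gbr (bv l) ?u k = (\<Sum>t\<in>G3B. ?u t * gbr (bv l) (bv t) k)"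
    unfolding gbr_bv_sum[OF G3M_acting(2)[OF assms(3)], of ?u]
    by (rule sum.cong) (simp_all add: gbr_bv_bv G3M_acting(2)[OF assms(3)] G3B_def)
  also have "\<dots> = (\<Sum>t\<in>G3M. ?u t * gbr (bv l) (bv t) k)"
    using bracket_outside[OF a assms(2)] by (intro sum.mono_neutral_right) (auto simp: G3M_def G3B_def)
  finally have "- sgn_if (par l \<and> par i \<noteq> par j) * gbr (bv l) ?u k
      = (\<Sum>t\<in>G3M. ?u t * (- sgn_if (par l \<and> par t) * gbr (bv l) (bv t) k))"
    using bracket_parity[OF assms(1,2), of "\<lambda>b. - sgn_if (par l \<and> b)" "\<lambda>t. gbr (bv l) (bv t) k"]
    by simp
  also have "\<dots> = gbr ?u (bv l) k"
    unfolding gbr_bracket[OF a assms(2)]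
    by (rule sum.cong) (auto simp: brm_skew[OF assms(3)])
  finally show "gbr ?u (bv l) k = - sgn_if (par l \<and> par i \<noteq> par j) * gbr (bv l) ?u k" ..
qed

text \<open>Brackets of two elements of m with a value of psi cancel by the Jacobi identity in g,
  the brackets with psi of a bracket cancel in pairs, and the values of psi on double brackets
  cancel by the Jacobi identity of m.\<close>

lemma ce_d2_ce_d1:
  assumes "i \<in> G3M" "j \<in> G3M" "l \<in> G3M"
  shows "ce_d2 (of_bool p) (ce_d1 (of_bool p) psi) i j l k = 0"
proof -
  have jac: "gbr (gbr (bv a) (bv b)) v k = gbr (bv a) (gbr (bv b) v) k - sgn_if (par a \<and> par b) * gbr (bv b) (gbr (bv a) v) k"
    if "a \<in> G3M" "b \<in> G3M" for a b v
    by (subst jacobi[OF that]) simp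
  have jac1: "apply1 psi (gbr (gbr (bv a) (bv b)) v) k = apply1 psi (gbr (bv a) (gbr (bv b) v)) k
      - sgn_if (par a \<and> par b) * apply1 psi (gbr (bv b) (gbr (bv a) v)) k"
    if "a \<in> G3M" "b \<in> G3M" for a b v
    by (subst jacobi[OF that]) (simp add: apply1_lin[of psi 1, simplified])
  have sk: "apply1 psi (gbr (bv c) (gbr (bv b) (bv a))) k
      = - sgn_if (par a \<and> par b) * apply1 psi (gbr (bv c) (gbr (bv a) (bv b))) k"
    if "a \<in> G3M" "b \<in> G3M" for a b c
    unfolding brm_skew[OF that] gbr_scale apply1_scale by simp
  have "apply1 psi (gbr (gbr (bv i) (bv j)) (bv l)) k
      = - sgn_if (par l \<and> par i \<noteq> par j) * apply1 psi (gbr (bv l) (gbr (bv i) (bv j))) k"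
    unfolding bracket_skew[OF assms] by (rule apply1_scale)
  \<comment> \<open>Once \<open>sk\<close> has ordered the inner brackets, psi is evaluated on three
    double brackets only. This relation eliminates one of them; what remains is a sign check for the
    16 parity patterns.\<close>
  then have cyc: "apply1 psi (gbr (bv l) (gbr (bv i) (bv j))) k
      = - sgn_if (par l \<and> par i \<noteq> par j) * (apply1 psi (gbr (bv i) (gbr (bv j) (bv l))) k
      - sgn_if (par i \<and> par j) * apply1 psi (gbr (bv j) (gbr (bv i) (bv l))) k)"
    unfolding jac1[OF assms(1,2)] by (cases "par l \<and> par i \<noteq> par j") auto
  show ?thesis
    using cyc sk[OF assms(1,2), of l] sk[OF assms(1,3), of j] sk[OF assms(2,3), of i]
    unfolding ce_d2_eq[OF assms] apply2_ce_d1[OF assms(1,2,3)] apply2_ce_d1[OF assms(1,3,2)]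
      apply2_ce_d1[OF assms(2,3,1)] ce_d1_eq[OF assms(1,2)] ce_d1_eq[OF assms(1,3)]
      ce_d1_eq[OF assms(2,3)] gbr_lin3 jac[OF assms(1,2)] jac[OF assms(1,3)] jac[OF assms(2,3)]
      jac1[OF assms(1,2)] jac1[OF assms(1,3)] jac1[OF assms(2,3)]
    by (cases p; cases "par i"; cases "par j"; cases "par l"; simp)
qed

lemma ce_d1_ce_d0:
  assumes "i \<in> G3M" "j \<in> G3M"
  shows "ce_d1 (of_bool p) (ce_d0 (of_bool p) v) i j k = 0"
proof -
  have d0: "ce_d0 (of_bool p) v t = (\<lambda>k. sgn_if (p \<and> par t) * gbr (bv t) v k)" if "t \<in> G3M" for t
    using that G3M_acting(2)[OF that] by (cases p; cases "par t"; simp add: ce_d0_def gpar_eq)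
  have "apply1 (ce_d0 (of_bool p) v) (gbr (bv i) (bv j)) k
      = (\<Sum>t\<in>G3M. gbr (bv i) (bv j) t * (sgn_if (p \<and> par t) * gbr (bv t) v k))"
    unfolding apply1_def by (rule sum.cong) (auto simp: d0)
  also have "\<dots> = sgn_if (p \<and> par i \<noteq> par j) * gbr (gbr (bv i) (bv j)) v k"
    unfolding gbr_bracket[OF G3M_acting(1)[OF assms(1)] assms(2)]
    using bracket_parity[OF assms, of "\<lambda>b. sgn_if (p \<and> b)" "\<lambda>t. gbr (bv t) v k"] by simp
  also have "gbr (gbr (bv i) (bv j)) v k = gbr (bv i) (gbr (bv j) v) k - sgn_if (par i \<and> par j) * gbr (bv j) (gbr (bv i) v) k"
    by (subst jacobi[OF assms]) simp
  finally show ?thesis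
    unfolding ce_d1_eq[OF assms] d0[OF assms(1)] d0[OF assms(2)] gbr_scale
    by (cases p; cases "par i"; cases "par j"; simp)
qed

section \<open>Homogeneous cochains in coordinates\<close>

lemma basis_iff: "k \<in> set (basis d p) \<longleftrightarrow> k < 31 \<and> deg k = d \<and> par k = p"
proof
  assume "k \<in> set (basis d p)"
  then show "k < 31 \<and> deg k = d \<and> par k = p"
    by (auto simp: basis_def deg_def par_def split: if_splits)
next
  have "k \<in> set (basis (deg k) (par k))" if "k < 31"
    using less_31[OF that] unfolding insert_iff empty_iff
    by (elim disjE; simp add: basis_def deg_def par_def)
  then show "k < 31 \<and> deg k = d \<and> par k = p \<Longrightarrow> k \<in> set (basis d p)" by auto
qed

lemma is_gvec_iff: "is_gvec d (of_bool p) v \<longleftrightarrow> (\<forall>k. v k \<noteq> 0 \<longrightarrow> k < 31 \<and> deg k = d \<and> par k = p)"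
  unfolding is_gvec_def G3B_def lessThan_iff
  by (intro arg_cong[of _ _ All] ext imp_cong refl conj_cong) (auto simp: gdeg_eq gpar_eq)

lemma is_cochain1_iff: "is_cochain1 d (of_bool p) psi \<longleftrightarrow>
  (\<forall>i k. psi i k \<noteq> 0 \<longrightarrow> i \<in> G3M \<and> k < 31 \<and> deg k = deg i + d \<and> par k = (par i \<noteq> p))"
  unfolding is_cochain1_def G3B_def lessThan_iff
  by (intro arg_cong[of _ _ All] ext imp_cong refl conj_cong) (auto simp: gdeg_eq gpar_eq G3M_acting)

lemma coords1_iff: "(i, k) \<in> set (coords1 d p) \<longleftrightarrow> i \<in> G3M \<and> k < 31 \<and> deg k = deg i + d \<and> par k = (par i \<noteq> p)"
  unfolding coords1_def G3M_def basis_iff[symmetric] by (simp add: image_iff)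

text \<open>Completeness of the list of coordinates: together with skew-symmetry, vanishing on the
  list forces the whole cochain to vanish.\<close>

lemma coords2_I:
  assumes "i \<in> G3M" "j \<in> G3M" "i < j \<or> i = j \<and> par i" "k < 31" "deg k = deg i + deg j + d"
    "par k = ((par i \<noteq> par j) \<noteq> p)"
  shows "(i, j, k) \<in> set (coords2 d p)"
proof -
  have k: "k \<in> set (basis (deg i + deg j + d) ((par i \<noteq> par j) \<noteq> p))"
    using assms by (simp add: basis_iff)
  have ij: "i \<in> set [0..<11]" "j \<in> set [if par i then i else Suc i..<11]"
    using assms by (auto simp: G3M_def)
  have enum: "(i, j, k) \<in> set (concat (map (\<lambda>i. concat (map (\<lambda>j. map (\<lambda>k. (i, j, k)) (F i j)) (L i))) M))"
    if "k \<in> set (F i j)" "i \<in> set M" "j \<in> set (L i)" for F :: "nat \<Rightarrow> nat \<Rightarrow> nat list" and L M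
    using that by (auto simp: image_iff)
  show ?thesis unfolding coords2_def by (rule enum) (rule k ij)+
qed

text \<open>Outside m, where \<open>gpar\<close> may be read past the end of its list, both sides
  are zero. Skew-symmetry can thus be stated on m alone, with boolean parities.\<close>

lemma skew_outside:
  assumes "\<And>i j k. phi i j k \<noteq> 0 \<Longrightarrow> i \<in> G3M \<and> j \<in> G3M"
  shows "(\<forall>i j k. phi j i k = - ssgn (gpar i * gpar j) * phi i j k) \<longleftrightarrow> skew2 phi"
proof -
  have sgn: "- ssgn (gpar i * gpar j) = (if par i \<and> par j then 1 else -1)" if "i \<in> G3M" "j \<in> G3M" for i j
    using that by (simp add: gpar_eq G3M_acting)
  show ?thesis
  proof
    assume *: "\<forall>i j k. phi j i k = - ssgn (gpar i * gpar j) * phi i j k"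
    show "skew2 phi"
      unfolding skew2_def
    proof (intro ballI allI)
      fix i j k assume ij: "i \<in> G3M" "j \<in> G3M"
      have "phi j i k = - ssgn (gpar i * gpar j) * phi i j k" using * by blast
      then show "phi j i k = (if par i \<and> par j then 1 else -1) * phi i j k" unfolding sgn[OF ij] .
    qed
  next
    assume *: "skew2 phi"
    show "\<forall>i j k. phi j i k = - ssgn (gpar i * gpar j) * phi i j k"
    proof (intro allI)
      fix i j k
      show "phi j i k = - ssgn (gpar i * gpar j) * phi i j k"
      proof (cases "i \<in> G3M \<and> j \<in> G3M")
        case True
        then have "phi j i k = (if par i \<and> par j then 1 else -1) * phi i j k"
          using * unfolding skew2_def by blast
        then show ?thesis using sgn True by metis
      next
        case False
        then have "phi i j k = 0" "phi j i k = 0" using assms by blast+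
        then show ?thesis by simp
      qed
    qed
  qed
qed

lemma is_cochain2_iff: "is_cochain2 d (of_bool p) phi \<longleftrightarrow> skew2 phi \<and>
  (\<forall>i j k. phi i j k \<noteq> 0 \<longrightarrow> i \<in> G3M \<and> j \<in> G3M \<and> k < 31 \<and> deg k = deg i + deg j + d
     \<and> par k = ((par i \<noteq> par j) \<noteq> p))"
proof -
  have "(\<forall>i j k. phi i j k \<noteq> 0 \<longrightarrow> i \<in> G3M \<and> j \<in> G3M \<and> k \<in> G3B \<and>
        gdeg k = gdeg i + gdeg j + d \<and> even (gpar k + gpar i + gpar j + of_bool p))
    \<longleftrightarrow> (\<forall>i j k. phi i j k \<noteq> 0 \<longrightarrow> i \<in> G3M \<and> j \<in> G3M \<and> k < 31 \<and> deg k = deg i + deg j + d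
     \<and> par k = ((par i \<noteq> par j) \<noteq> p))"
    unfolding G3B_def lessThan_iff
    by (intro arg_cong[of _ _ All] ext imp_cong refl conj_cong) (auto simp: gdeg_eq gpar_eq G3M_acting)
  then show ?thesis unfolding is_cochain2_def using skew_outside[of phi] by blast
qed

lemma is_cochain1_ce_d0:
  assumes "is_gvec d (of_bool p) v"
  shows "is_cochain1 d (of_bool p) (ce_d0 (of_bool p) v)"
  unfolding is_cochain1_iff
proof (intro allI impI)
  fix i k assume nz: "ce_d0 (of_bool p) v i k \<noteq> 0"
  then have i: "i \<in> G3M" and "gbr (bv i) v k \<noteq> 0" by (auto simp: ce_d0_def split: if_splits)
  then obtain t where "v t \<noteq> 0" "t < 31" "k < 31" "deg k = deg i + deg t" "par k = (par i \<noteq> par t)"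
    using gbr_bv_nonzero G3M_acting(2) by blast
  then show "i \<in> G3M \<and> k < 31 \<and> deg k = deg i + d \<and> par k = (par i \<noteq> p)"
    using i assms unfolding is_gvec_iff by auto
qed

lemma is_cochain2_ce_d1:
  assumes "is_cochain1 d (of_bool p) psi"
  shows "is_cochain2 d (of_bool p) (ce_d1 (of_bool p) psi)"
  unfolding is_cochain2_iff
proof (intro conjI allI impI)
  show "skew2 (ce_d1 (of_bool p) psi)"
    unfolding skew2_def
  proof (intro ballI allI)
    fix i j k assume ij: "i \<in> G3M" "j \<in> G3M"
    show "ce_d1 (of_bool p) psi j i k = (if par i \<and> par j then 1 else -1) * ce_d1 (of_bool p) psi i j k"
      unfolding ce_d1_eq[OF ij] ce_d1_eq[OF ij(2,1)] brm_skew[OF ij] apply1_scale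
      by (cases p; cases "par i"; cases "par j"; simp)
  qed
next
  fix i j k assume nz: "ce_d1 (of_bool p) psi i j k \<noteq> 0"
  then have ij: "i \<in> G3M" "j \<in> G3M" by (auto simp: ce_d1_def split: if_splits)
  note ij31 = ij[THEN G3M_acting(2)]
  have "gbr (bv i) (psi j) k \<noteq> 0 \<or> gbr (bv j) (psi i) k \<noteq> 0 \<or> apply1 psi (gbr (bv i) (bv j)) k \<noteq> 0"
    using nz unfolding ce_d1_eq[OF ij] by auto
  then have "k < 31 \<and> deg k = deg i + deg j + d \<and> par k = ((par i \<noteq> par j) \<noteq> p)"
  proof (elim disjE)
    assume "gbr (bv i) (psi j) k \<noteq> 0"
    then obtain t where "psi j t \<noteq> 0" "k < 31" "deg k = deg i + deg t" "par k = (par i \<noteq> par t)"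
      using gbr_bv_nonzero ij31 by metis
    then show ?thesis using assms unfolding is_cochain1_iff by auto
  next
    assume "gbr (bv j) (psi i) k \<noteq> 0"
    then obtain t where "psi i t \<noteq> 0" "k < 31" "deg k = deg j + deg t" "par k = (par j \<noteq> par t)"
      using gbr_bv_nonzero ij31 by metis
    then show ?thesis using assms unfolding is_cochain1_iff by auto
  next
    assume "apply1 psi (gbr (bv i) (bv j)) k \<noteq> 0"
    then obtain t where "gbr (bv i) (bv j) t * psi t k \<noteq> 0"
      unfolding apply1_def by (meson sum.not_neutral_contains_not_neutral)
    then have "g3sc i j t \<noteq> 0" "psi t k \<noteq> 0" by (auto simp: gbr_bv_bv ij31)
    then show ?thesis using assms g3sc_graded[of i j t] unfolding is_cochain1_iff by auto
  qed
  then show "i \<in> G3M" "j \<in> G3M" "k < 31" "deg k = deg i + deg j + d" "par k = ((par i \<noteq> par j) \<noteq> p)"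
    using ij by auto
qed

lemma cocycle2_iff: "cocycle2 d (of_bool p) phi \<longleftrightarrow> is_cochain2 d (of_bool p) phi \<and>
   (\<forall>q. ev (\<lambda>(i, j, k). phi i j k) (row2 p q) = 0)"
proof -
  have "(\<forall>i\<in>G3M. \<forall>j\<in>G3M. \<forall>l\<in>G3M. ce_d2 (of_bool p) phi i j l = (\<lambda>k. 0)) \<longleftrightarrow>
        (\<forall>q. ev (\<lambda>(i, j, k). phi i j k) (row2 p q) = 0)" if "skew2 phi"
  proof -
    have "ev (\<lambda>(i, j, k). phi i j k) (row2 p (i, j, l, k)) = 0" if "\<not> (i \<in> G3M \<and> j \<in> G3M \<and> l \<in> G3M)" for i j l k
      using that by (auto simp: row2_def G3M_def)
    then have "(\<forall>q. ev (\<lambda>(i, j, k). phi i j k) (row2 p q) = 0) \<longleftrightarrow>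
      (\<forall>i\<in>G3M. \<forall>j\<in>G3M. \<forall>l\<in>G3M. \<forall>k. ev (\<lambda>(i, j, k). phi i j k) (row2 p (i, j, l, k)) = 0)"
      unfolding split_paired_All by blast
    then show ?thesis
      by (simp add: fun_eq_iff ce_d2_row[OF \<open>skew2 phi\<close>])
  qed
  then show ?thesis unfolding cocycle2_def is_cochain2_iff by blast
qed

lemma cocycle1_iff: "cocycle1 d (of_bool p) psi \<longleftrightarrow> is_cochain1 d (of_bool p) psi \<and>
   (\<forall>q. ev (\<lambda>(i, k). psi i k) (row1 p q) = 0)"
proof -
  have "ev (\<lambda>(i, k). psi i k) (row1 p (i, j, k)) = 0" if "\<not> (i \<in> G3M \<and> j \<in> G3M)" for i j k
    using that by (auto simp: row1_def G3M_def)
  then have "(\<forall>q. ev (\<lambda>(i, k). psi i k) (row1 p q) = 0) \<longleftrightarrow>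
    (\<forall>i\<in>G3M. \<forall>j\<in>G3M. \<forall>k. ev (\<lambda>(i, k). psi i k) (row1 p (i, j, k)) = 0)"
    unfolding split_paired_All by blast
  then show ?thesis unfolding cocycle1_def by (simp add: fun_eq_iff ce_d1_row)
qed

lemma cocycle1_ce_d0: "is_gvec d (of_bool p) v \<Longrightarrow> cocycle1 d (of_bool p) (ce_d0 (of_bool p) v)"
  by (simp add: cocycle1_def is_cochain1_ce_d0 ce_d1_ce_d0 fun_eq_iff)

lemma cocycle2_ce_d1: "is_cochain1 d (of_bool p) psi \<Longrightarrow> cocycle2 d (of_bool p) (ce_d1 (of_bool p) psi)"
  by (simp add: cocycle2_def is_cochain2_ce_d1 ce_d2_ce_d1 fun_eq_iff)

lemma cocycle1_diff:
  assumes "cocycle1 d (of_bool p) f" "cocycle1 d (of_bool p) g"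
  shows "cocycle1 d (of_bool p) (\<lambda>i k. f i k - g i k)"
proof -
  have "is_cochain1 d (of_bool p) (\<lambda>i k. f i k - g i k)"
    using assms unfolding cocycle1_iff is_cochain1_iff by (metis diff_0_right)
  moreover have "ev (\<lambda>(i, k). f i k - g i k) r = ev (\<lambda>(i, k). f i k) r - ev (\<lambda>(i, k). g i k) r" for r
    by (induction r) (auto simp: algebra_simps)
  ultimately show ?thesis using assms by (simp add: cocycle1_iff)
qed

lemma cocycle2_lin:
  assumes "cocycle2 d (of_bool p) f" "cocycle2 d (of_bool p) g"
  shows "cocycle2 d (of_bool p) (\<lambda>i j k. a * f i j k + b * g i j k)"
proof -
  have nz: "f i j k \<noteq> 0 \<or> g i j k \<noteq> 0" if "a * f i j k + b * g i j k \<noteq> 0" for i j k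
    using that by auto
  have "skew2 (\<lambda>i j k. a * f i j k + b * g i j k)"
    unfolding skew2_def
  proof (intro ballI allI)
    fix i j k assume ij: "i \<in> G3M" "j \<in> G3M"
    have sk: "f j i k = (if par i \<and> par j then 1 else -1) * f i j k"
      "g j i k = (if par i \<and> par j then 1 else -1) * g i j k"
      using assms ij unfolding cocycle2_iff is_cochain2_iff skew2_def by blast+
    show "a * f j i k + b * g j i k = (if par i \<and> par j then 1 else -1) * (a * f i j k + b * g i j k)"
      unfolding sk by (simp add: algebra_simps)
  qed
  then have "is_cochain2 d (of_bool p) (\<lambda>i j k. a * f i j k + b * g i j k)"
    using assms nz unfolding cocycle2_iff is_cochain2_iff by blast
  moreover have "ev (\<lambda>(i, j, k). a * f i j k + b * g i j k) r
      = a * ev (\<lambda>(i, j, k). f i j k) r + b * ev (\<lambda>(i, j, k). g i j k) r" for r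
    by (induction r) (auto simp: algebra_simps)
  ultimately show ?thesis using assms by (simp add: cocycle2_iff)
qed

lemma cocycle2_diff:
  assumes "cocycle2 d (of_bool p) f" "cocycle2 d (of_bool p) g"
  shows "cocycle2 d (of_bool p) (\<lambda>i j k. f i j k - g i j k)"
  using cocycle2_lin[OF assms, of 1 "-1"] by simp

section \<open>Soundness of the certificates\<close>

lemma covered_sound:
  assumes "\<And>q. ev f (rw q) = 0" "\<forall>x\<in>fst ` set (gauge C) \<union> set T. f x = 0" "cover_ok rw X T C"
  shows "\<forall>x\<in>set X. f x = 0"
proof -
  have "\<forall>x\<in>set (covered rw T C). f x = 0"
  proof
    fix x assume "x \<in> set (covered rw T C)"
    then obtain G ss where G: "(G, ss) \<in> set C" "x \<in> set (propagate rw ss (map fst G @ T))"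
      by (auto simp: covered_def)
    then have "\<forall>x\<in>set (map fst G @ T). f x = 0"
      using assms(2) by (force simp: gauge_def)
    then show "f x = 0"
      using propagate_sound[of f rw "map fst G @ T" ss, OF assms(1)] G(2) by blast
  qed
  then show ?thesis using assms(3) by (auto simp: cover_ok_def Let_def list_all_iff)
qed

lemma gauge_ok_sound:
  assumes "gauge_ok rw Y C"
  obtains v where "\<And>y. v y \<noteq> 0 \<Longrightarrow> y \<in> set Y" "\<And>x. x \<in> fst ` set (gauge C) \<Longrightarrow> ev v (rw x) = f x"
proof -
  obtain v where v: "\<forall>y. v y \<noteq> 0 \<longrightarrow> (\<exists>(x, l)\<in>set (gauge C). y \<in> fst ` set l)"
    "\<forall>(x, l)\<in>set (gauge C). ev v (rw x) = f x"
    using gauge_fix[of rw "gauge C" f] assms unfolding gauge_ok_def by blast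
  have "y \<in> set Y" if "v y \<noteq> 0" for y
    using v(1) that assms unfolding gauge_ok_def list_all_iff by fastforce
  moreover have "ev v (rw x) = f x" if "x \<in> fst ` set (gauge C)" for x
    using v(2) that by auto
  ultimately show ?thesis using that by blast
qed

lemma H1_zero_certificate:
  assumes "gauge_ok (row0 p) (basis d p) C" "cover_ok (row1 p) (coords1 d p) [] C"
  shows "H1_zero d (of_bool p)"
  unfolding H1_zero_def
proof (intro allI impI)
  fix psi assume psi: "cocycle1 d (of_bool p) psi"
  \<comment> \<open>The prescribed values carry the factor 24 because \<open>row0\<close> is 24
    times the coordinate of \<open>ce_d0\<close>.\<close>
  obtain v where v: "\<And>y. v y \<noteq> 0 \<Longrightarrow> y \<in> set (basis d p)"
    "\<And>x. x \<in> fst ` set (gauge C) \<Longrightarrow> ev v (row0 p x) = 24 * (case x of (i, k) \<Rightarrow> psi i k)"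
    using gauge_ok_sound[where f = "\<lambda>x. 24 * (case x of (i, k) \<Rightarrow> psi i k)", OF assms(1)] by blast
  let ?f = "\<lambda>i k. psi i k - ce_d0 (of_bool p) v i k"
  have gv: "is_gvec d (of_bool p) v" using v(1) by (auto simp: is_gvec_iff basis_iff)
  then have "cocycle1 d (of_bool p) ?f" using psi cocycle1_diff cocycle1_ce_d0 by blast
  then have f: "is_cochain1 d (of_bool p) ?f" "\<And>q. ev (\<lambda>(i, k). ?f i k) (row1 p q) = 0"
    by (auto simp: cocycle1_iff)
  have "\<forall>x\<in>fst ` set (gauge C) \<union> set []. (\<lambda>(i, k). ?f i k) x = 0"
  proof
    fix x assume "x \<in> fst ` set (gauge C) \<union> set []"
    then show "(\<lambda>(i, k). ?f i k) x = 0" using v(2)[of x] by (cases x) (simp add: ce_d0_row)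
  qed
  from covered_sound[where rw = "row1 p", OF f(2) this assms(2)] have "?f i k = 0" for i k
    using f(1) unfolding is_cochain1_iff coords1_iff[symmetric] by fast
  then show "coboundary1 d (of_bool p) psi"
    unfolding coboundary1_def using gv by (intro exI[of _ v]) auto
qed

text \<open>Separated from the vanishing argument because in even degree 2 the normalised cocycle
  need not vanish; there it is compared with a canonical one.\<close>

lemma normal_form2:
  assumes "gauge_ok (row1 p) (coords1 d p) C" "cocycle2 d (of_bool p) phi"
  obtains psi where "is_cochain1 d (of_bool p) psi"
    "\<And>i j k. (i, j, k) \<in> fst ` set (gauge C) \<Longrightarrow> phi i j k - ce_d1 (of_bool p) psi i j k = 0"
    "cocycle2 d (of_bool p) (\<lambda>i j k. phi i j k - ce_d1 (of_bool p) psi i j k)"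
proof -
  obtain v where v: "\<And>y. v y \<noteq> 0 \<Longrightarrow> y \<in> set (coords1 d p)"
    "\<And>x. x \<in> fst ` set (gauge C) \<Longrightarrow> ev v (row1 p x) = 24 * (case x of (i, j, k) \<Rightarrow> phi i j k)"
    using gauge_ok_sound[where f = "\<lambda>x. 24 * (case x of (i, j, k) \<Rightarrow> phi i j k)", OF assms(1)] by blast
  define psi where "psi = (\<lambda>i k. v (i, k))"
  have "is_cochain1 d (of_bool p) psi"
    using v(1) by (auto simp: is_cochain1_iff coords1_iff psi_def)
  moreover have "phi i j k - ce_d1 (of_bool p) psi i j k = 0" if "(i, j, k) \<in> fst ` set (gauge C)" for i j k
    using v(2)[OF that] by (simp add: ce_d1_row psi_def)
  ultimately show ?thesis using that cocycle2_diff assms(2) cocycle2_ce_d1 by blast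
qed

text \<open>Serves the vanishing theorems with \<open>T\<close> empty, and even degree 2 with
  \<open>T\<close> the three coordinates that carry the cohomology.\<close>

lemma cocycle2_vanishes:
  assumes "cover_ok (row2 p) (coords2 d p) T C" "cocycle2 d (of_bool p) phi"
    "\<And>i j k. (i, j, k) \<in> fst ` set (gauge C) \<union> set T \<Longrightarrow> phi i j k = 0"
  shows "phi i j k = 0"
proof -
  have phi: "is_cochain2 d (of_bool p) phi" "\<And>q. ev (\<lambda>(i, j, k). phi i j k) (row2 p q) = 0"
    using assms(2) by (auto simp: cocycle2_iff)
  have zero: "\<forall>x\<in>set (coords2 d p). (\<lambda>(i, j, k). phi i j k) x = 0"
    by (rule covered_sound[where rw = "row2 p", OF phi(2) _ assms(1)]) (use assms(3) in auto)
  have *: "phi i j k = 0" if "i < j \<or> i = j \<and> par i" for i j k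
  proof (rule ccontr)
    assume nz: "phi i j k \<noteq> 0"
    then have "i \<in> G3M" "j \<in> G3M" "k < 31" "deg k = deg i + deg j + d" "par k = ((par i \<noteq> par j) \<noteq> p)"
      using phi(1) unfolding is_cochain2_iff by blast+
    then have "(i, j, k) \<in> set (coords2 d p)" using coords2_I that by blast
    then show False using zero nz by auto
  qed
  have sk: "phi j i k = (if par i \<and> par j then 1 else -1) * phi i j k" if "i \<in> G3M" "j \<in> G3M" for i j k
    using phi(1) that unfolding is_cochain2_iff skew2_def by blast
  show ?thesis
  proof (rule ccontr)
    assume nz: "phi i j k \<noteq> 0"
    then have ij: "i \<in> G3M" "j \<in> G3M" using phi(1) unfolding is_cochain2_iff by blast+
    \<comment> \<open>The remaining cases come from skew-symmetry: it exchanges the arguments, and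
      it kills the diagonal at an even basis vector.\<close>
    from * nz have "j < i \<or> i = j \<and> \<not> par i" by (metis linorder_neqE_nat)
    then show False
    proof
      assume "j < i"
      then show False using *[of j i k] sk[OF ij(2,1), of k] nz by simp
    next
      assume "i = j \<and> \<not> par i"
      then show False using skew2_diag phi(1) ij nz unfolding is_cochain2_iff by blast
    qed
  qed
qed

lemma H2_zero_certificate:
  assumes "gauge_ok (row1 p) (coords1 d p) C" "cover_ok (row2 p) (coords2 d p) [] C"
  shows "H2_zero d (of_bool p)"
  unfolding H2_zero_def
proof (intro allI impI)
  fix phi assume "cocycle2 d (of_bool p) phi"
  then obtain psi where psi: "is_cochain1 d (of_bool p) psi"
    "\<And>i j k. (i, j, k) \<in> fst ` set (gauge C) \<Longrightarrow> phi i j k - ce_d1 (of_bool p) psi i j k = 0"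
    "cocycle2 d (of_bool p) (\<lambda>i j k. phi i j k - ce_d1 (of_bool p) psi i j k)"
    using normal_form2[OF assms(1)] by blast
  have "phi i j k - ce_d1 (of_bool p) psi i j k = 0" for i j k
    by (rule cocycle2_vanishes[OF assms(2) psi(3)]) (use psi(2) in auto)
  then show "coboundary2 d (of_bool p) phi"
    unfolding coboundary2_def using psi(1) by (intro exI[of _ psi]) (auto simp: fun_eq_iff)
qed

lemma deg_bounds: "-3 \<le> deg i" "deg i \<le> 3"
  by (auto simp: deg_def)

text \<open>A linear map from degrees at least -3 to degrees at most 3 raises the degree by at most
  6, so the cochain itself is zero.\<close>

lemma H1_zero_large: "d > 6 \<Longrightarrow> H1_zero d (of_bool p)"
  unfolding H1_zero_def cocycle1_def is_cochain1_iff
proof (intro allI impI)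
  fix psi assume d: "d > 6" and "(\<forall>i k. psi i k \<noteq> 0 \<longrightarrow> i \<in> G3M \<and> k < 31 \<and> deg k = deg i + d \<and> par k = (par i \<noteq> p))
    \<and> (\<forall>i\<in>G3M. \<forall>j\<in>G3M. ce_d1 (of_bool p) psi i j = (\<lambda>k. 0))"
  then have "psi i k = 0" for i k using d deg_bounds(1)[of i] deg_bounds(2)[of k] by force
  then have "psi = (\<lambda>i k. 0)" by (intro ext)
  then show "coboundary1 d (of_bool p) psi"
    unfolding coboundary1_def
    by (intro exI[of _ "\<lambda>_. 0"]) (auto simp: is_gvec_def ce_d0_def gbr_def)
qed

lemma H2_zero_large: "d > 9 \<Longrightarrow> H2_zero d (of_bool p)"
  unfolding H2_zero_def cocycle2_def is_cochain2_iff
proof (intro allI impI)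
  fix phi assume d: "d > 9" and "(skew2 phi \<and> (\<forall>i j k. phi i j k \<noteq> 0 \<longrightarrow> i \<in> G3M \<and> j \<in> G3M \<and> k < 31
      \<and> deg k = deg i + deg j + d \<and> par k = ((par i \<noteq> par j) \<noteq> p)))
    \<and> (\<forall>i\<in>G3M. \<forall>j\<in>G3M. \<forall>l\<in>G3M. ce_d2 (of_bool p) phi i j l = (\<lambda>k. 0))"
  then have "phi i j k = 0" for i j k
    using d deg_bounds(1)[of i] deg_bounds(1)[of j] deg_bounds(2)[of k] by force
  then have "phi = (\<lambda>i j k. 0)" by (intro ext)
  then show "coboundary2 d (of_bool p) phi"
    unfolding coboundary2_def
    by (intro exI[of _ "\<lambda>_ _. 0"]) (auto simp: is_cochain1_def ce_d1_def gbr_def apply1_def)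
qed

section \<open>Certificates\<close>

definition cert1_0e :: "(nat \<times> nat, nat, nat \<times> nat \<times> nat) certificate" where
  "cert1_0e =
   [([((2,2), [(11,1)]), ((1,1), [(12,1)]), ((7,7), [(15,1)])],
     [eqn1 2 6 1, eqn1 5 6 2, eqn1 2 5 0, eqn1 4 7 0, eqn1 4 9 1, eqn1 5 9 3, eqn1 5 10 4, eqn1 6
     8 4]),
    ([((8,10), [(14,1)])],
     [eqn1 3 8 1, eqn1 4 7 1, eqn1 5 7 3]),
    ([((10,8), [(13,1)])],
     [eqn1 3 10 0, eqn1 4 9 0, eqn1 6 9 3]),
    ([((7,8), [(17,1)])],
     [eqn1 3 7 0, eqn1 3 9 1]),
    ([((8,7), [(16,1)])],
     [eqn1 4 8 0, eqn1 4 10 1]),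
    ([],
     [eqn1 3 7 1]),
    ([],
     [eqn1 4 8 1]),
    ([],
     [eqn1 3 9 0]),
    ([],
     [eqn1 4 10 0])]"

text \<open>Vanishing in degree d says that every derivation of m into g of that degree is induced
  by g_d. In this and the following certificates for H^1 the gauge pairs use every basis vector of
  g_d of the given parity, which reflects that no nonzero element of g_d is annihilated by
  m.\<close>

lemma H1_0e: "H1_zero 0 (of_bool False)"
  by (rule H1_zero_certificate[of _ _ cert1_0e]) code_simp+

definition cert1_1e :: "(nat \<times> nat, nat, nat \<times> nat \<times> nat) certificate" where
  "cert1_1e =
   [([((5,11), [(20,1)])],
     [eqn1 1 5 1, eqn1 0 5 0, eqn1 2 5 2, eqn1 5 6 6, eqn1 2 7 3, eqn1 2 8 4, eqn1 3 8 2, eqn1 4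
     7 2, eqn1 5 7 7]),
    ([((6,12), [(21,1)])],
     [eqn1 0 6 0, eqn1 1 6 1, eqn1 2 6 2, eqn1 5 6 5, eqn1 2 9 3, eqn1 2 10 4, eqn1 3 10 2, eqn1
     4 9 2, eqn1 6 7 7]),
    ([],
     [eqn1 2 9 4, eqn1 3 3 0, eqn1 3 6 4]),
    ([],
     [eqn1 2 7 4, eqn1 3 3 1, eqn1 3 5 4]),
    ([],
     [eqn1 2 10 3, eqn1 4 4 0, eqn1 4 6 3]),
    ([],
     [eqn1 2 8 3, eqn1 4 4 1, eqn1 4 5 3]),
    ([],
     [eqn1 0 5 1]),
    ([],
     [eqn1 1 6 0])]"

lemma H1_1e: "H1_zero 1 (of_bool False)"
  by (rule H1_zero_certificate[of _ _ cert1_1e]) code_simp+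

definition cert1_2e :: "(nat \<times> nat, nat, nat \<times> nat \<times> nat) certificate" where
  "cert1_2e =
   [([((6,20), [(26,1)])],
     [eqn1 5 6 15, eqn1 0 6 2, eqn1 0 9 3, eqn1 0 10 4, eqn1 3 6 9, eqn1 4 6 10, eqn1 7 9 16,
     eqn1 8 10 17, eqn1 2 3 3, eqn1 3 10 6, eqn1 5 6 11, eqn1 5 6 12]),
    ([],
     [eqn1 3 5 9, eqn1 7 7 16, eqn1 8 8 17, eqn1 0 5 2, eqn1 2 7 9]),
    ([],
     [eqn1 3 6 7, eqn1 9 9 16, eqn1 10 10 17, eqn1 1 6 2, eqn1 2 9 7]),
    ([],
     [eqn1 0 10 3, eqn1 1 8 3, eqn1 4 4 2, eqn1 5 6 16]),
    ([],
     [eqn1 0 9 4, eqn1 1 7 4, eqn1 3 3 2, eqn1 5 6 17]),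
    ([],
     [eqn1 0 7 4]),
    ([],
     [eqn1 0 8 3]),
    ([],
     [eqn1 1 9 4]),
    ([],
     [eqn1 1 10 3])]"

lemma H1_2e: "H1_zero 2 (of_bool False)"
  by (rule H1_zero_certificate[of _ _ cert1_2e]) code_simp+

definition cert1_3e :: "(nat \<times> nat, nat, nat \<times> nat \<times> nat) certificate" where
  "cert1_3e =
   [([((5,26), [(29,1)])],
     [eqn1 2 5 15, eqn1 1 5 6, eqn1 1 7 9, eqn1 1 8 10, eqn1 2 6 14, eqn1 3 5 18, eqn1 3 8 12,
     eqn1 4 5 19, eqn1 0 1 1]),
    ([((6,26), [(30,1)])],
     [eqn1 2 6 15, eqn1 0 6 5, eqn1 0 9 7, eqn1 0 10 8, eqn1 2 5 13, eqn1 2 6 12, eqn1 3 6 18,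
     eqn1 4 6 19, eqn1 0 1 0]),
    ([],
     [eqn1 0 5 6]),
    ([],
     [eqn1 0 10 9, eqn1 1 8 9, eqn1 2 4 9]),
    ([],
     [eqn1 0 9 10, eqn1 1 7 10, eqn1 2 3 10]),
    ([],
     [eqn1 1 6 5]),
    ([],
     [eqn1 0 10 7, eqn1 1 8 7, eqn1 2 4 7]),
    ([],
     [eqn1 0 9 8, eqn1 1 7 8, eqn1 2 3 8])]"

lemma H1_3e: "H1_zero 3 (of_bool False)"
  by (rule H1_zero_certificate[of _ _ cert1_3e]) code_simp+

text \<open>From degree 4 on g_d is zero, so there is nothing to subtract and the equations alone
  force the cocycle to vanish.\<close>

definition cert1_4e :: "(nat \<times> nat, nat, nat \<times> nat \<times> nat) certificate" where
  "cert1_4e =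
   [([],
     [eqn1 0 2 6, eqn1 1 5 14]),
    ([],
     [eqn1 0 9 18, eqn1 1 7 18, eqn1 2 7 24, eqn1 3 3 16, eqn1 4 4 17, eqn1 0 5 13, eqn1 0 6 11]),
    ([],
     [eqn1 0 6 13, eqn1 1 2 5]),
    ([],
     [eqn1 0 3 8]),
    ([],
     [eqn1 0 4 7])]"

lemma H1_4e: "H1_zero 4 (of_bool False)"
  by (rule H1_zero_certificate[of _ _ cert1_4e]) code_simp+

definition cert1_5e :: "(nat \<times> nat, nat, nat \<times> nat \<times> nat) certificate" where
  "cert1_5e =
   [([],
     [eqn1 0 1 6, eqn1 0 2 12]),
    ([],
     [eqn1 0 1 5, eqn1 0 2 13])]"

lemma H1_5e: "H1_zero 5 (of_bool False)"
  by (rule H1_zero_certificate[of _ _ cert1_5e]) code_simp+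

definition cert1_6e :: "(nat \<times> nat, nat, nat \<times> nat \<times> nat) certificate" where
  "cert1_6e =
   [([],
     [eqn1 0 1 14]),
    ([],
     [eqn1 0 2 21, eqn1 1 2 20]),
    ([],
     [eqn1 0 1 13])]"

lemma H1_6e: "H1_zero 6 (of_bool False)"
  by (rule H1_zero_certificate[of _ _ cert1_6e]) code_simp+

section \<open>Certificates for H^1, odd cochains of degree 0 to 6\<close>

definition cert1_0o :: "(nat \<times> nat, nat, nat \<times> nat \<times> nat) certificate" where
  "cert1_0o =
   [([((6,9), [(18,1)])],
     [eqn1 4 6 1, eqn1 6 8 2, eqn1 2 8 0, eqn1 2 10 1, eqn1 4 5 0]),
    ([((6,10), [(19,1)])],
     [eqn1 3 6 1, eqn1 6 7 2, eqn1 2 7 0, eqn1 2 9 1, eqn1 3 5 0]),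
    ([],
     [eqn1 2 8 1, eqn1 4 5 1]),
    ([],
     [eqn1 2 7 1, eqn1 3 5 1]),
    ([],
     [eqn1 2 10 0, eqn1 4 6 0]),
    ([],
     [eqn1 2 9 0, eqn1 3 6 0])]"

lemma H1_0o: "H1_zero 0 (of_bool True)"
  by (rule H1_zero_certificate[of _ _ cert1_0o]) code_simp+

definition cert1_1o :: "(nat \<times> nat, nat, nat \<times> nat \<times> nat) certificate" where
  "cert1_1o =
   [([((8,12), [(23,1)])],
     [eqn1 1 8 1, eqn1 2 8 2, eqn1 5 6 9, eqn1 0 8 0, eqn1 3 8 3, eqn1 4 8 4, eqn1 5 10 6, eqn1 7
     10 9]),
    ([((3,6), [(22,1)])],
     [eqn1 2 3 1, eqn1 2 7 2, eqn1 3 5 2, eqn1 2 5 4, eqn1 3 7 3, eqn1 3 8 4, eqn1 5 7 5, eqn1 5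
     9 6]),
    ([((10,11), [(24,1)])],
     [eqn1 0 10 0, eqn1 2 10 2, eqn1 5 6 7, eqn1 1 10 1, eqn1 3 10 3, eqn1 4 10 4, eqn1 6 8 5,
     eqn1 8 9 7]),
    ([((9,12), [(25,1)])],
     [eqn1 0 9 0, eqn1 2 9 2, eqn1 5 6 8, eqn1 1 9 1, eqn1 4 9 4, eqn1 5 9 5, eqn1 6 7 5, eqn1 7
     10 8]),
    ([],
     [eqn1 0 7 1]),
    ([],
     [eqn1 3 7 4]),
    ([],
     [eqn1 0 8 1]),
    ([],
     [eqn1 4 8 3]),
    ([],
     [eqn1 1 9 0]),
    ([],
     [eqn1 3 9 4]),
    ([],
     [eqn1 1 10 0]),
    ([],
     [eqn1 4 10 3])]"

lemma H1_1o: "H1_zero 1 (of_bool True)"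
  by (rule H1_zero_certificate[of _ _ cert1_1o]) code_simp+

definition cert1_2o :: "(nat \<times> nat, nat, nat \<times> nat \<times> nat) certificate" where
  "cert1_2o =
   [([((5,24), [(28,1)])],
     [eqn1 1 5 3, eqn1 1 8 2, eqn1 2 8 5, eqn1 2 10 6, eqn1 5 9 16, eqn1 5 10 15, eqn1 6 7 16,
     eqn1 2 5 7, eqn1 3 4 3, eqn1 4 5 5]),
    ([((5,25), [(27,1)])],
     [eqn1 1 5 4, eqn1 1 7 2, eqn1 2 7 5, eqn1 2 9 6, eqn1 5 9 15, eqn1 5 10 17, eqn1 6 7 15,
     eqn1 2 5 8, eqn1 3 4 4, eqn1 3 5 5]),
    ([],
     [eqn1 2 8 6, eqn1 5 7 16, eqn1 0 5 3, eqn1 4 5 6]),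
    ([],
     [eqn1 2 7 6, eqn1 5 7 15, eqn1 0 5 4, eqn1 3 5 6]),
    ([],
     [eqn1 2 10 5, eqn1 6 9 16, eqn1 1 6 3, eqn1 4 6 5]),
    ([],
     [eqn1 2 9 5, eqn1 6 9 15, eqn1 1 6 4, eqn1 3 6 5]),
    ([],
     [eqn1 3 3 4]),
    ([],
     [eqn1 4 4 3])]"

lemma H1_2o: "H1_zero 2 (of_bool True)"
  by (rule H1_zero_certificate[of _ _ cert1_2o]) code_simp+

definition cert1_3o :: "(nat \<times> nat, nat, nat \<times> nat \<times> nat) certificate" where
  "cert1_3o =
   [([],
     [eqn1 0 6 9, eqn1 1 5 9, eqn1 1 8 6, eqn1 2 7 16, eqn1 3 4 9]),
    ([],
     [eqn1 0 6 10, eqn1 1 5 10, eqn1 1 7 6, eqn1 2 7 12, eqn1 3 3 9]),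
    ([],
     [eqn1 0 6 7, eqn1 0 10 5, eqn1 1 5 7, eqn1 2 8 13, eqn1 3 4 7]),
    ([],
     [eqn1 0 6 8, eqn1 0 9 5, eqn1 1 5 8, eqn1 2 7 13, eqn1 3 3 7])]"

lemma H1_3o: "H1_zero 3 (of_bool True)"
  by (rule H1_zero_certificate[of _ _ cert1_3o]) code_simp+

definition cert1_4o :: "(nat \<times> nat, nat, nat \<times> nat \<times> nat) certificate" where
  "cert1_4o =
   [([],
     [eqn1 0 2 10, eqn1 1 7 14]),
    ([],
     [eqn1 0 2 9, eqn1 1 8 14]),
    ([],
     [eqn1 0 6 18, eqn1 1 5 18, eqn1 2 3 16, eqn1 3 4 18, eqn1 0 8 13, eqn1 0 10 11]),
    ([],
     [eqn1 0 6 19, eqn1 1 5 19, eqn1 2 3 15, eqn1 3 3 18, eqn1 0 7 13, eqn1 0 9 11]),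
    ([],
     [eqn1 0 10 13, eqn1 1 2 7]),
    ([],
     [eqn1 0 9 13, eqn1 1 2 8])]"

lemma H1_4o: "H1_zero 4 (of_bool True)"
  by (rule H1_zero_certificate[of _ _ cert1_4o]) code_simp+

definition cert1_5o :: "(nat \<times> nat, nat, nat \<times> nat \<times> nat) certificate" where
  "cert1_5o =
   [([],
     [eqn1 0 1 10, eqn1 0 3 12]),
    ([],
     [eqn1 0 1 9, eqn1 0 4 12]),
    ([],
     [eqn1 0 1 8, eqn1 0 3 13]),
    ([],
     [eqn1 0 1 7, eqn1 0 4 13])]"

lemma H1_5o: "H1_zero 5 (of_bool True)"
  by (rule H1_zero_certificate[of _ _ cert1_5o]) code_simp+

text \<open>In degree 6 only maps from g_-3 to g_3 are possible. Both spaces are purely even, so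
  there are no odd coordinates and the empty certificate suffices.\<close>

lemma H1_6o: "H1_zero 6 (of_bool True)"
  by (rule H1_zero_certificate[of _ _ "[]"]) code_simp+

section \<open>Certificates for H^2, even cochains of degree 1 and 3 to 9\<close>

definition cert2_1e :: "(nat \<times> nat \<times> nat, nat \<times> nat, nat \<times> nat \<times> nat \<times> nat) certificate" where
  "cert2_1e =
   [([unit_gauge 1 5 1 5 11, unit_gauge 4 5 4 4 10, unit_gauge 2 7 3 7 18, unit_gauge 3 5 3 3 9, unit_gauge 6 8 10 8 19, ((4,7,2), [((7,18),1), ((2,6),-2)]), ((5,9,9), [((5,15),2), ((3,9),-4), ((5,12),3), ((5,11),-1)]), ((0,5,0), [((7,18),1), ((2,6),-2), ((0,2),-1)]), ((0,6,1), [((8,19),1), ((6,14),1)])],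
     [eqn 2 7 10 1, eqn 4 5 9 1, eqn 3 5 10 1, eqn 4 5 7 0, eqn 5 7 10 2, eqn 2 5 6 1, eqn 3 6 8
     1, eqn 4 6 7 1, eqn 6 7 8 2, eqn 2 7 8 0, eqn 7 8 9 3, eqn 3 5 8 0]),
    ([unit_gauge 5 8 10 5 14],
     [eqn 2 7 8 1, eqn 3 5 8 1, eqn 4 5 7 1]),
    ([unit_gauge 0 6 0 6 11, unit_gauge 1 6 1 1 2, unit_gauge 8 9 5 9 18, unit_gauge 5 6 5 5 13, unit_gauge 6 10 10 6 15, unit_gauge 4 9 2 4 8, ((1,5,0), [((10,19),4), ((6,12),-3), ((6,11),-1), ((1,2),-6), ((4,8),6), ((5,13),-2)]), ((4,6,4), [((10,19),1), ((6,15),-1)]), unit_gauge 3 4 0 3 7],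
     [eqn 2 8 9 0, eqn 2 5 6 0, eqn 4 6 9 1, eqn 6 8 9 2, eqn 3 6 8 0, eqn 3 6 10 1, eqn 4 5 9 0,
     eqn 4 6 7 0, eqn 6 7 10 2, eqn 2 7 10 0, eqn 2 9 10 1, eqn 3 5 10 0]),
    ([unit_gauge 6 10 8 6 13],
     [eqn 2 9 10 0, eqn 3 6 10 0, eqn 4 6 9 0]),
    ([unit_gauge 7 7 5 7 19, unit_gauge 6 7 10 3 10, unit_gauge 5 9 10 5 17],
     [eqn 2 7 7 0, eqn 2 7 9 1, eqn 6 7 7 2, eqn 3 6 7 1, eqn 3 5 9 1, eqn 5 6 7 4]),
    ([unit_gauge 8 8 5 8 18, unit_gauge 6 8 9 4 9, unit_gauge 5 10 9 5 16],
     [eqn 2 8 8 0, eqn 2 8 10 1, eqn 6 8 8 2, eqn 4 6 8 1, eqn 4 5 10 1, eqn 5 6 8 3]),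
    ([unit_gauge 7 9 5 9 19, unit_gauge 3 9 2 3 8, unit_gauge 6 9 10 6 17],
     [eqn 2 7 9 0, eqn 2 9 9 1, eqn 5 9 9 2, eqn 3 5 9 0, eqn 3 6 9 1, eqn 6 7 9 2]),
    ([unit_gauge 8 10 5 10 18, unit_gauge 4 10 2 4 7, unit_gauge 6 10 9 6 16],
     [eqn 2 8 10 0, eqn 2 10 10 1, eqn 5 10 10 2, eqn 4 5 10 0, eqn 4 6 10 1, eqn 6 8 10 2]),
    ([],
     [eqn 2 7 7 1, eqn 3 5 7 1]),
    ([],
     [eqn 2 8 8 1, eqn 4 5 8 1]),
    ([],
     [eqn 2 9 9 0, eqn 3 6 9 0]),
    ([],
     [eqn 2 10 10 0, eqn 4 6 10 0])]"

text \<open>Most gauge cochains are elementary, sending one basis vector to another. The others are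
  combinations chosen to be annihilated by the rows of the earlier gauge coordinates, as
  triangularity demands.\<close>

lemma H2_1e: "H2_zero 1 (of_bool False)"
  by (rule H2_zero_certificate[of _ _ cert2_1e]) code_simp+

definition cert2_3e :: "(nat \<times> nat \<times> nat, nat \<times> nat, nat \<times> nat \<times> nat \<times> nat) certificate" where
  "cert2_3e =
   [([unit_gauge 4 10 17 10 27, unit_gauge 6 10 22 6 26, unit_gauge 7 10 21 2 21, unit_gauge 6 9 23 9 28, unit_gauge 0 10 8 0 13, unit_gauge 6 7 24 3 24, unit_gauge 4 9 12 1 12, unit_gauge 0 1 0 1 11, unit_gauge 3 10 15 1 15],
     [eqn 5 10 10 17, eqn 6 8 10 17, eqn 2 7 10 5, eqn 6 9 10 14, eqn 7 9 10 18, eqn 8 9 10 19,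
     eqn 0 6 10 4, eqn 0 9 10 2, eqn 6 7 9 16, eqn 5 9 9 16, eqn 5 9 10 12, eqn 6 7 10 12, eqn 0
     2 6 0, eqn 0 3 10 0, eqn 0 4 9 0, eqn 3 3 10 3, eqn 1 3 10 1, eqn 5 9 10 15, eqn 6 7 10 15,
     eqn 3 4 9 3, eqn 3 4 10 4, eqn 3 5 10 5, eqn 2 6 9 9, [(1,1,5,6,2), (1,1,2,6,1),
     (2,2,5,6,5), (-2,1,2,5,0)], eqn 5 6 9 18, eqn 5 6 10 19, eqn 2 5 6 5, eqn 3 5 6 7, eqn 4 5 6
     8, eqn 1 2 5 0, eqn 1 2 6 1, eqn 1 6 7 3, eqn 1 6 8 4, eqn 5 7 10 13, eqn 5 8 9 13]),
    ([unit_gauge 7 10 20 7 28, unit_gauge 2 8 19 8 27, unit_gauge 4 8 17 4 22, unit_gauge 5 8 25 5 26, unit_gauge 1 5 6 1 14, unit_gauge 5 9 23 3 23, unit_gauge 4 7 12 0 12, unit_gauge 0 1 1 0 11, unit_gauge 0 8 8 0 15],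
     [eqn 2 7 10 6, eqn 2 8 9 6, eqn 2 7 8 5, eqn 6 8 8 17, eqn 5 7 8 13, eqn 5 8 10 17, eqn 1 5
     7 3, eqn 1 5 8 4, eqn 5 7 9 16, eqn 6 7 7 16, eqn 5 7 10 12, eqn 5 8 9 12, eqn 1 2 5 1, eqn
     1 3 8 1, eqn 1 4 7 1, eqn 0 3 8 0, eqn 3 8 8 8, eqn 5 8 9 15, eqn 6 7 8 15, eqn 3 4 7 3, eqn
     3 4 8 4, eqn 3 6 8 6, eqn 2 5 7 7, [(1,0,5,6,2), (1,0,2,5,0), (-2,2,5,6,6), (-2,0,2,6,1)],
     eqn 5 6 7 18, eqn 5 6 8 19, eqn 2 5 6 6, eqn 3 5 6 9, eqn 4 5 6 10, eqn 0 2 6 1, eqn 0 5 6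
     2, eqn 0 5 9 3, eqn 0 5 10 4, eqn 6 7 10 14, eqn 6 8 9 14]),
    ([unit_gauge 7 7 21 7 27, unit_gauge 3 3 6 3 22, unit_gauge 0 9 10 0 17],
     [eqn 1 7 7 2, eqn 2 7 7 5, eqn 2 7 9 6, eqn 5 7 7 13, eqn 2 3 3 1, eqn 3 3 5 2, eqn 2 3 7 2,
     eqn 3 3 7 3, eqn 5 7 9 15, eqn 6 7 7 11, eqn 6 7 7 12, eqn 6 7 9 14, eqn 0 3 9 1, eqn 0 6 7
     4, eqn 3 3 8 4, eqn 4 7 7 8, eqn 5 7 10 17]),
    ([unit_gauge 8 8 21 8 28, unit_gauge 4 8 15 4 23, unit_gauge 0 10 9 0 16],
     [eqn 1 8 8 2, eqn 2 8 8 5, eqn 2 8 10 6, eqn 5 8 8 13, eqn 6 8 8 15, eqn 5 8 10 15, eqn 6 8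
     8 11, eqn 6 8 8 12, eqn 6 8 10 14, eqn 2 6 8 9, eqn 4 5 8 5, eqn 4 5 10 6, eqn 0 4 10 1, eqn
     0 6 8 3, eqn 3 8 8 7, eqn 4 4 7 3, eqn 5 7 10 16]),
    ([unit_gauge 2 5 14 0 14],
     [eqn 2 7 8 6, eqn 5 7 7 16, eqn 5 8 8 17, eqn 0 2 5 1, eqn 0 5 7 3, eqn 0 5 8 4, eqn 3 5 8
     6, eqn 4 5 7 6]),
    ([],
     [eqn 2 7 7 6, eqn 5 7 7 15, eqn 0 5 7 4, eqn 3 5 7 6]),
    ([],
     [eqn 2 8 8 6, eqn 5 7 8 16, eqn 0 5 8 3, eqn 4 5 8 6]),
    ([unit_gauge 7 9 21 9 27, unit_gauge 3 9 15 3 25, unit_gauge 1 9 10 1 17],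
     [eqn 2 7 9 5, eqn 2 9 9 6, eqn 6 9 9 14, eqn 0 6 9 4, eqn 5 9 9 15, eqn 5 7 9 13, eqn 5 9 9
     11, eqn 5 9 9 12, eqn 6 7 9 15, eqn 2 5 9 8, eqn 3 5 9 5, eqn 3 6 7 5, eqn 1 5 9 4, eqn 1 6
     7 4, eqn 3 3 10 4, eqn 4 9 9 10, eqn 6 7 10 17]),
    ([unit_gauge 8 10 21 10 28, unit_gauge 4 10 12 4 24, unit_gauge 1 10 9 1 16],
     [eqn 2 8 10 5, eqn 2 10 10 6, eqn 6 10 10 14, eqn 0 6 10 3, eqn 0 4 10 0, eqn 2 4 10 2, eqn
     5 10 10 11, eqn 4 5 10 5, eqn 4 6 10 6, eqn 4 10 10 10, eqn 6 8 10 11, eqn 4 8 10 8, eqn 1 5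
     10 3, eqn 1 6 8 3, eqn 3 10 10 9, eqn 4 4 9 3, eqn 6 7 10 16]),
    ([unit_gauge 2 6 13 1 13],
     [eqn 2 9 10 5, eqn 6 9 9 16, eqn 6 10 10 17, eqn 1 2 6 0, eqn 1 6 9 3, eqn 1 6 10 4, eqn 3 6
     10 5, eqn 4 6 9 5]),
    ([],
     [eqn 2 9 9 5, eqn 6 9 9 15, eqn 1 6 9 4, eqn 3 6 9 5]),
    ([],
     [eqn 2 10 10 5, eqn 6 9 10 16, eqn 1 6 10 3, eqn 4 6 10 5]),
    ([],
     [eqn 3 3 7 4]),
    ([],
     [eqn 3 3 9 4]),
    ([],
     [eqn 4 4 8 3]),
    ([],
     [eqn 4 4 10 3])]"

text \<open>The two bracketed four-term entries among the steps are genuine integer combinations of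
  cocycle equations, arranged so that only one unknown is left.\<close>

lemma H2_3e: "H2_zero 3 (of_bool False)"
  by (rule H2_zero_certificate[of _ _ cert2_3e]) code_simp+

definition cert2_4e :: "(nat \<times> nat \<times> nat, nat \<times> nat, nat \<times> nat \<times> nat \<times> nat) certificate" where
  "cert2_4e =
   [([unit_gauge 7 10 26 2 26, unit_gauge 1 2 6 1 20, unit_gauge 0 9 18 0 21, unit_gauge 2 3 18 3 28, unit_gauge 4 7 21 4 27, unit_gauge 1 6 14 6 29, unit_gauge 0 5 13 5 30],
     [eqn 7 7 10 24, eqn 7 8 9 24, eqn 7 8 10 25, eqn 7 9 10 23, eqn 7 10 10 22, eqn 1 2 7 3, eqn
     1 2 8 4, eqn 0 9 10 6, eqn 0 2 9 3, eqn 2 3 8 5, eqn 2 3 10 6, eqn 2 4 7 5, eqn 2 4 9 6, eqn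
     2 3 4 2, eqn 3 6 10 14, eqn 4 6 9 14, eqn 3 4 6 6, eqn 3 6 8 12, eqn 3 5 8 13, eqn 4 5 7 13,
     eqn 3 5 6 18, eqn 3 5 10 12, eqn 5 6 7 24, eqn 5 6 8 25, eqn 5 6 9 23, eqn 5 6 10 22, eqn 5
     7 10 21, eqn 6 7 10 20, eqn 0 5 6 5, eqn 1 5 6 6, eqn 3 5 9 16, eqn 4 5 10 17, eqn 0 1 5 0,
     eqn 0 3 10 2, eqn 0 4 9 2, eqn 0 6 9 9, eqn 1 3 8 2, eqn 1 4 7 2, eqn 1 5 7 7, eqn 3 5 10
     15]),
    ([unit_gauge 0 8 19 0 20, unit_gauge 5 7 28 5 29],
     [eqn 1 7 8 6, eqn 2 7 7 16, eqn 2 8 8 17, eqn 0 8 9 6, eqn 3 8 8 19, eqn 0 2 7 3, eqn 0 3 8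
     2, eqn 0 6 7 9, eqn 0 6 8 10, eqn 2 4 7 6, eqn 3 4 7 9, eqn 1 5 7 9, eqn 1 5 8 10, eqn 3 5 7
     16, eqn 4 5 8 17, eqn 2 3 5 9, eqn 3 5 8 12, eqn 3 5 8 15, eqn 0 3 5 3]),
    ([unit_gauge 3 3 11 3 27],
     [eqn 0 9 9 6, eqn 1 7 7 5, eqn 2 7 7 13, eqn 2 8 9 17, eqn 7 7 9 24, eqn 0 6 9 10, eqn 1 5 7
     8, eqn 2 3 3 2, eqn 3 3 3 3, eqn 2 3 7 5, eqn 2 3 9 6, eqn 3 3 4 4, eqn 3 4 7 8, eqn 3 4 9
     10, eqn 3 5 10 17, eqn 3 6 8 17, eqn 4 5 9 17, eqn 4 6 7 17, eqn 3 3 7 7]),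
    ([],
     [eqn 0 7 9 6, eqn 1 5 7 10, eqn 1 7 7 6, eqn 2 7 7 12, eqn 0 6 7 10, eqn 2 3 5 10, eqn 2 3 7
     6, eqn 3 3 5 6, eqn 3 5 8 17]),
    ([unit_gauge 3 4 16 4 28],
     [eqn 0 10 10 6, eqn 1 8 8 5, eqn 2 7 10 16, eqn 2 8 8 13, eqn 8 8 10 25, eqn 0 6 10 9, eqn 1
     5 8 7, eqn 3 5 10 16, eqn 3 6 8 16, eqn 4 5 9 16, eqn 4 5 10 15, eqn 4 6 7 16, eqn 5 8 10
     21, eqn 6 8 10 20, eqn 2 5 10 18, eqn 4 5 10 11, eqn 0 4 6 3, eqn 1 4 5 3, eqn 4 4 5 5]),
    ([],
     [eqn 0 8 10 6, eqn 1 5 8 9, eqn 1 8 8 6, eqn 2 7 8 16, eqn 0 6 8 9, eqn 2 4 5 9, eqn 2 4 8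
     6, eqn 3 5 8 16, eqn 4 4 5 6]),
    ([],
     [eqn 0 5 7 9]),
    ([unit_gauge 1 10 19 1 21, unit_gauge 6 9 28 6 30],
     [eqn 0 9 10 5, eqn 2 7 10 13, eqn 2 8 9 13, eqn 1 7 10 5, eqn 1 8 9 5, eqn 3 10 10 19, eqn 4
     9 9 18, eqn 1 3 10 2, eqn 1 4 9 2, eqn 1 5 9 7, eqn 3 4 9 7, eqn 0 6 9 7, eqn 0 6 10 8, eqn
     3 6 9 16, eqn 4 6 10 17, eqn 2 3 6 7, eqn 3 6 10 12, eqn 3 6 10 15, eqn 1 3 6 3]),
    ([],
     [eqn 0 6 9 8, eqn 0 9 9 5, eqn 1 7 9 5, eqn 2 7 9 13, eqn 1 5 9 8, eqn 1 6 7 8, eqn 2 3 6 8,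
     eqn 2 3 9 5, eqn 3 3 6 5]),
    ([],
     [eqn 0 6 10 7, eqn 0 10 10 5, eqn 1 8 10 5, eqn 2 8 10 13, eqn 1 5 10 7, eqn 1 6 8 7, eqn 2
     4 6 7, eqn 2 4 10 5, eqn 4 4 6 5]),
    ([],
     [eqn 1 6 9 7]),
    ([],
     [eqn 3 3 3 4]),
    ([],
     [eqn 4 4 4 3])]"

lemma H2_4e: "H2_zero 4 (of_bool False)"
  by (rule H2_zero_certificate[of _ _ cert2_4e]) code_simp+

definition cert2_5e :: "(nat \<times> nat \<times> nat, nat \<times> nat, nat \<times> nat \<times> nat \<times> nat) certificate" where
  "cert2_5e =
   [([unit_gauge 1 4 19 1 26, unit_gauge 1 2 11 2 30],
     [eqn 0 9 9 16, eqn 0 10 10 17, eqn 1 5 6 15, eqn 3 3 4 7, eqn 3 3 6 16, eqn 4 4 6 17, eqn 0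
     3 6 7, eqn 0 9 10 11, eqn 1 4 5 8, eqn 4 4 9 19, eqn 4 9 9 23, eqn 0 1 9 3, eqn 0 1 10 4,
     eqn 0 3 10 5, eqn 1 3 4 2, eqn 1 3 6 9, eqn 1 3 8 5, eqn 1 4 7 5, eqn 1 2 3 3, eqn 1 2 4 4,
     eqn 1 2 5 5, eqn 1 2 6 6, eqn 1 5 6 11, eqn 1 7 10 11, eqn 1 8 9 11, eqn 2 3 10 11, eqn 2 4
     9 11, eqn 2 3 8 13]),
    ([unit_gauge 0 4 19 0 26, unit_gauge 0 2 12 2 29],
     [eqn 0 5 6 15, eqn 1 7 7 16, eqn 1 8 8 17, eqn 3 3 4 9, eqn 3 3 5 16, eqn 4 4 5 17, eqn 1 3
     5 9, eqn 1 7 8 11, eqn 0 4 6 10, eqn 4 4 7 19, eqn 4 7 7 24, eqn 0 1 7 3, eqn 0 1 8 4, eqn 0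
     3 4 2, eqn 0 3 5 7, eqn 0 3 8 5, eqn 0 3 10 6, eqn 0 4 9 6, eqn 2 3 8 12, eqn 2 3 10 14, eqn
     2 4 7 12, eqn 2 4 8 17, eqn 2 8 9 20, eqn 1 2 7 9, eqn 1 5 6 14, eqn 1 7 10 14, eqn 2 5 7
     24, eqn 0 1 2 1]),
    ([],
     [eqn 0 3 5 9, eqn 0 3 8 6, eqn 0 4 7 6, eqn 1 7 8 14, eqn 2 3 8 14]),
    ([],
     [eqn 0 4 6 9, eqn 0 5 6 16, eqn 0 10 10 14, eqn 1 4 5 9, eqn 1 5 8 18, eqn 2 4 8 12, eqn 3 4
     4 9, eqn 0 1 8 3, eqn 0 8 8 13, eqn 1 2 8 9, eqn 1 4 8 6, eqn 1 8 10 14]),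
    ([],
     [eqn 0 3 6 10, eqn 0 5 6 17, eqn 0 9 9 14, eqn 1 3 5 10, eqn 1 5 7 19, eqn 2 3 7 12, eqn 3 3
     3 9, eqn 0 1 7 4, eqn 0 7 7 13, eqn 1 2 7 10, eqn 1 3 7 6, eqn 1 7 9 14]),
    ([],
     [eqn 0 2 7 10, eqn 1 7 7 14]),
    ([],
     [eqn 0 2 8 9, eqn 1 8 8 14]),
    ([],
     [eqn 0 3 6 8, eqn 0 6 9 19, eqn 1 3 5 8, eqn 1 5 6 17, eqn 1 7 7 13, eqn 2 3 7 13, eqn 3 3 3
     7, eqn 0 1 9 4, eqn 0 2 9 8, eqn 0 3 9 5, eqn 0 7 9 13, eqn 0 9 9 11]),
    ([],
     [eqn 0 4 6 7, eqn 0 6 10 18, eqn 1 4 5 7, eqn 1 5 6 16, eqn 1 8 8 13, eqn 2 4 8 13, eqn 3 4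
     4 7, eqn 0 1 10 3, eqn 0 2 10 7, eqn 0 4 10 5, eqn 0 8 10 13, eqn 0 10 10 11]),
    ([],
     [eqn 0 9 10 13, eqn 1 3 6 7, eqn 1 3 10 5, eqn 1 4 9 5, eqn 2 3 10 13]),
    ([],
     [eqn 0 9 9 13, eqn 1 2 9 8]),
    ([],
     [eqn 0 10 10 13, eqn 1 2 10 7])]"

lemma H2_5e: "H2_zero 5 (of_bool False)"
  by (rule H2_zero_certificate[of _ _ cert2_5e]) code_simp+

definition cert2_6e :: "(nat \<times> nat \<times> nat, nat \<times> nat, nat \<times> nat \<times> nat \<times> nat) certificate" where
  "cert2_6e =
   [([unit_gauge 1 4 22 1 29, unit_gauge 0 3 24 0 30],
     [eqn 0 2 6 15, eqn 2 3 3 16, eqn 2 4 4 17, eqn 3 3 4 18, eqn 1 4 5 19, eqn 1 4 8 17, eqn 1 4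
     9 14, eqn 1 5 6 20, eqn 1 5 7 24, eqn 1 5 9 23, eqn 3 3 10 23, eqn 6 7 10 29, eqn 0 3 6 18,
     eqn 0 3 8 13, eqn 0 3 9 16, eqn 0 4 6 19, eqn 0 4 7 13, eqn 0 4 10 17, eqn 0 5 6 21, eqn 5 7
     10 30, eqn 0 1 2 2, eqn 0 1 5 5]),
    ([unit_gauge 1 4 25 1 30],
     [eqn 1 2 4 8, eqn 1 2 5 13, eqn 1 2 6 12, eqn 1 2 9 18, eqn 1 2 10 19, eqn 1 3 4 5, eqn 1 3
     6 18, eqn 1 3 10 12, eqn 1 4 9 12]),
    ([unit_gauge 0 4 22 0 29],
     [eqn 0 2 4 10, eqn 0 2 5 12, eqn 0 2 6 14, eqn 0 2 7 18, eqn 0 2 8 19, eqn 0 3 4 6, eqn 0 3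
     5 18, eqn 0 3 8 12, eqn 0 4 7 12]),
    ([],
     [eqn 0 2 6 16, eqn 0 2 10 18, eqn 0 4 6 18, eqn 1 2 8 18, eqn 1 4 5 18, eqn 2 3 4 16, eqn 3
     4 4 18, eqn 5 8 10 30, eqn 5 10 10 29]),
    ([],
     [eqn 0 2 6 17, eqn 0 2 9 19, eqn 0 3 6 19, eqn 1 2 7 19, eqn 1 3 5 19, eqn 2 3 3 15, eqn 3 3
     3 18, eqn 5 7 9 30, eqn 5 9 9 29]),
    ([],
     [eqn 0 1 7 10, eqn 0 2 3 10, eqn 1 3 7 14]),
    ([],
     [eqn 0 1 8 9, eqn 0 2 4 9, eqn 1 4 8 14]),
    ([],
     [eqn 0 1 9 8, eqn 0 3 9 13, eqn 1 2 3 8]),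
    ([],
     [eqn 0 1 10 7, eqn 0 4 10 13, eqn 1 2 4 7])]"

lemma H2_6e: "H2_zero 6 (of_bool False)"
  by (rule H2_zero_certificate[of _ _ cert2_6e]) code_simp+

text \<open>Beyond degree 6 there are no 1-cochains, hence no gauge freedom.\<close>

definition cert2_7e :: "(nat \<times> nat \<times> nat, nat \<times> nat, nat \<times> nat \<times> nat \<times> nat) certificate" where
  "cert2_7e =
   [([],
     [eqn 0 1 7 18, eqn 0 2 7 24, eqn 0 3 3 16, eqn 0 3 4 12, eqn 0 4 4 17, eqn 1 3 5 23, eqn 3 5
     8 30, eqn 0 1 6 14]),
    ([],
     [eqn 0 1 9 18, eqn 0 3 4 13, eqn 0 3 6 24, eqn 1 2 7 24, eqn 1 3 3 16, eqn 1 4 4 17, eqn 3 6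
     10 29, eqn 0 1 5 13]),
    ([],
     [eqn 0 1 3 10, eqn 0 3 3 12]),
    ([],
     [eqn 0 1 4 9, eqn 0 4 4 12]),
    ([],
     [eqn 0 1 5 14]),
    ([],
     [eqn 0 1 3 8, eqn 0 3 3 13]),
    ([],
     [eqn 0 1 4 7, eqn 0 4 4 13]),
    ([],
     [eqn 0 1 6 13])]"

lemma H2_7e: "H2_zero 7 (of_bool False)"
  by (rule H2_zero_certificate[of _ _ cert2_7e]) code_simp+

definition cert2_8e :: "(nat \<times> nat \<times> nat, nat \<times> nat, nat \<times> nat \<times> nat \<times> nat) certificate" where
  "cert2_8e =
   [([],
     [eqn 0 1 3 18, eqn 0 2 3 24, eqn 1 2 3 23]),
    ([],
     [eqn 0 1 2 14]),
    ([],
     [eqn 0 1 2 13])]"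

lemma H2_8e: "H2_zero 8 (of_bool False)"
  by (rule H2_zero_certificate[of _ _ cert2_8e]) code_simp+

definition cert2_9e :: "(nat \<times> nat \<times> nat, nat \<times> nat, nat \<times> nat \<times> nat \<times> nat) certificate" where
  "cert2_9e =
   [([],
     [eqn 0 1 2 20]),
    ([],
     [eqn 0 1 2 21])]"

lemma H2_9e: "H2_zero 9 (of_bool False)"
  by (rule H2_zero_certificate[of _ _ cert2_9e]) code_simp+

section \<open>Certificates for H^2, odd cochains of degree 1 to 9\<close>

definition cert2_1o :: "(nat \<times> nat \<times> nat, nat \<times> nat, nat \<times> nat \<times> nat \<times> nat) certificate" where
  "cert2_1o =
   [([unit_gauge 2 3 1 3 6, unit_gauge 2 7 2 7 11, unit_gauge 1 7 1 7 12, unit_gauge 7 10 10 7 15, unit_gauge 3 5 2 5 19, unit_gauge 4 7 4 0 4, unit_gauge 0 9 1 9 14, unit_gauge 8 9 10 8 17],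
     [eqn 2 6 7 1, eqn 7 7 10 2, eqn 3 7 10 1, eqn 3 5 6 1, eqn 5 6 7 2, eqn 4 7 7 0, eqn 2 5 7
     0, eqn 2 5 9 1, eqn 4 7 9 1, eqn 3 8 9 1, eqn 6 7 8 4]),
    ([unit_gauge 7 8 10 7 14],
     [eqn 3 7 8 1, eqn 4 7 7 1, eqn 5 7 7 3]),
    ([unit_gauge 1 8 1 8 11, unit_gauge 0 8 0 0 3, unit_gauge 8 8 8 8 15, unit_gauge 6 8 6 4 6, unit_gauge 8 9 9 2 9, unit_gauge 4 5 2 5 18, unit_gauge 8 10 10 10 14, unit_gauge 4 7 3 7 16],
     [eqn 3 8 8 0, eqn 6 8 8 4, eqn 8 8 9 2, eqn 2 6 8 1, eqn 4 5 6 1, eqn 5 6 8 2, eqn 2 5 8 0,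
     eqn 3 8 10 1, eqn 5 8 10 4, eqn 4 7 8 0, eqn 4 7 10 1]),
    ([unit_gauge 8 8 10 8 14],
     [eqn 3 8 8 1, eqn 4 7 8 1, eqn 5 7 8 3]),
    ([unit_gauge 0 9 0 9 11, unit_gauge 1 9 1 1 4, unit_gauge 9 9 9 9 15, unit_gauge 1 7 0 7 13, unit_gauge 8 9 8 2 8, unit_gauge 2 3 0 3 5, unit_gauge 3 6 2 6 19, unit_gauge 9 10 10 10 17],
     [eqn 4 9 9 1, eqn 4 7 9 0, eqn 8 9 9 2, eqn 2 5 9 0, eqn 3 8 9 0, eqn 3 5 6 0, eqn 5 6 9 2,
     eqn 2 6 9 1, eqn 6 7 9 3, eqn 3 9 10 1, eqn 6 7 10 4]),
    ([unit_gauge 4 6 2 4 5, unit_gauge 2 4 0 2 7, unit_gauge 2 10 2 10 11, unit_gauge 5 10 5 10 12, unit_gauge 4 10 4 10 15, unit_gauge 1 10 1 1 3, unit_gauge 1 8 0 8 13, unit_gauge 4 9 3 9 16],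
     [eqn 4 5 6 0, eqn 2 5 10 0, eqn 5 6 10 2, eqn 5 10 10 4, eqn 7 10 10 2, eqn 3 10 10 1, eqn 2
     6 10 1, eqn 2 6 8 0, eqn 3 8 10 0, eqn 4 8 9 0, eqn 4 9 10 1]),
    ([unit_gauge 9 10 8 9 13],
     [eqn 3 9 10 0, eqn 4 9 9 0, eqn 6 9 9 3]),
    ([unit_gauge 10 10 8 10 13],
     [eqn 3 10 10 0, eqn 4 9 10 0, eqn 6 9 10 3]),
    ([unit_gauge 7 9 10 7 17],
     [eqn 3 7 9 1, eqn 6 7 7 4]),
    ([unit_gauge 9 9 10 9 17],
     [eqn 3 9 9 1, eqn 6 7 9 4]),
    ([unit_gauge 8 10 9 8 16],
     [eqn 4 8 10 1, eqn 8 8 10 2]),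
    ([unit_gauge 10 10 9 10 16],
     [eqn 4 10 10 1, eqn 8 10 10 2]),
    ([],
     [eqn 3 7 7 1]),
    ([],
     [eqn 4 8 8 1]),
    ([],
     [eqn 3 9 9 0]),
    ([],
     [eqn 4 10 10 0])]"

lemma H2_1o: "H2_zero 1 (of_bool True)"
  by (rule H2_zero_certificate[of _ _ cert2_1o]) code_simp+

definition cert2_2o :: "(nat \<times> nat \<times> nat, nat \<times> nat, nat \<times> nat \<times> nat \<times> nat) certificate" where
  "cert2_2o =
   [([unit_gauge 3 8 8 3 11, unit_gauge 8 9 19 2 19, unit_gauge 6 7 12 6 22, ((2,3,2), [((3,11),1), ((0,8),1)]), ((5,9,15), [((3,15),1), ((0,8),1)]), ((5,9,11), [((5,25),2), ((3,15),1), ((0,8),1)]), ((3,10,10), [((6,22),2), ((3,12),-1), ((0,8),1)]), ((3,9,9), [((7,21),4), ((3,12),-3), ((0,8),3), ((1,10),-3)]), ((5,6,19), [((7,21),2), ((6,22),-3)]), unit_gauge 5 10 17 4 17],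
     [eqn 2 8 9 4, eqn 5 9 9 9, eqn 3 8 9 2, eqn 5 8 9 8, eqn 0 5 9 0, eqn 2 3 5 0, eqn 3 5 9 3,
     eqn 3 3 10 1, eqn 1 5 9 1, eqn 3 5 6 2, eqn 5 6 9 6, eqn 0 6 9 1, eqn 0 6 7 0, eqn 1 6 7 1,
     eqn 2 3 6 1, eqn 2 6 7 2, eqn 5 6 7 5, eqn 2 7 10 4, eqn 2 7 9 3, eqn 3 7 10 2, eqn 6 7 9 9,
     eqn 3 5 10 4, eqn 3 6 8 4, eqn 4 5 9 4, eqn 4 6 7 4]),
    ([unit_gauge 7 7 18 7 20, unit_gauge 5 7 11 5 22, unit_gauge 2 5 10 0 10, unit_gauge 5 9 14 3 14],
     [eqn 2 7 7 3, eqn 2 7 8 4, eqn 1 5 7 1, eqn 5 7 7 7, eqn 5 7 8 8, eqn 2 5 7 2, eqn 5 7 10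
     10, eqn 0 5 7 0, eqn 0 5 9 1, eqn 0 6 7 1, eqn 2 3 5 1, eqn 3 4 7 1, eqn 3 5 8 4]),
    ([unit_gauge 6 8 11 6 23, unit_gauge 2 10 6 10 20, unit_gauge 5 10 11 5 24, unit_gauge 0 4 0 0 7, unit_gauge 5 10 15 4 15, ((4,10,10), [((4,12),1), ((0,7),1)]), unit_gauge 3 10 9 1 9, ((4,5,5), [((6,23),6), ((5,24),-4), ((4,12),3), ((4,11),1), ((4,15),-4)]), ((1,5,3), [((3,16),1), ((1,9),-1)]), ((4,6,6), [((8,21),2), ((6,23),3)])],
     [eqn 2 7 10 3, eqn 5 10 10 10, eqn 0 5 10 0, eqn 4 5 10 4, eqn 4 4 7 0, eqn 4 7 10 2, eqn 5
     7 10 7, eqn 1 5 10 1, eqn 3 4 10 1, eqn 4 4 9 1, eqn 4 5 9 3, eqn 2 4 6 1, eqn 4 5 6 2, eqn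
     2 5 6 3, eqn 4 6 7 3, eqn 6 7 10 9, eqn 0 6 8 0, eqn 1 6 8 1, eqn 2 6 8 2, eqn 5 6 8 5, eqn
     2 8 9 3, eqn 2 8 10 4, eqn 3 8 10 2, eqn 4 8 9 2, eqn 6 7 8 7]),
    ([unit_gauge 7 8 18 8 20, unit_gauge 5 8 12 5 23, unit_gauge 2 5 9 0 9, unit_gauge 5 10 14 4 14],
     [eqn 2 7 8 3, eqn 2 8 8 4, eqn 1 5 8 1, eqn 5 8 8 8, eqn 5 7 8 7, eqn 2 5 8 2, eqn 5 8 9 9,
     eqn 0 5 8 0, eqn 0 5 10 1, eqn 0 6 8 1, eqn 2 4 5 1, eqn 3 4 8 1, eqn 4 5 7 3]),
    ([unit_gauge 9 9 18 9 21, unit_gauge 6 9 12 6 25, unit_gauge 2 6 8 1 8, unit_gauge 5 9 13 3 13],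
     [eqn 2 9 9 3, eqn 2 9 10 4, eqn 0 6 9 0, eqn 6 9 9 9, eqn 6 9 10 10, eqn 2 6 9 2, eqn 6 8 9
     8, eqn 1 6 9 1, eqn 1 5 9 0, eqn 1 6 7 0, eqn 2 3 6 0, eqn 3 4 9 0, eqn 3 6 10 4]),
    ([unit_gauge 9 10 18 10 21, unit_gauge 6 10 11 6 24, unit_gauge 2 6 7 1 7, unit_gauge 5 10 13 4 13],
     [eqn 2 9 10 3, eqn 2 10 10 4, eqn 0 6 10 0, eqn 6 10 10 10, eqn 6 9 10 9, eqn 2 6 10 2, eqn
     6 7 10 7, eqn 1 6 10 1, eqn 1 5 10 0, eqn 1 6 8 0, eqn 2 4 6 0, eqn 3 4 10 0, eqn 4 6 9 3]),
    ([unit_gauge 5 9 17 3 17],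
     [eqn 2 7 9 4, eqn 5 9 9 10, eqn 3 5 9 4, eqn 3 7 9 2, eqn 6 7 9 10]),
    ([],
     [eqn 2 7 7 4, eqn 3 3 7 1, eqn 3 5 7 4]),
    ([],
     [eqn 2 9 9 4, eqn 3 3 9 0, eqn 3 6 9 4]),
    ([unit_gauge 5 10 16 4 16],
     [eqn 2 8 10 3, eqn 5 10 10 9, eqn 4 5 10 3, eqn 4 8 10 2, eqn 6 8 10 9]),
    ([],
     [eqn 2 8 8 3, eqn 4 4 8 1, eqn 4 5 8 3]),
    ([],
     [eqn 2 10 10 3, eqn 4 4 10 0, eqn 4 6 10 3]),
    ([],
     [eqn 0 5 7 1]),
    ([],
     [eqn 0 5 8 1]),
    ([],
     [eqn 1 6 9 0]),
    ([],
     [eqn 1 6 10 0])]"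

lemma H2_2o: "H2_zero 2 (of_bool True)"
  by (rule H2_zero_certificate[of _ _ cert2_2o]) code_simp+

definition cert2_3o :: "(nat \<times> nat \<times> nat, nat \<times> nat, nat \<times> nat \<times> nat \<times> nat) certificate" where
  "cert2_3o =
   [([unit_gauge 7 10 23 2 23, unit_gauge 0 10 6 0 18, unit_gauge 1 8 6 8 26, unit_gauge 2 4 6 4 20, unit_gauge 2 5 18 5 28],
     [eqn 7 7 10 16, eqn 7 10 10 14, eqn 0 2 10 1, eqn 1 7 8 3, eqn 1 8 8 4, eqn 8 8 10 17, eqn 0
     8 10 4, eqn 3 8 8 5, eqn 7 8 9 16, eqn 8 8 9 11, eqn 8 8 9 12, eqn 8 8 9 15, eqn 2 4 7 3,
     eqn 2 4 8 4, eqn 6 7 8 18, eqn 5 7 10 18, eqn 5 8 9 18, eqn 1 5 8 2, [(1,4,5,6,6),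
     (-1,5,6,8,11), (-1,5,6,8,12), (-1,5,6,10,14)], eqn 5 6 7 16, eqn 5 6 8 15, eqn 2 5 6 9, eqn
     3 5 8 7, eqn 3 5 10 9, eqn 4 6 7 9, eqn 4 6 8 10, eqn 5 6 8 11, eqn 5 6 8 12, eqn 0 4 6 1]),
    ([unit_gauge 2 9 14 2 22, unit_gauge 7 9 23 7 26, unit_gauge 6 7 20 3 20, unit_gauge 0 6 10 0 19, unit_gauge 5 7 21 5 27],
     [eqn 8 9 9 14, eqn 2 8 9 10, eqn 7 7 9 16, eqn 7 9 10 14, eqn 1 7 7 3, eqn 1 7 8 4, eqn 7 7
     10 11, eqn 7 7 10 12, eqn 7 7 10 15, eqn 6 7 7 18, eqn 2 3 7 3, eqn 1 5 7 2, eqn 5 7 9 18,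
     [(1,3,5,6,6), (-1,5,6,7,11), (-1,5,6,7,12), (-1,5,6,9,14)], eqn 5 6 7 15, eqn 5 6 8 17, eqn
     2 5 6 10, eqn 4 5 9 10, eqn 4 6 7 10, eqn 4 7 9 6, eqn 5 6 9 14, eqn 5 8 9 19, eqn 2 5 7 5,
     eqn 5 6 7 11, eqn 5 6 7 12, eqn 3 3 4 1, eqn 0 2 9 1, eqn 0 3 6 1, eqn 0 3 5 0]),
    ([],
     [eqn 7 7 8 16, eqn 8 8 8 17, eqn 0 7 8 3, eqn 2 7 8 9, eqn 5 7 8 18, eqn 0 5 8 2, eqn 5 6 8
     14]),
    ([],
     [eqn 7 7 7 16, eqn 7 8 8 17, eqn 0 7 7 3, eqn 2 7 7 9, eqn 5 7 7 18, eqn 0 5 7 2, eqn 5 6 7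
     14]),
    ([unit_gauge 10 10 22 10 26, unit_gauge 2 10 15 2 24, unit_gauge 4 6 12 4 21, unit_gauge 1 2 3 1 18, unit_gauge 2 6 18 6 28],
     [eqn 0 10 10 4, eqn 8 10 10 17, eqn 9 10 10 14, eqn 7 10 10 15, eqn 8 9 10 15, eqn 8 8 9 13,
     eqn 8 9 9 16, eqn 7 10 10 11, eqn 7 10 10 12, eqn 1 2 8 0, eqn 1 7 10 3, eqn 3 10 10 6, eqn
     6 7 10 18, eqn 0 6 10 2, eqn 0 4 6 0, [(1,4,6,8,8), (-1,4,4,6,4), (-3,4,6,10,10),
     (3,6,8,10,19)], eqn 6 8 9 18, eqn 6 8 10 19, eqn 2 6 8 5, eqn 4 6 10 10, eqn 4 4 6 4, eqn 4
     4 9 2, eqn 5 6 10 15, eqn 5 10 10 19, eqn 1 4 6 1, eqn 1 5 6 3, eqn 3 4 10 2, eqn 3 6 8 7,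
     eqn 4 5 9 7]),
    ([unit_gauge 2 9 15 2 25, unit_gauge 7 9 24 9 26, unit_gauge 3 9 18 3 21, unit_gauge 3 6 15 6 27, unit_gauge 1 7 5 1 19],
     [eqn 7 9 9 16, eqn 9 9 10 14, eqn 8 9 9 15, eqn 8 9 10 17, eqn 7 9 10 15, eqn 0 9 9 3, eqn 7
     7 10 13, eqn 8 9 9 11, eqn 8 9 9 12, eqn 5 9 9 18, eqn 2 3 9 3, eqn 5 6 9 15, eqn 5 6 10 17,
     eqn 1 2 7 0, eqn 1 7 9 3, eqn 4 9 9 6, eqn 2 3 10 4, [(1,3,6,7,7), (1,3,5,9,7),
     (2,5,6,7,13), (1,3,5,6,5)], eqn 5 6 7 13, eqn 6 7 9 18, eqn 6 7 10 19, eqn 5 6 9 11, eqn 5 6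
     9 12, eqn 0 3 6 0, eqn 3 3 6 3, eqn 3 3 10 2, eqn 1 3 6 1, eqn 1 5 6 4, eqn 3 4 6 4]),
    ([],
     [eqn 9 9 10 16, eqn 10 10 10 17, eqn 1 9 10 3, eqn 2 9 10 7, eqn 6 9 10 18, eqn 1 6 10 2,
     eqn 5 6 10 13]),
    ([],
     [eqn 9 9 9 16, eqn 9 10 10 17, eqn 1 9 9 3, eqn 2 9 9 7, eqn 6 9 9 18, eqn 1 6 9 2, eqn 5 6
     9 13]),
    ([],
     [eqn 0 7 9 4, eqn 1 7 7 4, eqn 3 3 3 1, eqn 2 7 7 8, eqn 3 3 5 4, eqn 3 3 7 2]),
    ([],
     [eqn 0 8 10 3, eqn 1 8 8 3, eqn 4 4 4 1, eqn 2 8 8 7, eqn 4 4 5 3, eqn 4 4 8 2]),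
    ([],
     [eqn 0 9 9 4, eqn 1 7 9 4, eqn 3 3 3 0, eqn 2 7 9 8, eqn 3 3 6 4, eqn 3 3 9 2]),
    ([],
     [eqn 0 10 10 3, eqn 1 8 10 3, eqn 4 4 4 0, eqn 2 8 10 7, eqn 4 4 6 3, eqn 4 4 10 2]),
    ([],
     [eqn 0 7 7 4]),
    ([],
     [eqn 0 8 8 3]),
    ([],
     [eqn 1 9 9 4]),
    ([],
     [eqn 1 10 10 3])]"

lemma H2_3o: "H2_zero 3 (of_bool True)"
  by (rule H2_zero_certificate[of _ _ cert2_3o]) code_simp+

definition cert2_4o :: "(nat \<times> nat \<times> nat, nat \<times> nat, nat \<times> nat \<times> nat \<times> nat) certificate" where
  "cert2_4o =
   [([unit_gauge 4 4 19 4 26, unit_gauge 5 6 28 2 28, unit_gauge 4 7 24 0 24, unit_gauge 2 6 23 1 23, unit_gauge 6 8 26 8 30, unit_gauge 5 10 26 10 29],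
     [eqn 3 4 4 2, eqn 3 4 5 7, eqn 3 4 6 9, eqn 4 5 6 12, eqn 3 5 6 16, eqn 4 5 6 15, eqn 2 4 4
     4, eqn 4 4 7 5, eqn 0 2 4 0, eqn 4 6 7 18, eqn 2 4 5 5, eqn 2 5 9 16, eqn 2 5 10 15, eqn 2 6
     7 16, eqn 2 6 8 15, eqn 0 2 6 3, eqn 0 4 9 3, eqn 1 4 7 3, eqn 4 5 9 18, eqn 2 4 9 9, eqn 6
     8 8 25, eqn 4 7 8 13, eqn 6 7 8 24, eqn 0 8 9 7, eqn 1 3 8 3, eqn 1 6 8 6, eqn 2 3 8 7, eqn
     5 10 10 22, eqn 4 8 10 17, eqn 4 9 10 14, eqn 5 9 10 23, eqn 6 7 10 23, eqn 8 9 10 20, eqn 0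
     3 10 3, eqn 0 5 10 5]),
    ([unit_gauge 3 4 19 3 26, unit_gauge 5 6 27 2 27, unit_gauge 0 6 19 0 25, unit_gauge 1 7 15 1 22, unit_gauge 6 7 26 7 30, unit_gauge 5 9 26 9 29],
     [eqn 3 3 4 2, eqn 3 3 5 7, eqn 3 3 6 9, eqn 3 5 6 12, eqn 3 5 6 15, eqn 4 5 6 17, eqn 2 3 3
     3, eqn 0 3 6 2, eqn 0 5 6 8, eqn 3 3 8 5, eqn 2 3 5 5, eqn 2 5 9 15, eqn 2 5 10 17, eqn 2 6
     7 15, eqn 2 6 8 17, eqn 0 2 6 4, eqn 0 3 10 4, eqn 1 3 8 4, eqn 3 5 10 19, eqn 2 3 10 10,
     eqn 6 7 7 24, eqn 3 7 8 13, eqn 6 7 8 25, eqn 0 7 10 8, eqn 1 3 7 3, eqn 1 6 7 6, eqn 2 4 7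
     8, eqn 5 9 9 23, eqn 3 7 9 16, eqn 3 9 10 14, eqn 5 9 10 22, eqn 6 8 9 22, eqn 7 9 10 20,
     eqn 0 3 9 3, eqn 0 5 9 5]),
    ([unit_gauge 0 7 16 0 23, unit_gauge 4 8 22 8 29],
     [eqn 3 4 5 9, eqn 4 5 6 14, eqn 2 5 7 16, eqn 2 5 8 15, eqn 4 7 7 16, eqn 0 4 7 3, eqn 2 4 7
     9, eqn 2 5 10 14, eqn 4 5 7 18, eqn 4 8 8 17, eqn 5 8 8 25, eqn 7 8 8 21, eqn 8 8 9 20, eqn
     0 2 8 2, eqn 0 3 8 3, eqn 0 6 8 6, eqn 2 6 8 14]),
    ([unit_gauge 0 9 14 0 22, unit_gauge 4 7 22 7 29],
     [eqn 3 3 5 9, eqn 3 5 6 14, eqn 2 5 9 14, eqn 3 8 9 14, eqn 2 3 5 6, eqn 2 5 7 15, eqn 2 5 8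
     17, eqn 0 2 3 1, eqn 0 2 5 4, eqn 4 7 7 12, eqn 0 4 7 4, eqn 2 4 7 10, eqn 2 6 7 14, eqn 3 4
     7 6, eqn 3 5 7 18, eqn 4 7 7 11, eqn 4 7 8 17]),
    ([],
     [eqn 0 5 7 6]),
    ([],
     [eqn 0 7 9 10, eqn 1 7 7 10, eqn 2 3 7 10]),
    ([],
     [eqn 0 5 8 6]),
    ([],
     [eqn 0 8 10 9, eqn 1 8 8 9, eqn 2 4 8 9]),
    ([unit_gauge 1 7 13 1 25, unit_gauge 4 9 25 9 30],
     [eqn 3 3 6 7, eqn 3 5 6 13, eqn 2 6 7 13, eqn 3 7 10 13, eqn 2 3 6 5, eqn 2 6 9 15, eqn 2 6
     10 17, eqn 1 2 3 0, eqn 1 2 6 4, eqn 4 9 9 12, eqn 1 4 9 4, eqn 2 4 9 8, eqn 2 5 9 13, eqn 3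
     4 9 5, eqn 3 6 9 18, eqn 4 9 9 11, eqn 4 9 10 17]),
    ([],
     [eqn 0 9 9 10, eqn 1 7 7 8, eqn 2 7 9 19, eqn 3 3 3 2, eqn 3 5 6 17, eqn 3 7 7 13, eqn 3 9 9
     14]),
    ([unit_gauge 1 8 13 1 24, unit_gauge 4 10 25 10 30],
     [eqn 3 4 6 7, eqn 4 5 6 13, eqn 2 6 8 13, eqn 4 8 9 13, eqn 2 4 6 5, eqn 2 6 9 16, eqn 2 6
     10 15, eqn 1 2 4 0, eqn 1 2 6 3, eqn 4 10 10 17, eqn 6 8 10 25, eqn 6 9 10 23, eqn 8 9 10
     21, eqn 1 2 10 2, eqn 1 3 10 3, eqn 1 5 10 5, eqn 2 5 10 13]),
    ([],
     [eqn 0 10 10 9, eqn 1 8 8 7, eqn 2 8 10 18, eqn 4 4 4 2, eqn 4 5 6 16, eqn 4 8 8 13, eqn 4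
     10 10 14]),
    ([],
     [eqn 1 6 9 5]),
    ([],
     [eqn 0 9 9 8, eqn 1 7 9 8, eqn 2 3 9 8]),
    ([],
     [eqn 1 6 10 5]),
    ([],
     [eqn 0 10 10 7, eqn 1 8 10 7, eqn 2 4 10 7])]"

lemma H2_4o: "H2_zero 4 (of_bool True)"
  by (rule H2_zero_certificate[of _ _ cert2_4o]) code_simp+

definition cert2_5o :: "(nat \<times> nat \<times> nat, nat \<times> nat, nat \<times> nat \<times> nat \<times> nat) certificate" where
  "cert2_5o =
   [([unit_gauge 1 8 21 1 28, unit_gauge 1 4 12 4 30],
     [eqn 0 6 9 16, eqn 0 9 10 18, eqn 2 7 10 24, eqn 0 6 10 11, eqn 1 2 8 5, eqn 1 5 8 13, eqn 1
     5 9 16, eqn 1 5 10 15, eqn 1 6 7 16, eqn 1 7 10 18, eqn 2 3 6 16, eqn 3 3 10 16, eqn 0 1 6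
     3, eqn 2 4 6 12, eqn 3 4 10 12, eqn 4 4 9 12, eqn 4 4 10 17, eqn 4 5 6 21, eqn 5 10 10 27,
     eqn 0 4 6 5, eqn 0 4 9 7, eqn 0 6 8 13, eqn 1 2 4 2]),
    ([unit_gauge 1 3 15 1 27, unit_gauge 1 3 12 3 30],
     [eqn 0 6 9 15, eqn 0 9 9 18, eqn 2 7 9 24, eqn 0 6 9 11, eqn 1 5 9 15, eqn 1 5 10 17, eqn 1
     6 7 15, eqn 2 3 6 15, eqn 4 4 9 17, eqn 4 9 9 20, eqn 0 1 6 4, eqn 1 2 5 8, eqn 1 4 7 8, eqn
     2 3 6 12, eqn 3 3 10 12, eqn 3 4 9 12, eqn 3 5 6 21, eqn 0 3 6 5, eqn 0 3 9 7, eqn 0 3 10 8,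
     eqn 0 5 9 13, eqn 0 6 7 13, eqn 1 2 3 2]),
    ([unit_gauge 0 8 21 0 28, unit_gauge 1 4 14 4 29],
     [eqn 1 5 7 16, eqn 1 7 8 18, eqn 2 7 8 24, eqn 1 5 8 11, eqn 0 8 9 18, eqn 0 8 10 19, eqn 3
     8 8 21, eqn 0 1 8 2, eqn 0 2 6 9, eqn 0 3 8 7, eqn 0 5 6 18, eqn 1 2 5 9, eqn 0 5 10 15, eqn
     2 4 6 14, eqn 3 4 10 14, eqn 4 4 9 14, eqn 4 5 6 20, eqn 0 2 4 2, eqn 0 4 6 6, eqn 1 4 7 9,
     eqn 1 4 8 10, eqn 1 5 10 14, eqn 1 6 8 14]),
    ([unit_gauge 0 3 15 0 27, unit_gauge 1 3 14 3 29],
     [eqn 1 5 7 15, eqn 1 7 7 18, eqn 2 7 7 24, eqn 1 5 7 11, eqn 0 5 9 15, eqn 0 5 10 17, eqn 0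
     6 7 15, eqn 0 6 9 14, eqn 0 7 9 18, eqn 0 7 10 19, eqn 2 3 5 15, eqn 4 4 7 17, eqn 0 1 5 4,
     eqn 2 3 6 14, eqn 3 3 10 14, eqn 3 4 9 14, eqn 3 5 6 20, eqn 0 2 3 2, eqn 0 3 6 6, eqn 1 3 7
     9, eqn 1 3 8 10, eqn 1 5 9 14, eqn 1 6 7 14]),
    ([],
     [eqn 0 2 5 10, eqn 0 2 7 6, eqn 0 3 8 10, eqn 1 5 7 14]),
    ([],
     [eqn 0 3 9 10, eqn 1 3 7 10, eqn 2 3 3 10]),
    ([],
     [eqn 0 2 5 9, eqn 0 2 8 6, eqn 0 4 7 9, eqn 1 5 8 14]),
    ([],
     [eqn 0 4 10 9, eqn 1 4 8 9, eqn 2 4 4 9]),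
    ([],
     [eqn 0 6 9 13, eqn 1 2 6 8, eqn 1 2 9 5, eqn 1 3 10 8]),
    ([],
     [eqn 0 3 9 8, eqn 1 3 7 8, eqn 2 3 3 8]),
    ([],
     [eqn 0 6 10 13, eqn 1 2 6 7, eqn 1 2 10 5, eqn 1 4 9 7]),
    ([],
     [eqn 0 4 10 7, eqn 1 4 8 7, eqn 2 4 4 7])]"

lemma H2_5o: "H2_zero 5 (of_bool True)"
  by (rule H2_zero_certificate[of _ _ cert2_5o]) code_simp+

definition cert2_6o :: "(nat \<times> nat \<times> nat, nat \<times> nat, nat \<times> nat \<times> nat \<times> nat) certificate" where
  "cert2_6o =
   [([],
     [eqn 0 2 9 16, eqn 0 3 6 16, eqn 0 8 10 25, eqn 1 2 7 16, eqn 1 3 5 16, eqn 1 7 8 24, eqn 2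
     7 10 28, eqn 2 8 9 28, eqn 3 3 4 16, eqn 4 4 4 17, eqn 0 1 5 7, eqn 0 3 4 7, eqn 0 4 5 13,
     eqn 0 4 6 12, eqn 1 3 4 9, eqn 2 3 4 18]),
    ([],
     [eqn 0 2 9 15, eqn 0 3 6 15, eqn 0 7 9 24, eqn 1 2 7 15, eqn 1 3 5 15, eqn 1 7 7 24, eqn 2 7
     10 27, eqn 2 8 9 27, eqn 3 3 3 16, eqn 3 4 4 17, eqn 0 1 5 8, eqn 0 3 3 7, eqn 0 3 5 13, eqn
     0 3 6 12, eqn 1 3 3 9, eqn 2 3 3 18]),
    ([],
     [eqn 0 1 5 10, eqn 0 1 7 6, eqn 0 2 7 15, eqn 0 3 3 9, eqn 1 2 7 14, eqn 1 3 5 14]),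
    ([],
     [eqn 0 1 5 9, eqn 0 1 8 6, eqn 0 2 7 16, eqn 0 3 4 9, eqn 1 2 8 14, eqn 1 4 5 14]),
    ([],
     [eqn 0 1 6 7, eqn 0 1 10 5, eqn 0 2 10 13, eqn 0 4 6 13, eqn 1 2 8 13, eqn 1 3 4 7]),
    ([],
     [eqn 0 1 6 8, eqn 0 1 9 5, eqn 0 2 9 13, eqn 0 3 6 13, eqn 1 2 7 13, eqn 1 3 3 7]),
    ([],
     [eqn 0 3 3 8]),
    ([],
     [eqn 0 4 4 7])]"

lemma H2_6o: "H2_zero 6 (of_bool True)"
  by (rule H2_zero_certificate[of _ _ cert2_6o]) code_simp+

definition cert2_7o :: "(nat \<times> nat \<times> nat, nat \<times> nat, nat \<times> nat \<times> nat \<times> nat) certificate" where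
  "cert2_7o =
   [([],
     [eqn 0 1 5 19, eqn 0 2 3 12, eqn 0 2 3 15, eqn 0 3 3 18, eqn 0 4 7 25, eqn 1 2 7 20, eqn 0 1
     9 14]),
    ([],
     [eqn 0 1 5 18, eqn 0 2 3 16, eqn 0 2 4 12, eqn 0 3 4 18, eqn 0 3 8 24, eqn 1 2 8 20, eqn 0 1
     10 14]),
    ([],
     [eqn 0 1 6 18, eqn 0 2 4 13, eqn 0 2 10 21, eqn 1 2 3 16, eqn 1 3 4 18, eqn 1 3 10 23, eqn 0
     1 8 13]),
    ([],
     [eqn 0 1 6 19, eqn 0 2 3 13, eqn 0 2 9 21, eqn 1 2 3 15, eqn 1 3 3 18, eqn 1 4 9 22, eqn 0 1
     7 13]),
    ([],
     [eqn 0 1 7 14]),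
    ([],
     [eqn 0 1 8 14]),
    ([],
     [eqn 0 1 9 13]),
    ([],
     [eqn 0 1 10 13])]"

lemma H2_7o: "H2_zero 7 (of_bool True)"
  by (rule H2_zero_certificate[of _ _ cert2_7o]) code_simp+

definition cert2_8o :: "(nat \<times> nat \<times> nat, nat \<times> nat, nat \<times> nat \<times> nat \<times> nat) certificate" where
  "cert2_8o =
   [([],
     [eqn 0 1 2 19, eqn 0 2 3 21, eqn 1 2 3 20]),
    ([],
     [eqn 0 1 2 18, eqn 0 2 4 21, eqn 1 2 4 20]),
    ([],
     [eqn 0 1 3 14]),
    ([],
     [eqn 0 1 4 14]),
    ([],
     [eqn 0 1 3 13]),
    ([],
     [eqn 0 1 4 13])]"

lemma H2_8o: "H2_zero 8 (of_bool True)"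
  by (rule H2_zero_certificate[of _ _ cert2_8o]) code_simp+

text \<open>Degree 9 leaves only two arguments in g_-3 and values in g_3, all even, so no odd
  coordinates exist.\<close>

lemma H2_9o: "H2_zero 9 (of_bool True)"
  by (rule H2_zero_certificate[of _ _ "[]"]) code_simp+

section \<open>Certificate for H^2, even cochains of degree 2\<close>

definition cert2_2e :: "(nat \<times> nat \<times> nat, nat \<times> nat, nat \<times> nat \<times> nat \<times> nat) certificate" where
  "cert2_2e =
   [([unit_gauge 5 7 19 7 22],
     [eqn 3 3 5 1, eqn 3 5 7 2, eqn 5 6 7 10, eqn 5 7 9 6, eqn 7 8 9 10, eqn 0 7 9 1, eqn 2 7 7
     2, eqn 0 7 7 0, eqn 3 7 7 3]),
    ([unit_gauge 5 8 18 8 23],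
     [eqn 4 4 5 1, eqn 4 5 8 2, eqn 5 6 8 9, eqn 5 8 10 6, eqn 7 8 10 9, eqn 0 8 10 1, eqn 2 8 8
     2, eqn 0 8 8 0, eqn 3 8 8 3]),
    ([unit_gauge 3 3 2 3 19, unit_gauge 3 7 5 7 25, unit_gauge 7 9 12 9 22, unit_gauge 7 10 17 2 17],
     [eqn 3 3 5 0, eqn 3 3 6 1, eqn 3 6 7 2, eqn 6 7 7 5, eqn 1 7 7 0, eqn 1 7 9 1, eqn 5 7 9 5,
     eqn 6 7 9 6, eqn 7 7 9 7, eqn 7 9 9 9, eqn 0 9 9 1, eqn 7 7 10 8, eqn 2 6 7 4, eqn 3 5 6 4,
     eqn 3 8 9 4, eqn 5 6 9 10]),
    ([unit_gauge 4 4 2 4 18, unit_gauge 4 8 5 8 24, unit_gauge 8 10 11 10 23, unit_gauge 7 10 16 2 16],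
     [eqn 4 4 5 0, eqn 4 4 6 1, eqn 4 6 8 2, eqn 6 8 8 5, eqn 1 8 8 0, eqn 1 8 10 1, eqn 5 8 10
     5, eqn 6 8 10 6, eqn 8 8 10 8, eqn 8 10 10 10, eqn 0 10 10 1, eqn 7 10 10 9, eqn 2 5 10 3,
     eqn 2 6 8 3, eqn 4 5 6 3, eqn 4 8 9 3]),
    ([unit_gauge 6 9 19 9 25],
     [eqn 3 3 6 0, eqn 3 6 9 2, eqn 5 6 9 8, eqn 6 7 9 5, eqn 7 9 10 8, eqn 1 7 9 0, eqn 2 9 9 2,
     eqn 1 9 9 1, eqn 3 9 9 3]),
    ([unit_gauge 6 10 18 10 24],
     [eqn 4 4 6 0, eqn 4 6 10 2, eqn 5 6 10 7, eqn 6 8 10 5, eqn 8 9 10 7, eqn 1 8 10 0, eqn 2 10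
     10 2, eqn 1 10 10 1, eqn 3 10 10 3]),
    ([],
     [eqn 0 7 7 1]),
    ([],
     [eqn 3 7 7 4]),
    ([],
     [eqn 0 7 8 1]),
    ([],
     [eqn 3 7 9 4]),
    ([],
     [eqn 0 8 8 1]),
    ([],
     [eqn 4 8 8 3]),
    ([],
     [eqn 4 8 10 3]),
    ([],
     [eqn 1 9 9 0]),
    ([],
     [eqn 3 9 9 4]),
    ([],
     [eqn 1 9 10 0]),
    ([],
     [eqn 1 10 10 0]),
    ([],
     [eqn 4 10 10 3]),
    ([unit_gauge 0 2 1 2 14, unit_gauge 2 5 6 5 20, ((0,5,2), [((5,20),1), ((2,14),-1), ((0,6),-1)]), unit_gauge 3 8 6 8 22, unit_gauge 4 7 6 7 23],
     [eqn 0 5 6 1, eqn 2 3 8 1, eqn 2 4 7 1, eqn 2 7 8 2, eqn 6 7 8 6, eqn 2 5 8 4, eqn 3 5 8 2,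
     eqn 4 7 8 4, eqn 5 6 7 9, eqn 5 6 8 10, eqn 5 7 10 6, eqn 5 8 9 6, eqn 7 7 8 7, eqn 7 8 8 8,
     eqn 0 7 10 1]),
    ([unit_gauge 5 6 15 2 15, unit_gauge 2 4 4 4 19, unit_gauge 0 6 2 6 20, unit_gauge 5 6 11 5 21, unit_gauge 5 6 12 2 12, unit_gauge 1 5 2 1 6, unit_gauge 4 9 6 9 23, unit_gauge 8 9 11 8 25, unit_gauge 2 7 7 7 24, unit_gauge 2 10 10 10 22, unit_gauge 2 3 3 3 18, ((2,6,6), [((10,22),18), ((3,18),3), ((2,11),-3), ((5,21),8), ((1,6),12), ((4,19),3), ((6,20),-4), ((0,5),6), ((9,23),-18), ((2,12),-3)])],
     [eqn 0 5 6 0, eqn 1 5 6 1, eqn 2 4 9 1, eqn 2 8 9 2, eqn 2 4 7 0, eqn 2 7 10 2, eqn 2 3 8 0,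
     eqn 2 3 10 1, eqn 2 5 6 2, eqn 3 5 6 3, eqn 5 6 7 7, eqn 5 6 9 9, eqn 2 5 9 3, eqn 2 6 7 3,
     eqn 3 7 10 3, eqn 3 8 9 3, eqn 4 7 9 3, eqn 4 7 10 4, eqn 4 8 9 4, eqn 5 8 9 5, eqn 6 7 10
     6, eqn 6 8 9 6, eqn 5 6 8 8, eqn 7 8 9 7, eqn 7 8 10 8, eqn 7 9 10 9, eqn 3 4 5 0, eqn 3 4 6
     1, eqn 2 5 10 4]),
    ([unit_gauge 1 2 0 2 13, unit_gauge 2 6 5 6 21, ((1,6,2), [((6,21),1), ((2,13),1), ((1,5),1)]), unit_gauge 3 10 5 10 25, unit_gauge 4 9 5 9 24],
     [eqn 1 5 6 0, eqn 2 3 10 0, eqn 2 4 9 0, eqn 2 9 10 2, eqn 5 9 10 5, eqn 2 6 10 4, eqn 3 6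
     10 2, eqn 4 9 10 4, eqn 5 6 9 7, eqn 5 6 10 8, eqn 6 7 10 5, eqn 6 8 9 5, eqn 9 9 10 9, eqn
     9 10 10 10, eqn 1 8 9 0])]"

lemma gauge_2e: "gauge_ok (row1 False) (coords1 2 False) cert2_2e"
  by code_simp

text \<open>The three extra coordinates have sp(2)-weight 0 and sl(2)-weights -2, 0, 2; they start
  the propagation in the last three blocks of the certificate. A normalised cocycle is thus
  determined by three numbers, so the cohomology has dimension at most three.\<close>

lemma cover_2e: "cover_ok (row2 False) (coords2 2 False) [(5, 8, 19), (3, 6, 9), (6, 10, 19)] cert2_2e"
  by code_simp

section \<open>The cohomology in degree 2\<close>

text \<open>The lists \<open>canon11\<close>, \<open>canon12\<close>, \<open>canon22\<close> are
  what the formulas of the theorem give for a symmetric latin tensor s whose only nonzero entries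
  are s_11 = 1, s_12 = s_21 = 1 or s_22 = 1. The sl(2) and sp(2) components are read off from their
  action on e_c and eps_gamma.\<close>

definition canon11 :: "((nat \<times> nat \<times> nat) \<times> int) list" where
  "canon11 =
     [((0,7,3),-2), ((0,8,4),-2), ((3,5,9),1), ((4,5,10),1), ((5,7,18),-1), ((5,8,19),-1),
     ((7,7,16),4), ((7,8,15),-2), ((7,10,14),-2), ((8,8,17),-4), ((8,9,14),2)]"

definition canon12 :: "((nat \<times> nat \<times> nat) \<times> int) list" where
  "canon12 =
     [((0,9,3),-2), ((0,10,4),-2), ((1,7,3),-2), ((1,8,4),-2), ((3,5,7),-1), ((3,6,9),1),
     ((4,5,8),-1), ((4,6,10),1), ((5,9,18),-1), ((5,10,19),-1), ((6,7,18),-1), ((6,8,19),-1),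
     ((7,9,16),4), ((7,10,12),2), ((7,10,15),-2), ((8,9,12),-2), ((8,9,15),-2), ((8,10,17),-4)]"

definition canon22 :: "((nat \<times> nat \<times> nat) \<times> int) list" where
  "canon22 =
     [((1,9,3),-2), ((1,10,4),-2), ((3,6,7),-1), ((4,6,8),-1), ((6,9,18),-1), ((6,10,19),-1),
     ((7,10,13),2), ((8,9,13),-2), ((9,9,16),4), ((9,10,15),-2), ((10,10,17),-4)]"

definition skew_ext :: "((nat \<times> nat \<times> nat) \<times> int) list \<Rightarrow> nat \<Rightarrow> nat \<Rightarrow> g3vec" where
  "skew_ext L i j k = (if i \<le> j then vec L (i, j, k)
     else (if par i \<and> par j then 1 else -1) * vec L (j, i, k))"

text \<open>24 times the action of b_m on a cochain. As b_m is even no Koszul signs occur; the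
  constant arguments of \<open>sg\<close> give the three terms the shape required by
  \<open>ev_skew_terms\<close>.\<close>

definition act_row :: "nat \<Rightarrow> nat \<times> nat \<times> nat \<Rightarrow> ((nat \<times> nat \<times> nat) \<times> int) list" where
  "act_row m = (\<lambda>(i, j, k).
       concat (map (\<lambda>(t, c). skew_term i j t (sg False c)) (ad m k))
     @ concat (map (\<lambda>(t, c). skew_term t j k (sg True c)) (brm m i))
     @ concat (map (\<lambda>(t, c). skew_term i t k (sg True c)) (brm m j)))"

text \<open>Only targets k of the right degree and parity are evaluated; elsewhere the differential
  vanishes by homogeneity, see \<open>ce_d2_graded\<close>. Each row is computed once and tested
  against all cochains.\<close>

definition cocycles_ok :: "((nat \<times> nat \<times> nat) \<times> int) list list \<Rightarrow> bool" where
  "cocycles_ok Ls \<longleftrightarrow> (let C = coords2 2 False in list_all (list_all (\<lambda>(x, c). x \<in> set C)) Ls)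
     \<and> list_all (\<lambda>i. list_all (\<lambda>j. list_all (\<lambda>l. list_all (\<lambda>k.
         let r = row2 False (i, j, l, k) in list_all (\<lambda>L. dot r L = 0) Ls)
         (basis (deg i + deg j + deg l + 2) ((par i \<noteq> par j) \<noteq> par l))) [0..<11]) [0..<11]) [0..<11]"

definition act_ok :: "nat \<Rightarrow> ((nat \<times> nat \<times> nat) \<times> int) list \<Rightarrow> int \<Rightarrow> ((nat \<times> nat \<times> nat) \<times> int) list \<Rightarrow> bool" where
  "act_ok m L a L' \<longleftrightarrow> list_all (\<lambda>i. list_all (\<lambda>j. list_all (\<lambda>k.
       dot (act_row m (i, j, k)) L = 24 * a * dot (skew_term i j k 1) L')
         (basis (deg i + deg j + 2) (par i \<noteq> par j))) [0..<11]) [0..<11]"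

section \<open>Evaluating the differential and the action on sparse cochains\<close>

lemma bracket_coeff:
  assumes "i \<in> acting" "j \<in> G3M"
  shows "gbr (bv i) (bv j) = (\<lambda>k. ev (\<lambda>t. bv t k) (brm i j) / 24)"
proof
  fix k
  have "ev (\<lambda>t. bv t k) (brm i j) / 24 = (\<Sum>t\<in>G3M. gbr (bv i) (bv j) t * bv t k)"
    using brm_sum[OF assms] by simp
  also have "\<dots> = (\<Sum>t\<in>G3M. if t = k then gbr (bv i) (bv j) k else 0)"
    by (rule sum.cong) (auto simp: bv_def)
  also have "\<dots> = gbr (bv i) (bv j) k"
    using bracket_outside[OF assms] by (simp add: G3M_def)
  finally show "gbr (bv i) (bv j) k = ev (\<lambda>t. bv t k) (brm i j) / 24" ..
qed

lemma ce_d2_graded: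
  assumes phi: "is_cochain2 d (of_bool p) phi" and ijl: "i \<in> G3M" "j \<in> G3M" "l \<in> G3M"
    and nz: "ce_d2 (of_bool p) phi i j l k \<noteq> 0"
  shows "k \<in> set (basis (deg i + deg j + deg l + d) (((par i \<noteq> par j) \<noteq> par l) \<noteq> p))"
proof -
  have phi0: "phi a b t \<noteq> 0 \<Longrightarrow> t < 31 \<and> deg t = deg a + deg b + d \<and> par t = ((par a \<noteq> par b) \<noteq> p)" for a b t
    using phi unfolding is_cochain2_iff by blast
  have A: "k < 31 \<and> deg k = deg a + deg b + deg c + d \<and> par k = (((par a \<noteq> par b) \<noteq> par c) \<noteq> p)"
    if gz: "gbr (bv a) (phi b c) k \<noteq> 0" and a: "a \<in> G3M" for a b c
  proof -
    obtain t where "phi b c t \<noteq> 0" "k < 31" "deg k = deg a + deg t" "par k = (par a \<noteq> par t)"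
      using gbr_bv_nonzero[OF G3M_acting(2)[OF a] gz] by blast
    then show ?thesis using phi0 by auto
  qed
  have B: "k < 31 \<and> deg k = deg a + deg b + deg c + d \<and> par k = (((par a \<noteq> par b) \<noteq> par c) \<noteq> p)"
    if az: "apply2 phi (gbr (bv a) (bv b)) (bv c) k \<noteq> 0" and abc: "a \<in> G3M" "b \<in> G3M" "c \<in> G3M" for a b c
  proof -
    obtain t where "gbr (bv a) (bv b) t * phi t c k \<noteq> 0"
      using az unfolding apply2_bv_right[OF abc(3)] by (meson sum.not_neutral_contains_not_neutral)
    then have "g3sc a b t \<noteq> 0" "phi t c k \<noteq> 0" using abc G3M_acting(2) by (auto simp: gbr_bv_bv)
    then show ?thesis using phi0 g3sc_graded[of a b t] by auto
  qed
  have "gbr (bv i) (phi j l) k \<noteq> 0 \<or> gbr (bv j) (phi i l) k \<noteq> 0 \<or> gbr (bv l) (phi i j) k \<noteq> 0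
      \<or> apply2 phi (gbr (bv i) (bv j)) (bv l) k \<noteq> 0 \<or> apply2 phi (gbr (bv i) (bv l)) (bv j) k \<noteq> 0
      \<or> apply2 phi (gbr (bv j) (bv l)) (bv i) k \<noteq> 0"
    using nz unfolding ce_d2_eq[OF ijl] by auto
  then show ?thesis
    unfolding basis_iff
    using A[of i j l] A[of j i l] A[of l i j] B[of i j l] B[of i l j] B[of j l i] ijl
    by (elim disjE) auto
qed

lemma skew_term_sorted: "(x, e) \<in> set (skew_term i j k c) \<Longrightarrow> (case x of (a, b, t) \<Rightarrow> a \<le> b)"
  by (auto simp: skew_term_def split: if_splits)

lemma row2_sorted: "((a, b, t), e) \<in> set (row2 p q) \<Longrightarrow> a \<le> b"
  by (cases q) (force simp: row2_def Let_def dest: skew_term_sorted split: if_splits)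

lemma act_row_sorted: "((a, b, t), e) \<in> set (act_row m q) \<Longrightarrow> a \<le> b"
  by (cases q) (force simp: act_row_def dest: skew_term_sorted)

text \<open>On ordered arguments the skew extension is the sparse vector itself, so that its values
  on a row are integer scalar products.\<close>

lemma ev_skew_ext:
  assumes "\<And>a b t e. ((a, b, t), e) \<in> set r \<Longrightarrow> a \<le> b"
  shows "ev (\<lambda>(i, j, k). skew_ext L i j k) r = of_int (dot r L)"
  unfolding ev_vec[symmetric]
  by (rule ev_cong) (use assms in \<open>auto simp: skew_ext_def\<close>)

lemma skew_ext_cochain:
  assumes "list_all (\<lambda>(x, c). x \<in> set (coords2 2 False)) L"
  shows "is_cochain2 2 (of_bool False) (skew_ext L)"
proof -
  have c2: "i \<in> G3M \<and> j \<in> G3M \<and> (i < j \<or> i = j \<and> par i) \<and> k < 31 \<and> deg k = deg i + deg j + 2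
      \<and> par k = (par i \<noteq> par j)" if "vec L (i, j, k) \<noteq> 0" for i j k
  proof -
    have "(i, j, k) \<in> set (coords2 2 False)"
      using vec_support[OF that] assms by (auto simp: list_all_iff)
    then show ?thesis
      by (auto simp: coords2_def basis_iff G3M_def split: if_splits)
  qed
  have "skew2 (skew_ext L)"
    unfolding skew2_def
  proof (intro ballI allI)
    fix i j k
    show "skew_ext L j i k = (if par i \<and> par j then 1 else -1) * skew_ext L i j k"
    proof (cases i j rule: linorder_cases)
      case equal
      then show ?thesis using c2[of i i k] by (cases "par i") (auto simp: skew_ext_def)
    qed (auto simp: skew_ext_def)
  qed
  moreover have "i \<in> G3M \<and> j \<in> G3M \<and> k < 31 \<and> deg k = deg i + deg j + 2 \<and> par k = ((par i \<noteq> par j) \<noteq> False)"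
    if "skew_ext L i j k \<noteq> 0" for i j k
    using that c2[of i j k] c2[of j i k] by (auto simp: skew_ext_def split: if_splits)
  ultimately show ?thesis unfolding is_cochain2_iff by blast
qed

lemma skew_ext_cocycle:
  assumes "cocycles_ok Ls" "L \<in> set Ls"
  shows "cocycle2 2 (of_bool False) (skew_ext L)"
proof -
  have c: "is_cochain2 2 (of_bool False) (skew_ext L)"
    using assms skew_ext_cochain unfolding cocycles_ok_def Let_def list_all_iff[of _ Ls] by blast
  then have sk: "skew2 (skew_ext L)" by (simp only: is_cochain2_iff)
  have "ce_d2 (of_bool False) (skew_ext L) i j l k = 0" if ijl: "i \<in> G3M" "j \<in> G3M" "l \<in> G3M" for i j l k
  proof (rule ccontr)
    assume nz: "ce_d2 (of_bool False) (skew_ext L) i j l k \<noteq> 0"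
    have "k \<in> set (basis (deg i + deg j + deg l + 2) ((par i \<noteq> par j) \<noteq> par l))"
      using ce_d2_graded[OF c ijl nz] by simp
    then have "dot (row2 False (i, j, l, k)) L = 0"
      using assms ijl unfolding cocycles_ok_def Let_def list_all_iff G3M_def by auto
    then have "ev (\<lambda>(i, j, k). skew_ext L i j k) (row2 False (i, j, l, k)) = 0"
      using ev_skew_ext[of "row2 False (i, j, l, k)" L] row2_sorted by simp
    then show False using nz unfolding ce_d2_row[OF sk ijl] by simp
  qed
  then show ?thesis unfolding cocycle2_def using c by blast
qed

lemma act_C2_row:
  assumes "skew2 phi" "m \<in> {12..<18}" "i \<in> G3M" "j \<in> G3M"
  shows "act_C2 (bv m) phi i j k = ev (\<lambda>(i, j, k). phi i j k) (act_row m (i, j, k)) / 24"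
proof -
  have m: "m \<in> acting" using assms(2) by (simp add: acting_def)
  have a: "ev (\<lambda>(i, j, k). phi i j k) (concat (map (\<lambda>(t, c). skew_term i j t (sg False c)) (ad m k)))
      = ev (phi i j) (ad m k)"
    by (subst ev_skew_terms[OF assms(1), of "ad m k" "\<lambda>_. i" "\<lambda>_. j" "\<lambda>t. t" False]) (use assms in auto)
  have b: "ev (\<lambda>(i, j, k). phi i j k) (concat (map (\<lambda>(t, c). skew_term t j k (sg True c)) (brm m i)))
      = - ev (\<lambda>t. phi t j k) (brm m i)"
    by (subst ev_skew_terms[OF assms(1), of "brm m i" "\<lambda>t. t" "\<lambda>_. j" "\<lambda>_. k" True])
      (use assms bracket_in[OF m] in auto)
  have c: "ev (\<lambda>(i, j, k). phi i j k) (concat (map (\<lambda>(t, c). skew_term i t k (sg True c)) (brm m j)))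
      = - ev (\<lambda>t. phi i t k) (brm m j)"
    by (subst ev_skew_terms[OF assms(1), of "brm m j" "\<lambda>_. i" "\<lambda>t. t" "\<lambda>_. k" True])
      (use assms bracket_in[OF m] in auto)
  have "apply2 phi (bv i) u k = (\<Sum>t\<in>G3M. u t * phi i t k)" for u
  proof -
    have "apply2 phi (bv i) u k = (\<Sum>s\<in>G3M. if s = i then (\<Sum>t\<in>G3M. u t * phi i t k) else 0)"
      unfolding apply2_def by (rule sum.cong) (auto simp: bv_def)
    then show ?thesis using assms(3) by (simp add: G3M_def)
  qed
  then have "apply2 phi (bv i) (gbr (bv m) (bv j)) k = ev (\<lambda>t. phi i t k) (brm m j) / 24"
    using brm_sum[OF m assms(4)] by simp
  then show ?thesis
    unfolding act_C2_def act_row_def prod.case ev_simps a b c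
    by (simp add: gbr_bv[OF m] apply2_bracket[OF m assms(3,4)] diff_divide_distrib)
qed

lemma act_C2_graded:
  assumes phi: "is_cochain2 d (of_bool p) phi" and "m \<in> {12..<18}" "i \<in> G3M" "j \<in> G3M"
    and nz: "act_C2 (bv m) phi i j k \<noteq> 0"
  shows "k \<in> set (basis (deg i + deg j + d) ((par i \<noteq> par j) \<noteq> p))"
proof -
  have m: "m < 31" "deg m = 0" "\<not> par m" using assms(2) by (auto simp: deg_def par_def)
  have phi0: "phi a b t \<noteq> 0 \<Longrightarrow> t < 31 \<and> deg t = deg a + deg b + d \<and> par t = ((par a \<noteq> par b) \<noteq> p)" for a b t
    using phi unfolding is_cochain2_iff by blast
  have "gbr (bv m) (phi i j) k \<noteq> 0 \<or> apply2 phi (gbr (bv m) (bv i)) (bv j) k \<noteq> 0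
      \<or> apply2 phi (bv i) (gbr (bv m) (bv j)) k \<noteq> 0"
    using nz unfolding act_C2_def by auto
  then show ?thesis
    unfolding basis_iff
  proof (elim disjE)
    assume "gbr (bv m) (phi i j) k \<noteq> 0"
    then obtain t where "phi i j t \<noteq> 0" "k < 31" "deg k = deg m + deg t" "par k = (par m \<noteq> par t)"
      using gbr_bv_nonzero[OF m(1)] by blast
    then show "k < 31 \<and> deg k = deg i + deg j + d \<and> par k = ((par i \<noteq> par j) \<noteq> p)"
      using phi0 m by auto
  next
    assume "apply2 phi (gbr (bv m) (bv i)) (bv j) k \<noteq> 0"
    then have "(\<Sum>t\<in>G3M. gbr (bv m) (bv i) t * phi t j k) \<noteq> 0"
      unfolding apply2_bv_right[OF assms(4)] .
    then obtain t where "gbr (bv m) (bv i) t * phi t j k \<noteq> 0"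
      by (meson sum.not_neutral_contains_not_neutral)
    then have "g3sc m i t \<noteq> 0" "phi t j k \<noteq> 0" using m assms(3) G3M_acting(2) by (auto simp: gbr_bv_bv)
    then show "k < 31 \<and> deg k = deg i + deg j + d \<and> par k = ((par i \<noteq> par j) \<noteq> p)"
      using phi0 g3sc_graded[of m i t] m by auto
  next
    assume "apply2 phi (bv i) (gbr (bv m) (bv j)) k \<noteq> 0"
    then obtain s t where "bv i s * gbr (bv m) (bv j) t * phi s t k \<noteq> 0"
      unfolding apply2_def by (meson sum.not_neutral_contains_not_neutral)
    then have "gbr (bv m) (bv j) t \<noteq> 0" "phi i t k \<noteq> 0"
      by (auto simp: bv_def[of i] split: if_splits)
    then have "g3sc m j t \<noteq> 0" "phi i t k \<noteq> 0"
      using m assms(4) G3M_acting(2) by (auto simp: gbr_bv_bv)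
    then show "k < 31 \<and> deg k = deg i + deg j + d \<and> par k = ((par i \<noteq> par j) \<noteq> p)"
      using phi0 g3sc_graded[of m j t] m by auto
  qed
qed

lemma skew_term_one_sorted: "((a, b, t), e) \<in> set (skew_term i j k 1) \<Longrightarrow> a \<le> b"
  by (auto simp: skew_term_def split: if_splits)

lemma act_ok_sound:
  assumes "cocycle2 2 (of_bool False) (skew_ext L)" "cocycle2 2 (of_bool False) (skew_ext L')" "act_ok m L a L'" "m \<in> {12..<18}" "i \<in> G3M" "j \<in> G3M"
  shows "act_C2 (bv m) (skew_ext L) i j k = of_int a * skew_ext L' i j k"
proof (cases "k \<in> set (basis (deg i + deg j + 2) (par i \<noteq> par j))")
  case True
  have sk: "skew2 (skew_ext L)" "skew2 (skew_ext L')"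
    using assms(1,2) unfolding cocycle2_def is_cochain2_iff by blast+
  have "dot (act_row m (i, j, k)) L = 24 * a * dot (skew_term i j k 1) L'"
    using assms(3,5,6) True unfolding act_ok_def list_all_iff G3M_def by auto
  then have "(of_int (dot (act_row m (i, j, k)) L) :: complex) = 24 * of_int a * of_int (dot (skew_term i j k 1) L')"
    by simp
  moreover have "of_int (dot (skew_term i j k 1) L') = skew_ext L' i j k"
    using ev_skew_ext[of "skew_term i j k 1" L'] skew_term_one_sorted ev_skew_term[OF sk(2) assms(5,6), of k 1]
    by simp
  moreover have "act_C2 (bv m) (skew_ext L) i j k = of_int (dot (act_row m (i, j, k)) L) / 24"
    unfolding act_C2_row[OF sk(1) assms(4-6)]
    using ev_skew_ext[of "act_row m (i, j, k)" L] act_row_sorted by simp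
  ultimately show ?thesis by simp
next
  case False
  have c: "is_cochain2 2 (of_bool False) (skew_ext L)" "is_cochain2 2 (of_bool False) (skew_ext L')"
    using assms(1,2) unfolding cocycle2_def by blast+
  have "act_C2 (bv m) (skew_ext L) i j k = 0"
    using act_C2_graded[OF c(1) assms(4-6), of k] False by auto
  moreover have "skew_ext L' i j k = 0"
  proof (rule ccontr)
    assume "skew_ext L' i j k \<noteq> 0"
    then have "k < 31 \<and> deg k = deg i + deg j + 2 \<and> par k = ((par i \<noteq> par j) \<noteq> False)"
      using c(2) unfolding is_cochain2_iff by blast
    then show False using False by (simp add: basis_iff)
  qed
  ultimately show ?thesis by simp
qed

lemma cocycles_ok_canon: "cocycles_ok [canon11, canon12, canon22]"
  by code_simp

lemma canon_cocycles:
  "cocycle2 2 (of_bool False) (skew_ext canon11)"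
  "cocycle2 2 (of_bool False) (skew_ext canon12)"
  "cocycle2 2 (of_bool False) (skew_ext canon22)"
  by (rule skew_ext_cocycle[OF cocycles_ok_canon]; simp)+

text \<open>The canonical cochains span the three-dimensional irreducible sl(2)-module, as weight
  vectors of weights -2, 0, 2, and sp(2) acts by zero. A coefficient 0 records that the image is
  zero.\<close>

lemma act_ok_canon:
  "act_ok 12 canon11 (-2) canon11" "act_ok 12 canon12 (0) canon12" "act_ok 12 canon22 (2) canon22"
  "act_ok 13 canon11 (-1) canon12" "act_ok 13 canon12 (-2) canon22" "act_ok 13 canon22 (0) canon22"
  "act_ok 14 canon11 (0) canon11" "act_ok 14 canon12 (-2) canon11" "act_ok 14 canon22 (-1) canon12"
  "act_ok 15 canon11 (0) canon11" "act_ok 15 canon12 (0) canon12" "act_ok 15 canon22 (0) canon22"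
  "act_ok 16 canon11 (0) canon11" "act_ok 16 canon12 (0) canon12" "act_ok 16 canon22 (0) canon22"
  "act_ok 17 canon11 (0) canon11" "act_ok 17 canon12 (0) canon12" "act_ok 17 canon22 (0) canon22"
  by code_simp+

text \<open>The gauge coordinates lie off the support of the canonical cocycles. Subtracting a
  canonical cocycle therefore preserves the normalisation, and \<open>cover_2e\<close> applies to
  the difference.\<close>

lemma canon_gauge:
  "list_all (\<lambda>((i, j, k), l). i \<le> j \<and> lookup canon11 (i, j, k) = 0 \<and> lookup canon12 (i, j, k) = 0
     \<and> lookup canon22 (i, j, k) = 0) (gauge cert2_2e)"
  by code_simp

text \<open>The following combinations of coordinates, of sl(2)-weights -2, 0 and 2, vanish on coboundaries; the
  canonical cocycles are not annihilated by them, so they are independent in cohomology.\<close>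

lemma functional11: "collect (comb_row (row1 False) [(8, 5, 7, 18), (-16, 3, 5, 9), (1, 7, 7, 16)]) = []"
  by code_simp

lemma functional12: "collect (comb_row (row1 False)
    [(4, 1, 8, 4), (8, 1, 5, 2), (12, 3, 10, 6), (24, 3, 5, 7), (-3, 8, 10, 17)]) = []"
  by code_simp

lemma functional22: "collect (comb_row (row1 False) [(8, 6, 10, 19), (16, 3, 6, 7), (-1, 10, 10, 17)]) = []"
  by code_simp

text \<open>A symmetric tensor is given by its components \<open>s = (s_11, s_12, s_22)\<close> with lowered indices;
  \<open>canon s\<close> is the canonical cochain whose lowered first component is \<open>s_ab \<omega>_\<beta>\<gamma>\<close>.\<close>

definition low :: "(nat \<Rightarrow> nat \<Rightarrow> nat \<Rightarrow> nat \<Rightarrow> complex) \<Rightarrow> complex \<times> complex \<times> complex" where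
  "low t = (t 2 2 1 2, - t 1 2 1 2, t 1 1 1 2)"

definition canon :: "complex \<times> complex \<times> complex \<Rightarrow> nat \<Rightarrow> nat \<Rightarrow> g3vec" where
  "canon s = (\<lambda>i j k. fst s * skew_ext canon11 i j k + fst (snd s) * skew_ext canon12 i j k
     + snd (snd s) * skew_ext canon22 i j k)"

lemma canon_cocycle: "cocycle2 2 0 (canon s)"
proof -
  note c = canon_cocycles
  have "cocycle2 2 (of_bool False) (canon s)"
    using cocycle2_lin[OF cocycle2_lin[OF c(1,2), of "fst s" "fst (snd s)"] c(3), of 1 "snd (snd s)"]
    by (simp add: canon_def)
  then show ?thesis by simp
qed

section \<open>The action of sl(2) + sp(2) on canonical cocycles and on tensors\<close>

lemma gbr_acting_expand:
  assumes "in_sl2sp2 X"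
  shows "gbr X v k = (\<Sum>m\<in>{12..<18}. X m * gbr (bv m) v k)"
  unfolding gbr_expand[of X]
  by (rule sum.mono_neutral_right)
    (use assms in \<open>auto simp: G3B_def in_sl2sp2_def sl2_idx_def sp2_idx_def less_Suc_eq numeral_eq_Suc\<close>)

lemma sum_12_18: "(\<Sum>m\<in>{12..<18::nat}. f m) = f 12 + f 13 + f 14 + f 15 + f 16 + (f 17 :: complex)"
  by (simp add: numeral_eq_Suc sum.atLeastLessThan_Suc)

lemma apply2_sum_left: "apply2 phi (\<lambda>t. \<Sum>m\<in>A. x m * u m t) w k = (\<Sum>m\<in>A. x m * apply2 phi (u m) w k)"
proof -
  have "apply2 phi (\<lambda>t. \<Sum>m\<in>A. x m * u m t) w k
      = (\<Sum>i\<in>G3M. \<Sum>m\<in>A. \<Sum>j\<in>G3M. x m * (u m i * w j * phi i j k))"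
    unfolding apply2_def sum_distrib_left sum_distrib_right
    by (subst sum.swap[of _ A]) (simp add: mult_ac)
  also have "\<dots> = (\<Sum>m\<in>A. \<Sum>i\<in>G3M. \<Sum>j\<in>G3M. x m * (u m i * w j * phi i j k))"
    by (rule sum.swap)
  finally show ?thesis by (simp add: apply2_def sum_distrib_left)
qed

lemma apply2_sum_right: "apply2 phi w (\<lambda>t. \<Sum>m\<in>A. x m * u m t) k = (\<Sum>m\<in>A. x m * apply2 phi w (u m) k)"
proof -
  have "apply2 phi w (\<lambda>t. \<Sum>m\<in>A. x m * u m t) k
      = (\<Sum>i\<in>G3M. \<Sum>m\<in>A. \<Sum>j\<in>G3M. x m * (w i * u m j * phi i j k))"
    unfolding apply2_def sum_distrib_left sum_distrib_right
    by (subst sum.swap[of _ A]) (simp add: mult_ac)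
  also have "\<dots> = (\<Sum>m\<in>A. \<Sum>i\<in>G3M. \<Sum>j\<in>G3M. x m * (w i * u m j * phi i j k))"
    by (rule sum.swap)
  finally show ?thesis by (simp add: apply2_def sum_distrib_left)
qed

lemma act_C2_expand:
  assumes "in_sl2sp2 X"
  shows "act_C2 X phi i j k = (\<Sum>m\<in>{12..<18}. X m * act_C2 (bv m) phi i j k)"
proof -
  have X: "gbr X v = (\<lambda>k. \<Sum>m\<in>{12..<18}. X m * gbr (bv m) v k)" for v
    using gbr_acting_expand[OF assms] by blast
  show ?thesis
    unfolding act_C2_def X apply2_sum_left apply2_sum_right
    by (simp add: sum_subtractf right_diff_distrib)
qed

lemma act_C2_lin: "act_C2 X (\<lambda>i j k. a * f i j k + b * g i j k + c * h i j k) i j k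
    = a * act_C2 X f i j k + b * act_C2 X g i j k + c * act_C2 X h i j k"
proof -
  have 1: "apply2 (\<lambda>i j k. a * f i j k + b * g i j k + c * h i j k) u w k
      = a * apply2 f u w k + b * apply2 g u w k + c * apply2 h u w k" for u w
    unfolding apply2_def by (simp add: sum.distrib sum_distrib_left algebra_simps)
  have 2: "gbr X (\<lambda>k. a * f i j k + b * g i j k + c * h i j k) k
      = a * gbr X (f i j) k + b * gbr X (g i j) k + c * gbr X (h i j) k"
    unfolding gbr_def by (simp add: sum.distrib sum_distrib_left algebra_simps)
  show ?thesis unfolding act_C2_def 1 2 by (simp add: algebra_simps)
qed

lemma act_C2_canon:
  assumes X: "in_sl2sp2 X" and ij: "i \<in> G3M" "j \<in> G3M"
  shows "act_C2 X (canon (a, b, c)) i j k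
       = canon (-2 * X 12 * a - 2 * X 14 * b, - X 13 * a - X 14 * c, 2 * X 12 * c - 2 * X 13 * b) i j k"
proof -
  note act =
    act_ok_sound[OF canon_cocycles(1) canon_cocycles(1) act_ok_canon(1) _ ij]
    act_ok_sound[OF canon_cocycles(2) canon_cocycles(2) act_ok_canon(2) _ ij]
    act_ok_sound[OF canon_cocycles(3) canon_cocycles(3) act_ok_canon(3) _ ij]
    act_ok_sound[OF canon_cocycles(1) canon_cocycles(2) act_ok_canon(4) _ ij]
    act_ok_sound[OF canon_cocycles(2) canon_cocycles(3) act_ok_canon(5) _ ij]
    act_ok_sound[OF canon_cocycles(3) canon_cocycles(3) act_ok_canon(6) _ ij]
    act_ok_sound[OF canon_cocycles(1) canon_cocycles(1) act_ok_canon(7) _ ij]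
    act_ok_sound[OF canon_cocycles(2) canon_cocycles(1) act_ok_canon(8) _ ij]
    act_ok_sound[OF canon_cocycles(3) canon_cocycles(2) act_ok_canon(9) _ ij]
    act_ok_sound[OF canon_cocycles(1) canon_cocycles(1) act_ok_canon(10) _ ij]
    act_ok_sound[OF canon_cocycles(2) canon_cocycles(2) act_ok_canon(11) _ ij]
    act_ok_sound[OF canon_cocycles(3) canon_cocycles(3) act_ok_canon(12) _ ij]
    act_ok_sound[OF canon_cocycles(1) canon_cocycles(1) act_ok_canon(13) _ ij]
    act_ok_sound[OF canon_cocycles(2) canon_cocycles(2) act_ok_canon(14) _ ij]
    act_ok_sound[OF canon_cocycles(3) canon_cocycles(3) act_ok_canon(15) _ ij]
    act_ok_sound[OF canon_cocycles(1) canon_cocycles(1) act_ok_canon(16) _ ij]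
    act_ok_sound[OF canon_cocycles(2) canon_cocycles(2) act_ok_canon(17) _ ij]
    act_ok_sound[OF canon_cocycles(3) canon_cocycles(3) act_ok_canon(18) _ ij]
  show ?thesis
    unfolding act_C2_expand[OF X] sum_12_18 canon_def fst_conv snd_conv act_C2_lin
    by (simp add: act algebra_simps)
qed

lemma gbr_acting:
  assumes "in_sl2sp2 X"
  shows "gbr X (bv 5) = (\<lambda>k. X 12 * bv 5 k + X 14 * bv 6 k)"
    and "gbr X (bv 6) = (\<lambda>k. X 13 * bv 5 k - X 12 * bv 6 k)"
    and "gbr X (bv 3) = (\<lambda>k. X 15 * bv 3 k + X 17 * bv 4 k)"
    and "gbr X (bv 4) = (\<lambda>k. X 16 * bv 3 k - X 15 * bv 4 k)"
  by (simp_all add: fun_eq_iff gbr_acting_expand[OF assms] sum_12_18 bracket_coeff acting_def G3M_def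
      brm_def row_def)

text \<open>The triple is the one in \<open>act_C2_canon\<close>, so tensors and canonical cocycles
  transform alike. The sp(2) part of X drops out because traceless matrices act by zero on Lambda^2
  C^2.\<close>

lemma low_act_T:
  assumes X: "in_sl2sp2 X" and t: "t \<in> S2L2" and s: "low t = (a, b, c)"
  shows "low (act_T X t) = (-2 * X 12 * a - 2 * X 14 * b, - X 13 * a - X 14 * c, 2 * X 12 * c - 2 * X 13 * b)"
proof -
  \<comment> \<open>These relations reduce every component that occurs to the three recorded by
    \<open>low\<close>.\<close>
  have "t 2 1 1 2 = t 1 2 1 2" "t x y 1 1 = 0" "t x y 2 2 = 0" for x y
  proof -
    have sym: "t x y be ga = t y x be ga" and skew: "t x y be ga = - t x y ga be" for x y be ga
      using t unfolding S2L2_def by blast+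
    show "t 2 1 1 2 = t 1 2 1 2" by (rule sym)
    have "2 * t x y be be = 0" for be
      using skew[of x y be be] by (metis add.right_inverse mult_2)
    then show "t x y 1 1 = 0" "t x y 2 2 = 0" by simp_all
  qed
  moreover have bv: "bv i k = (if k = i then 1 else 0)" for i k by (simp add: bv_def)
  have "rho1 X 1 1 = X 12" "rho1 X 1 2 = X 13" "rho1 X 2 1 = X 14" "rho1 X 2 2 = - X 12"
    "rho2 X 1 1 = X 15" "rho2 X 1 2 = X 16" "rho2 X 2 1 = X 17" "rho2 X 2 2 = - X 15"
    by (simp_all add: rho1_def rho2_def ix_e_def ix_eps2_def gbr_acting[OF X] bv del: One_nat_def)
  ultimately show ?thesis
    using s by (auto simp: low_def act_T_def idx2_def algebra_simps simp del: One_nat_def)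
qed

section \<open>The canonical form\<close>

lemma canon_support:
  assumes "canon s i j k \<noteq> 0"
  shows "\<exists>c. ((i, j, k), c) \<in> set (canon11 @ canon12 @ canon22) \<or> ((j, i, k), c) \<in> set (canon11 @ canon12 @ canon22)"
proof -
  have "skew_ext canon11 i j k \<noteq> 0 \<or> skew_ext canon12 i j k \<noteq> 0 \<or> skew_ext canon22 i j k \<noteq> 0"
    using assms by (auto simp: canon_def)
  then have "\<exists>L\<in>{canon11, canon12, canon22}. vec L (i, j, k) \<noteq> 0 \<or> vec L (j, i, k) \<noteq> 0"
    by (auto simp: skew_ext_def split: if_splits)
  then show ?thesis using vec_support by fastforce
qed

text \<open>Indices 7 to 10 are the vectors eps_{a alpha}. The second conjunct allows the value on
  two of them to be split into its sl(2) and sp(2) coordinates.\<close>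

lemma canon_slots:
  "list_all (\<lambda>((i, j, k), c). (canon_slot i j k \<or> canon_slot j i k)
     \<and> (7 \<le> i \<and> i \<le> 10 \<and> 7 \<le> j \<and> j \<le> 10 \<longrightarrow> k \<in> sl2_idx \<union> sp2_idx)) (canon11 @ canon12 @ canon22)"
  by (simp add: canon11_def canon12_def canon22_def canon_slot_def idx2_def ix_e_def ix_eps1_def
      ix_eps0_def ix_eps2_def ix_f_def sl2_idx_def sp2_idx_def)

lemmas canon_eval = canon_def skew_ext_def vec_def canon11_def canon12_def canon22_def par_def

definition sym2 :: "complex \<times> complex \<times> complex \<Rightarrow> nat \<Rightarrow> nat \<Rightarrow> complex" where
  "sym2 s a b = (if a \<noteq> b then fst (snd s) else if a = 1 then fst s else snd (snd s))"

text \<open>The entries (1,1), (1,2), (2,1), in this order, of the matrix of e_c |-> 2 omega_{alpha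
  beta} (s_cb e_a - s_ca e_b), which is the sl(2) formula of the theorem with the first component
  expressed by s.\<close>

lemma canon_sl2:
  assumes "a \<in> idx2" "al \<in> idx2" "b \<in> idx2" "be \<in> idx2"
  shows "canon s (ix_eps1 a al) (ix_eps1 b be) 12
       = 2 * omega al be * ((if a = 1 then sym2 s 1 b else 0) - (if b = 1 then sym2 s 1 a else 0))"
    and "canon s (ix_eps1 a al) (ix_eps1 b be) 13
       = 2 * omega al be * ((if a = 1 then sym2 s 2 b else 0) - (if b = 1 then sym2 s 2 a else 0))"
    and "canon s (ix_eps1 a al) (ix_eps1 b be) 14
       = 2 * omega al be * ((if a = 2 then sym2 s 1 b else 0) - (if b = 2 then sym2 s 1 a else 0))"
  using assms unfolding idx2_def insert_iff empty_iff
  by (elim disjE; simp add: ix_eps1_def omega_def sym2_def canon_eval)+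

text \<open>Likewise the entries of the matrix of eps_gamma |-> 2 s_ab (omega_{alpha gamma} eps_beta
  + omega_{beta gamma} eps_alpha).\<close>

lemma canon_sp2:
  assumes "a \<in> idx2" "al \<in> idx2" "b \<in> idx2" "be \<in> idx2"
  shows "canon s (ix_eps1 a al) (ix_eps1 b be) 15
       = 2 * sym2 s a b * ((if be = 1 then omega al 1 else 0) + (if al = 1 then omega be 1 else 0))"
    and "canon s (ix_eps1 a al) (ix_eps1 b be) 16
       = 2 * sym2 s a b * ((if be = 1 then omega al 2 else 0) + (if al = 1 then omega be 2 else 0))"
    and "canon s (ix_eps1 a al) (ix_eps1 b be) 17
       = 2 * sym2 s a b * ((if be = 2 then omega al 1 else 0) + (if al = 2 then omega be 1 else 0))"
  using assms unfolding idx2_def insert_iff empty_iff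
  by (elim disjE; simp add: ix_eps1_def omega_def sym2_def canon_eval)+

lemma comp1_canon:
  assumes "a \<in> idx2" "b \<in> idx2" "be \<in> idx2" "ga \<in> idx2"
  shows "comp1 (canon s) a b be ga = (if be = ga then - sym2 s a b else 0)"
  using assms unfolding idx2_def insert_iff empty_iff
  by (elim disjE; simp add: comp1_def ix_e_def ix_eps1_def ix_eps0_def sym2_def canon_eval)

lemma comp4_canon:
  assumes "a \<in> idx2" "b \<in> idx2" "be \<in> idx2" "ga \<in> idx2"
  shows "comp4 (canon s) b be a ga = (if be = ga then 2 * sym2 s a b else 0)"
  using assms unfolding idx2_def insert_iff empty_iff
  by (elim disjE; simp add: comp4_def ix_eps2_def ix_eps1_def ix_f_def sym2_def canon_eval)

lemma comp3_canon:
  assumes "a \<in> idx2" "b \<in> idx2" "be \<in> idx2" "al \<in> idx2"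
  shows "comp3 (canon s) al a b be
       = (if al \<noteq> be then 0 else if b = 1 then - sym2 s a 2 else sym2 s a 1)"
  using assms unfolding idx2_def insert_iff empty_iff
  by (elim disjE; simp add: comp3_def ix_eps2_def ix_eps1_def ix_e_def sym2_def canon_eval)

lemma canonical_form_canon: "canonical_form (canon s)"
proof -
  let ?phi = "canon s"
  have sym: "sym2 s a b = sym2 s b a" and skew: "omega be ga = - omega ga be" for a b be ga
    by (auto simp: sym2_def omega_def)
  have slot: "canon_slot i j k \<or> canon_slot j i k" if "?phi i j k \<noteq> 0" for i j k
    using canon_support[OF that] canon_slots unfolding list_all_iff by fast
  have g0: "k \<in> sl2_idx \<union> sp2_idx" if "?phi i j k \<noteq> 0" "i \<in> {7..10}" "j \<in> {7..10}" for i j k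
    using canon_support[OF that(1)] canon_slots that(2,3) unfolding list_all_iff by fastforce
  have low: "low1 ?phi a b be ga = omega be ga * sym2 s a b"
    if "a \<in> idx2" "b \<in> idx2" "be \<in> idx2" "ga \<in> idx2" for a b be ga
    using that comp1_canon[OF that(1-3), of _ s] unfolding idx2_def insert_iff empty_iff
    by (elim disjE; simp add: low1_def idx2_def omega_def)
  have parts: "\<exists>X Y. in_span sl2_idx X \<and> in_span sp2_idx Y \<and>
        ?phi (ix_eps1 a al) (ix_eps1 b be) = (\<lambda>k. X k + Y k) \<and>
        (\<forall>c\<in>idx2. gbr X (bv (ix_e c)) =
            (\<lambda>k. -2 * low1 ?phi c b be al * bv (ix_e a) k - 2 * low1 ?phi c a al be * bv (ix_e b) k)) \<and>
        (\<forall>ga\<in>idx2. gbr Y (bv (ix_eps2 ga)) =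
            (\<lambda>k. \<Sum>de\<in>idx2. (-2 * omega al ga * comp1 ?phi a b be de
                              - 2 * omega be ga * comp1 ?phi b a al de) * bv (ix_eps2 de) k))"
    if i: "a \<in> idx2" "al \<in> idx2" "b \<in> idx2" "be \<in> idx2" for a al b be
  proof -
    define X where "X = (\<lambda>k. if k \<in> sl2_idx then ?phi (ix_eps1 a al) (ix_eps1 b be) k else 0)"
    define Y where "Y = (\<lambda>k. if k \<in> sp2_idx then ?phi (ix_eps1 a al) (ix_eps1 b be) k else 0)"
    have span: "in_span sl2_idx X" "in_span sp2_idx Y" by (auto simp: in_span_def X_def Y_def)
    then have sp: "in_sl2sp2 X" "in_sl2sp2 Y" by (auto simp: in_span_def in_sl2sp2_def)
    have X: "X 12 = ?phi (ix_eps1 a al) (ix_eps1 b be) 12" "X 13 = ?phi (ix_eps1 a al) (ix_eps1 b be) 13"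
      "X 14 = ?phi (ix_eps1 a al) (ix_eps1 b be) 14" by (simp_all add: X_def sl2_idx_def)
    have Y: "Y 15 = ?phi (ix_eps1 a al) (ix_eps1 b be) 15" "Y 16 = ?phi (ix_eps1 a al) (ix_eps1 b be) 16"
      "Y 17 = ?phi (ix_eps1 a al) (ix_eps1 b be) 17" by (simp_all add: Y_def sp2_idx_def)
    have "?phi (ix_eps1 a al) (ix_eps1 b be) = (\<lambda>k. X k + Y k)"
    proof
      fix k
      have "ix_eps1 a al \<in> {7..10}" "ix_eps1 b be \<in> {7..10}" using i by (auto simp: idx2_def ix_eps1_def)
      then show "?phi (ix_eps1 a al) (ix_eps1 b be) k = X k + Y k"
        using g0[of "ix_eps1 a al" "ix_eps1 b be" k]
        by (auto simp: X_def Y_def sl2_idx_def sp2_idx_def)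
    qed
    moreover have "gbr X (bv (ix_e c)) =
            (\<lambda>k. -2 * low1 ?phi c b be al * bv (ix_e a) k - 2 * low1 ?phi c a al be * bv (ix_e b) k)"
      if "c \<in> idx2" for c
      unfolding low[OF that i(3,4,2)] low[OF that i(1,2,4)]
      using i that X[unfolded canon_sl2[OF i]] unfolding idx2_def insert_iff empty_iff
      by (elim disjE; simp add: ix_e_def gbr_acting[OF sp(1)] fun_eq_iff omega_def sym2_def)
    moreover have "gbr Y (bv (ix_eps2 ga)) =
            (\<lambda>k. \<Sum>de\<in>idx2. (-2 * omega al ga * comp1 ?phi a b be de
                              - 2 * omega be ga * comp1 ?phi b a al de) * bv (ix_eps2 de) k)"
      if "ga \<in> idx2" for ga
    proof -
      \<comment> \<open>The first component is diagonal in its greek indices, by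
        \<open>comp1_canon\<close>, so only the summands with \<open>de = be\<close> and
        \<open>de = al\<close> contribute.\<close>
      have 1: "(\<Sum>de\<in>idx2. (-2 * omega al ga * comp1 ?phi a b be de
                - 2 * omega be ga * comp1 ?phi b a al de) * bv (ix_eps2 de) k)
        = (\<Sum>de\<in>idx2. (if de = be then 2 * omega al ga * sym2 s a b * bv (ix_eps2 de) k else 0)
                      + (if de = al then 2 * omega be ga * sym2 s b a * bv (ix_eps2 de) k else 0))" for k
        by (rule sum.cong) (auto simp: comp1_canon i algebra_simps)
      have 2: "(\<Sum>de\<in>idx2. (if de = be then 2 * omega al ga * sym2 s a b * bv (ix_eps2 de) k else 0)
                      + (if de = al then 2 * omega be ga * sym2 s b a * bv (ix_eps2 de) k else 0))
          = 2 * sym2 s a b * (omega al ga * bv (ix_eps2 be) k + omega be ga * bv (ix_eps2 al) k)" for k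
        using i sym[of b a] by (simp add: sum.distrib idx2_def algebra_simps)
      have rhs: "(\<lambda>k. \<Sum>de\<in>idx2. (-2 * omega al ga * comp1 ?phi a b be de
                - 2 * omega be ga * comp1 ?phi b a al de) * bv (ix_eps2 de) k)
        = (\<lambda>k. 2 * sym2 s a b * (omega al ga * bv (ix_eps2 be) k + omega be ga * bv (ix_eps2 al) k))"
        unfolding 1 2 ..
      have ix: "ix_eps2 1 = 3" "ix_eps2 2 = 4" by (simp_all add: ix_eps2_def)
      show ?thesis
        unfolding rhs
        using i(2,4) that Y[unfolded canon_sp2[OF i]] unfolding idx2_def insert_iff empty_iff
        by (elim disjE; simp add: ix gbr_acting[OF sp(2)] fun_eq_iff omega_def del: One_nat_def)
    qed
    ultimately show ?thesis using span by (intro exI[of _ X] exI[of _ Y]) blast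
  qed
  have low3: "low3 ?phi al a b be = omega be al * sym2 s a b"
    if "al \<in> idx2" "a \<in> idx2" "b \<in> idx2" "be \<in> idx2" for al a b be
    using that(1,3,4) comp3_canon[OF that(2) _ _ that(1), of _ _ s] unfolding idx2_def insert_iff empty_iff
    by (elim disjE; simp add: low3_def idx2_def omega_def)
  have low4: "low4 ?phi a al b ga = -2 * omega al ga * sym2 s b a"
    if "a \<in> idx2" "al \<in> idx2" "b \<in> idx2" "ga \<in> idx2" for a al b ga
    using that(2,4) comp4_canon[OF that(3,1,2), of _ s] unfolding idx2_def insert_iff empty_iff
    by (elim disjE; simp add: low4_def idx2_def omega_def)
  show ?thesis
    unfolding canonical_form_def
  proof (intro conjI ballI allI impI)
    show "canon_slot i j k \<or> canon_slot j i k" if "?phi i j k \<noteq> 0" for i j k by (rule slot[OF that])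
  next
    fix a b be ga assume i: "a \<in> idx2" "b \<in> idx2" "be \<in> idx2" "ga \<in> idx2"
    show "low1 ?phi a b be ga = low1 ?phi b a be ga" by (simp only: low i sym[of a b])
    show "low1 ?phi a b be ga = - low1 ?phi a b ga be"
      unfolding low[OF i] low[OF i(1,2,4,3)] skew[of be ga] by simp
    show "low3 ?phi a b be ga = low3 ?phi a be b ga" by (simp only: low3 i sym[of b be])
    show "low3 ?phi a b be ga = - low3 ?phi ga b be a"
      unfolding low3[OF i] low3[OF i(4,2,3,1)] skew[of ga a] by simp
    show "low4 ?phi a b be ga = low4 ?phi be b a ga" by (simp only: low4 i sym[of be a])
    show "low4 ?phi a b be ga = - low4 ?phi a ga be b"
      unfolding low4[OF i] low4[OF i(1,4,3,2)] skew[of b ga] by simp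
    show "comp4 ?phi b be a ga = -2 * comp1 ?phi a b be ga" by (simp add: comp4_canon comp1_canon i)
    show "low3 ?phi a b be ga = low1 ?phi b be ga a" by (simp only: low low3 i)
  qed (rule parts)
qed

section \<open>Existence and uniqueness of canonical representatives\<close>

lemma functional_vanishes:
  assumes "collect (comb_row (row1 False) l) = []"
  shows "(\<Sum>(a, x)\<leftarrow>l. of_int a * (case x of (i, j, k) \<Rightarrow> ce_d1 0 psi i j k)) = 0"
proof -
  have d1: "ce_d1 0 psi i j k = ev (\<lambda>(i, k). psi i k) (row1 False (i, j, k)) / 24" for i j k
    using ce_d1_row[of False] by simp
  have "(\<Sum>(a, x)\<leftarrow>l. of_int a * (case x of (i, j, k) \<Rightarrow> ce_d1 0 psi i j k))
      = ev (\<lambda>(i, k). psi i k) (comb_row (row1 False) l) / 24"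
    by (induction l) (auto simp: comb_row_def ev_map_scale d1 add_divide_distrib)
  then show ?thesis using ev_collect_Nil[OF assms] by simp
qed

lemma coboundary_functionals:
  assumes "coboundary2 2 0 chi"
  shows "8 * chi 5 7 18 - 16 * chi 3 5 9 + chi 7 7 16 = 0"
    and "4 * chi 1 8 4 + 8 * chi 1 5 2 + 12 * chi 3 10 6 + 24 * chi 3 5 7 - 3 * chi 8 10 17 = 0"
    and "8 * chi 6 10 19 + 16 * chi 3 6 7 - chi 10 10 17 = 0"
proof -
  obtain psi where psi: "\<forall>i\<in>G3M. \<forall>j\<in>G3M. chi i j = ce_d1 0 psi i j"
    using assms unfolding coboundary2_def by blast
  then have chi: "chi i j = ce_d1 0 psi i j" if "i < 11" "j < 11" for i j
    using that by (simp add: G3M_def)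
  note f = functional11[THEN functional_vanishes, of psi] functional12[THEN functional_vanishes, of psi]
    functional22[THEN functional_vanishes, of psi]
  show "8 * chi 5 7 18 - 16 * chi 3 5 9 + chi 7 7 16 = 0"
    using f(1) by (simp add: chi algebra_simps)
  show "4 * chi 1 8 4 + 8 * chi 1 5 2 + 12 * chi 3 10 6 + 24 * chi 3 5 7 - 3 * chi 8 10 17 = 0"
    using f(2) by (simp add: chi algebra_simps)
  show "8 * chi 6 10 19 + 16 * chi 3 6 7 - chi 10 10 17 = 0"
    using f(3) by (simp add: chi algebra_simps)
qed

text \<open>Each of the three functionals kills coboundaries, takes the value -20 on its own
  canonical cocycle and 0 on the other two. Its value on \<open>phi\<close> therefore determines one
  entry of the triple.\<close>

lemma canon_unique:
  assumes "coboundary2 2 0 (\<lambda>i j k. phi i j k - canon s i j k)"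
    "coboundary2 2 0 (\<lambda>i j k. phi i j k - canon s' i j k)"
  shows "s = s'"
proof -
  have "fst s = fst s'"
    using coboundary_functionals(1)[OF assms(1)] coboundary_functionals(1)[OF assms(2)]
    by (simp add: canon_eval algebra_simps) (metis add_right_imp_eq mult_right_cancel zero_neq_numeral)
  moreover have "fst (snd s) = fst (snd s')"
    using coboundary_functionals(2)[OF assms(1)] coboundary_functionals(2)[OF assms(2)]
    by (simp add: canon_eval algebra_simps) (metis add_right_imp_eq mult_right_cancel zero_neq_numeral)
  moreover have "snd (snd s) = snd (snd s')"
    using coboundary_functionals(3)[OF assms(1)] coboundary_functionals(3)[OF assms(2)]
    by (simp add: canon_eval algebra_simps) (metis add_right_imp_eq mult_right_cancel zero_neq_numeral)
  ultimately show ?thesis by (simp add: prod_eq_iff)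
qed

lemma canon_exists:
  assumes "cocycle2 2 0 phi"
  obtains s where "coboundary2 2 0 (\<lambda>i j k. phi i j k - canon s i j k)"
proof -
  have phi: "cocycle2 2 (of_bool False) phi" using assms by simp
  obtain psi where psi: "is_cochain1 2 (of_bool False) psi"
    "\<And>i j k. (i, j, k) \<in> fst ` set (gauge cert2_2e) \<Longrightarrow> phi i j k - ce_d1 (of_bool False) psi i j k = 0"
    "cocycle2 2 (of_bool False) (\<lambda>i j k. phi i j k - ce_d1 (of_bool False) psi i j k)"
    using normal_form2[OF gauge_2e phi] by blast
  define chi where "chi = (\<lambda>i j k. phi i j k - ce_d1 (of_bool False) psi i j k)"
  \<comment> \<open>The canonical cocycle has to agree with \<open>chi\<close> on the three
    surviving coordinates. The signs are those of the entries there: -1 for \<open>canon11\<close>,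
    1 for \<open>canon12\<close>, -1 for \<open>canon22\<close>.\<close>
  define s where "s = (- chi 5 8 19, chi 3 6 9, - chi 6 10 19)"
  have "cocycle2 2 (of_bool False) (\<lambda>i j k. chi i j k - canon s i j k)"
    using cocycle2_diff[OF psi(3), of "canon s"] canon_cocycle[of s] by (simp add: chi_def)
  moreover have "chi i j k - canon s i j k = 0"
    if "(i, j, k) \<in> fst ` set (gauge cert2_2e) \<union> set [(5, 8, 19), (3, 6, 9), (6, 10, 19)]" for i j k
    using that
  proof
    assume *: "(i, j, k) \<in> fst ` set (gauge cert2_2e)"
    then have "i \<le> j" "lookup canon11 (i, j, k) = 0" "lookup canon12 (i, j, k) = 0" "lookup canon22 (i, j, k) = 0"
      using canon_gauge by (auto simp: list_all_iff)
    then have "canon s i j k = 0" by (simp add: canon_def skew_ext_def vec_def)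
    then show ?thesis using psi(2)[OF *] by (simp add: chi_def)
  next
    assume "(i, j, k) \<in> set [(5, 8, 19), (3, 6, 9), (6, 10, 19)]"
    then consider "(i, j, k) = (5, 8, 19)" | "(i, j, k) = (3, 6, 9)" | "(i, j, k) = (6, 10, 19)"
      by auto
    then show ?thesis by cases (simp_all add: s_def canon_eval)
  qed
  ultimately have "chi i j k - canon s i j k = 0" for i j k
    using cocycle2_vanishes[OF cover_2e] by blast
  then have "phi i j k - canon s i j k = ce_d1 0 psi i j k" for i j k
    by (simp add: chi_def algebra_simps)
  then have "coboundary2 2 0 (\<lambda>i j k. phi i j k - canon s i j k)"
    unfolding coboundary2_def using psi(1) by auto
  then show ?thesis using that by blast
qed

section \<open>The module S^2 C^2 x Lambda^2 C^2 and the isomorphism\<close>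

definition tensor :: "complex \<times> complex \<times> complex \<Rightarrow> nat \<Rightarrow> nat \<Rightarrow> nat \<Rightarrow> nat \<Rightarrow> complex" where
  "tensor s = (\<lambda>a b be ga. omega be ga *
     (if a = 2 \<and> b = 2 then fst s else if a = 1 \<and> b = 1 then snd (snd s)
      else if a = 1 \<and> b = 2 \<or> a = 2 \<and> b = 1 then - fst (snd s) else 0))"

lemma tensor_S2L2: "tensor s \<in> S2L2"
proof -
  have om: "omega be ga = - omega ga be" "omega be ga \<noteq> 0 \<Longrightarrow> be \<in> idx2 \<and> ga \<in> idx2" for be ga
    by (auto simp: omega_def idx2_def split: if_splits)
  have "a \<in> idx2 \<and> b \<in> idx2 \<and> be \<in> idx2 \<and> ga \<in> idx2" if "tensor s a b be ga \<noteq> 0" for a b be ga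
    using that om(2)[of be ga] by (auto simp: tensor_def idx2_def split: if_splits)
  moreover have "tensor s a b be ga = tensor s b a be ga" for a b be ga
    by (cases "a = 1"; cases "a = 2"; cases "b = 1"; cases "b = 2"; simp add: tensor_def)
  moreover have "tensor s a b be ga = - tensor s a b ga be" for a b be ga
    unfolding tensor_def by (subst om(1)) simp
  ultimately show ?thesis unfolding S2L2_def by blast
qed

lemma low_tensor: "low (tensor s) = s"
  by (simp add: low_def tensor_def omega_def)

text \<open>Lambda^2 C^2 is spanned by omega, so a tensor in \<open>S2L2\<close> is a symmetric 2 x
  2 matrix times omega. \<open>tensor\<close> raises the latin indices that \<open>low\<close> has
  lowered.\<close>

lemma tensor_low:
  assumes "t \<in> S2L2"
  shows "tensor (low t) = t"
proof (intro ext)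
  fix a b be ga
  have sym: "t x y be ga = t y x be ga" and skew: "t x y be ga = - t x y ga be"
    and supp: "t x y be ga \<noteq> 0 \<Longrightarrow> x \<in> idx2 \<and> y \<in> idx2 \<and> be \<in> idx2 \<and> ga \<in> idx2" for x y be ga
    using assms unfolding S2L2_def by blast+
  have diag: "t x y be be = 0" for x y be
    using skew[of x y be be] by (metis add.right_inverse mult_2 mult_eq_0_iff zero_neq_numeral)
  have "tensor (low t) a b be ga = t a b be ga" if "a \<in> idx2" "b \<in> idx2" "be \<in> idx2" "ga \<in> idx2"
    using that diag skew[of _ _ 2 1] sym[of 2 1]
    unfolding idx2_def insert_iff empty_iff by (elim disjE; simp add: tensor_def low_def omega_def)
  moreover have "tensor (low t) a b be ga = t a b be ga"
    if "\<not> (a \<in> idx2 \<and> b \<in> idx2 \<and> be \<in> idx2 \<and> ga \<in> idx2)"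
  proof -
    have "t a b be ga = 0" using supp that by blast
    moreover have "tensor (low t) a b be ga = 0" using that by (auto simp: tensor_def idx2_def omega_def)
    ultimately show ?thesis by simp
  qed
  ultimately show "tensor (low t) a b be ga = t a b be ga" by blast
qed

lemma H22_iso: H22_iso_S2L2
  unfolding H22_iso_S2L2_def
proof (intro exI[of _ "\<lambda>t. canon (low t)"] conjI ballI allI impI)
  fix t show "cocycle2 2 0 (canon (low t))" by (rule canon_cocycle)
next
  fix t u :: "nat \<Rightarrow> nat \<Rightarrow> nat \<Rightarrow> nat \<Rightarrow> complex" and c e
  show "canon (low (\<lambda>a b be ga. c * t a b be ga + e * u a b be ga))
      = (\<lambda>i j k. c * canon (low t) i j k + e * canon (low u) i j k)"
    by (simp add: canon_def low_def algebra_simps)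
next
  fix phi assume "cocycle2 2 0 phi"
  then obtain s where s: "coboundary2 2 0 (\<lambda>i j k. phi i j k - canon s i j k)"
    using canon_exists by blast
  show "\<exists>!t. t \<in> S2L2 \<and> coboundary2 2 0 (\<lambda>i j k. phi i j k - canon (low t) i j k)"
  proof (rule ex1I[of _ "tensor s"])
    show "tensor s \<in> S2L2 \<and> coboundary2 2 0 (\<lambda>i j k. phi i j k - canon (low (tensor s)) i j k)"
      using s tensor_S2L2 by (simp add: low_tensor)
    fix t assume t: "t \<in> S2L2 \<and> coboundary2 2 0 (\<lambda>i j k. phi i j k - canon (low t) i j k)"
    then have "low t = s" using canon_unique s by blast
    then show "t = tensor s" using tensor_low t by metis
  qed
next
  fix X t assume "t \<in> S2L2" "in_sl2sp2 X"
  obtain a b c where s: "low t = (a, b, c)" by (metis prod.collapse)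
  have "act_C2 X (canon (low t)) i j k - canon (low (act_T X t)) i j k = 0" if "i \<in> G3M" "j \<in> G3M" for i j k
    unfolding low_act_T[OF \<open>in_sl2sp2 X\<close> \<open>t \<in> S2L2\<close> s] s
    by (simp add: act_C2_canon[OF \<open>in_sl2sp2 X\<close> that])
  \<comment> \<open>On m the two cochains agree exactly, not only up to a coboundary, so the zero
    1-cochain is the witness.\<close>
  moreover have "ce_d1 0 (\<lambda>_ _. 0) i j k = 0" for i j k
    by (simp add: ce_d1_def gbr_def apply1_def)
  ultimately show "coboundary2 2 0 (\<lambda>i j k. act_C2 X (canon (low t)) i j k - canon (low (act_T X t)) i j k)"
    unfolding coboundary2_def by (intro exI[of _ "\<lambda>_ _. 0"]) (auto simp: is_cochain1_def fun_eq_iff)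
qed

section \<open>Collecting the degrees\<close>

lemma int_upto_cases: "0 \<le> (d::int) \<Longrightarrow> d = 0 \<or> d = 1 \<or> d = 2 \<or> d = 3 \<or> d = 4 \<or> d = 5 \<or> d = 6 \<or> d = 7
    \<or> d = 8 \<or> d = 9 \<or> d > 9"
  by presburger

lemma H1_zero_all:
  assumes "(d::int) \<ge> 0"
  shows "H1_zero d (of_bool p)"
  using int_upto_cases[OF assms] H1_zero_large[of d p]
    H1_0e H1_1e H1_2e H1_3e H1_4e H1_5e H1_6e H1_0o H1_1o H1_2o H1_3o H1_4o H1_5o H1_6o
  by (cases p) auto

lemma H2_zero_all:
  assumes "(d::int) > 0" "p \<or> d \<noteq> 2"
  shows "H2_zero d (of_bool p)"
  using int_upto_cases[of d] assms H2_zero_large[of d p]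
    H2_1e H2_3e H2_4e H2_5e H2_6e H2_7e H2_8e H2_9e
    H2_1o H2_2o H2_3o H2_4o H2_5o H2_6o H2_7o H2_8o H2_9o
  by (cases p) auto

theorem theorem3p20:
  shows "(\<forall>d::int. d \<ge> 0 \<longrightarrow> H1_zero d 0 \<and> H1_zero d 1)
       \<and> (\<forall>d::int. d > 0 \<and> d \<noteq> 2 \<longrightarrow> H2_zero d 0)
       \<and> H22_iso_S2L2
       \<and> (\<forall>d::int. d > 0 \<longrightarrow> H2_zero d 1)
       \<and> (\<forall>phi. cocycle2 2 0 phi \<longrightarrow>
            (\<exists>phi'. cocycle2 2 0 phi' \<and> coboundary2 2 0 (\<lambda>i j k. phi i j k - phi' i j k)
                    \<and> canonical_form phi'))"
proof (intro conjI allI impI)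
  fix phi assume "cocycle2 2 0 phi"
  then obtain s where "coboundary2 2 0 (\<lambda>i j k. phi i j k - canon s i j k)"
    using canon_exists by blast
  then show "\<exists>phi'. cocycle2 2 0 phi' \<and> coboundary2 2 0 (\<lambda>i j k. phi i j k - phi' i j k)
      \<and> canonical_form phi'"
    using canon_cocycle canonical_form_canon by blast
next
  show "H1_zero d 0" "H1_zero d 1" if "d \<ge> 0" for d
    using H1_zero_all[OF that, of False] H1_zero_all[OF that, of True] by simp_all
next
  show "H2_zero d 0" if "d > 0 \<and> d \<noteq> 2" for d using H2_zero_all[of d False] that by simp
next
  show "H2_zero d 1" if "d > 0" for d using H2_zero_all[of d True] that by simp
qed (rule H22_iso)

end
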